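(* Let $\mathcal{H}=\mathcal{H}_1\oplus\mathcal{H}_2$ be a nontrivial orthogonal decomposition of a complex Hilbert space and suppose that $T=\begin{bmatrix} V & E\\ 0 & Q\end{bmatrix}\in\mathcal{Q}_{\mathcal{H}_1,\mathcal{H}_2}$ and $E\neq 0$. Then the following assertions hold: (i) $0\in\mathscr{S}^{\dag}(T)$; (ii) $\mathscr{S}^{\dag}(T)\setminus\{0\}\neq\emptyset$ if and only if $\sigma_{\sharp}(|Q|,|E|)\subseteq[0,1]\times(0,\infty)$ and $\beta^{\dag}(T)>0$; (iii) if $\mathscr{S}^{\dag}(T)\setminus\{0\}\neq\emptyset$, then $\mathscr{S}^{\dag}(T)=[0,\beta^{\dag}(T)]$. Moreover, if $\sigma_{\sharp}(|Q|,|E|)\subseteq[0,1]\times(0,\infty)$, then $$\mathscr{S}^{\dag}(T)=\{0\}\iff\beta^{\dag}(T)=0.$$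
   Context: $B(\mathcal{H},\mathcal{K})$ denotes the bounded linear operators between complex Hilbert spaces, $B(\mathcal{H})=B(\mathcal{H},\mathcal{H})$; $|T|=(T^*T)^{1/2}$; $\mathbb{R}_+=[0,\infty)$. Class $\mathcal{Q}$: an orthogonal decomposition $\mathcal{H}=\mathcal{H}_1\oplus\mathcal{H}_2$ is nontrivial if $\mathcal{H}_1\neq\{0\}$ and $\mathcal{H}_2\neq\{0\}$. For such a decomposition, $T=\begin{bmatrix} V & E\\ 0 & Q\end{bmatrix}\in\mathcal{Q}_{\mathcal{H}_1,\mathcal{H}_2}$ means that $T\in B(\mathcal{H})$ has this block form with $V\in B(\mathcal{H}_1)$, $E\in B(\mathcal{H}_2,\mathcal{H}_1)$, $Q\in B(\mathcal{H}_2)$ satisfying $V^*V=I$, $V^*E=0$, $QE^*E=E^*EQ$, and $Q$ is quasinormal, i.e. $QQ^*Q=Q^*QQ$. Then $|Q|$ and $|E|$ are commuting positive operators; $\sigma(|Q|,|E|)$ denotes the Taylor spectrum of the pair $(|Q|,|E|)$, and $\sigma_{\sharp}(|Q|,|E|):=\sigma(|Q|,|E|)\cap(\mathbb{R}_+\times(0,\infty))$ (this set is nonempty if and only if $E\neq0$). For $\lambda\in\mathbb{C}$ set $T^{\dag}(\lambda)=\begin{bmatrix} V & \lambda E\\ 0 & Q\end{bmatrix}$, and let $$\mathscr{S}^{\dag}(T)=\{\alpha\in\mathbb{R}_+: T^{\dag}(\alpha)\text{ is subnormal}\}.$$ If $E\neq0$ and $\sigma_{\sharp}(|Q|,|E|)\subseteq[0,1]\times(0,\infty)$,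 define $$\beta^{\dag}(T)=\inf_{(s,t)\in\sigma_{\sharp}(|Q|,|E|)}\sqrt{\frac{1-s^2}{t^2}}\in\mathbb{R}_+.$$ An operator is subnormal if it is the restriction to its space $\mathcal{H}$ of a normal operator on some complex Hilbert space $\mathcal{K}\supseteq\mathcal{H}$. *)

theory Defs
  imports "HOL-Analysis.Analysis"
begin

section \<open>Complex Hilbert spaces and bounded operators\<close>

text \<open>
  A complex Hilbert space is a real Hilbert space of the library together with a complex scalar
  multiplication extending the real one and a complex inner product, linear in its first
  argument, whose real part is the real inner product. Positive definiteness and the formula
  for the norm are inherited from \<^class>\<open>real_inner\<close>.
\<close>

class chilbert_space = real_inner + complete_space +
  fixes scaleC :: "complex \<Rightarrow> 'a \<Rightarrow> 'a"  (infixr "*\<^sub>C" 75)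
    and cinner :: "'a \<Rightarrow> 'a \<Rightarrow> complex"
  assumes scaleC_add_right: "a *\<^sub>C (x + y) = a *\<^sub>C x + a *\<^sub>C y"
    and scaleC_add_left: "(a + b) *\<^sub>C x = a *\<^sub>C x + b *\<^sub>C x"
    and scaleC_scaleC: "a *\<^sub>C b *\<^sub>C x = (a * b) *\<^sub>C x"
    and scaleR_scaleC: "r *\<^sub>R x = complex_of_real r *\<^sub>C x"
    and cinner_add_left: "cinner (x + y) z = cinner x z + cinner y z"
    and cinner_scaleC_left: "cinner (a *\<^sub>C x) y = a * cinner x y"
    and cinner_commute: "cinner x y = cnj (cinner y x)"
    and inner_eq_Re_cinner: "inner x y = Re (cinner x y)"

text \<open>
  The orthogonal sum of two Hilbert spaces is their product, with the library's
  inner product \<^term>\<open>inner (x, y) (x', y') = inner x x' + inner y y'\<close>.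
\<close>

instantiation prod :: (chilbert_space, chilbert_space) chilbert_space
begin

definition scaleC_prod_def: "a *\<^sub>C z = (a *\<^sub>C fst z, a *\<^sub>C snd z)"

definition cinner_prod_def: "cinner z w = cinner (fst z) (fst w) + cinner (snd z) (snd w)"

instance
proof
  fix a b :: complex and r :: real and x y z :: "'a \<times> 'b"
  show "a *\<^sub>C (x + y) = a *\<^sub>C x + a *\<^sub>C y"
    by (simp add: scaleC_prod_def scaleC_add_right)
  show "(a + b) *\<^sub>C x = a *\<^sub>C x + b *\<^sub>C x"
    by (simp add: scaleC_prod_def scaleC_add_left)
  show "a *\<^sub>C b *\<^sub>C x = (a * b) *\<^sub>C x"
    by (simp add: scaleC_prod_def scaleC_scaleC)
  show "r *\<^sub>R x = complex_of_real r *\<^sub>C x"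
    by (simp add: scaleC_prod_def scaleR_prod_def scaleR_scaleC)
  show "cinner (x + y) z = cinner x z + cinner y z"
    by (simp add: cinner_prod_def cinner_add_left)
  show "cinner (a *\<^sub>C x) y = a * cinner x y"
    by (simp add: cinner_prod_def scaleC_prod_def cinner_scaleC_left algebra_simps)
  show "cinner x y = cnj (cinner y x)"
    unfolding cinner_prod_def complex_cnj_add by (metis cinner_commute)
  show "inner x y = Re (cinner x y)"
    by (simp add: cinner_prod_def inner_prod_def inner_eq_Re_cinner)
qed

end

definition bounded_clinear :: "('a::chilbert_space \<Rightarrow> 'b::chilbert_space) \<Rightarrow> bool" where
  "bounded_clinear A \<longleftrightarrow> bounded_linear A \<and> (\<forall>c x. A (c *\<^sub>C x) = c *\<^sub>C A x)"

definition cadj :: "('a::chilbert_space \<Rightarrow> 'b::chilbert_space) \<Rightarrow> 'b \<Rightarrow> 'a" where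
  "cadj A = (THE B. \<forall>x y. cinner (A x) y = cinner x (B y))"

definition positive_op :: "('a::chilbert_space \<Rightarrow> 'a) \<Rightarrow> bool" where
  "positive_op A \<longleftrightarrow> bounded_clinear A \<and> (\<forall>x. cinner (A x) x \<in> \<real> \<and> 0 \<le> Re (cinner (A x) x))"

definition op_abs :: "('a::chilbert_space \<Rightarrow> 'b::chilbert_space) \<Rightarrow> 'a \<Rightarrow> 'a" where
  "op_abs A = (THE P. positive_op P \<and> P \<circ> P = cadj A \<circ> A)"

definition quasinormal :: "('a::chilbert_space \<Rightarrow> 'a) \<Rightarrow> bool" where
  "quasinormal Q \<longleftrightarrow> bounded_clinear Q \<and> Q \<circ> cadj Q \<circ> Q = cadj Q \<circ> Q \<circ> Q"


section \<open>Taylor spectrum of a commuting pair\<close>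

text \<open>
  The Koszul complex of a commuting pair \<open>(A, B)\<close> on \<open>H\<close> is
  \<open>0 \<rightarrow> H \<rightarrow> H \<times> H \<rightarrow> H \<rightarrow> 0\<close> with the two boundary maps below.
\<close>

definition koszul0 :: "('a \<Rightarrow> 'a) \<Rightarrow> ('a \<Rightarrow> 'a) \<Rightarrow> 'a \<Rightarrow> 'a \<times> 'a" where
  "koszul0 A B x = (A x, B x)"

definition koszul1 :: "('a::chilbert_space \<Rightarrow> 'a) \<Rightarrow> ('a \<Rightarrow> 'a) \<Rightarrow> 'a \<times> 'a \<Rightarrow> 'a" where
  "koszul1 A B p = A (snd p) - B (fst p)"

definition koszul_exact :: "('a::chilbert_space \<Rightarrow> 'a) \<Rightarrow> ('a \<Rightarrow> 'a) \<Rightarrow> bool" where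
  "koszul_exact A B \<longleftrightarrow>
     {x. koszul0 A B x = 0} = {0} \<and>
     range (koszul0 A B) = {p. koszul1 A B p = 0} \<and>
     range (koszul1 A B) = UNIV"

definition taylor_spectrum ::
    "('a::chilbert_space \<Rightarrow> 'a) \<Rightarrow> ('a \<Rightarrow> 'a) \<Rightarrow> (complex \<times> complex) set" where
  "taylor_spectrum A B =
     {(z, w). \<not> koszul_exact (\<lambda>x. A x - z *\<^sub>C x) (\<lambda>x. B x - w *\<^sub>C x)}"


section \<open>Subnormal operators\<close>

text \<open>
  The space of a normal extension cannot be quantified over as a type, so it is given by a
  carrier set with its own operations.
\<close>

record 'k hilbert_struct =
  carrier :: "'k set"
  zer :: 'k
  add :: "'k \<Rightarrow> 'k \<Rightarrow> 'k"
  scl :: "complex \<Rightarrow> 'k \<Rightarrow> 'k"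
  ip :: "'k \<Rightarrow> 'k \<Rightarrow> complex"

definition nrm :: "'k hilbert_struct \<Rightarrow> 'k \<Rightarrow> real" where
  "nrm K x = sqrt (Re (ip K x x))"

definition dst :: "'k hilbert_struct \<Rightarrow> 'k \<Rightarrow> 'k \<Rightarrow> real" where
  "dst K x y = nrm K (add K x (scl K (- 1) y))"

locale hilbert_space_on =
  fixes K :: "'k hilbert_struct"
  assumes zer_closed: "zer K \<in> carrier K"
    and add_closed: "x \<in> carrier K \<Longrightarrow> y \<in> carrier K \<Longrightarrow> add K x y \<in> carrier K"
    and scl_closed: "x \<in> carrier K \<Longrightarrow> scl K a x \<in> carrier K"
    and add_assoc: "x \<in> carrier K \<Longrightarrow> y \<in> carrier K \<Longrightarrow> z \<in> carrier K \<Longrightarrow>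
          add K (add K x y) z = add K x (add K y z)"
    and add_commute: "x \<in> carrier K \<Longrightarrow> y \<in> carrier K \<Longrightarrow> add K x y = add K y x"
    and add_zer: "x \<in> carrier K \<Longrightarrow> add K x (zer K) = x"
    and scl_add_right: "x \<in> carrier K \<Longrightarrow> y \<in> carrier K \<Longrightarrow>
          scl K a (add K x y) = add K (scl K a x) (scl K a y)"
    and scl_add_left: "x \<in> carrier K \<Longrightarrow> scl K (a + b) x = add K (scl K a x) (scl K b x)"
    and scl_scl: "x \<in> carrier K \<Longrightarrow> scl K a (scl K b x) = scl K (a * b) x"
    and scl_one: "x \<in> carrier K \<Longrightarrow> scl K 1 x = x"
    and scl_0: "x \<in> carrier K \<Longrightarrow> scl K 0 x = zer K"
    and ip_add_left: "x \<in> carrier K \<Longrightarrow> y \<in> carrier K \<Longrightarrow> z \<in> carrier K \<Longrightarrow>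
          ip K (add K x y) z = ip K x z + ip K y z"
    and ip_scl_left: "x \<in> carrier K \<Longrightarrow> y \<in> carrier K \<Longrightarrow> ip K (scl K a x) y = a * ip K x y"
    and ip_commute: "x \<in> carrier K \<Longrightarrow> y \<in> carrier K \<Longrightarrow> ip K x y = cnj (ip K y x)"
    and ip_ge_0: "x \<in> carrier K \<Longrightarrow> 0 \<le> Re (ip K x x)"
    and ip_eq_0: "x \<in> carrier K \<Longrightarrow> ip K x x = 0 \<Longrightarrow> x = zer K"
    and complete:
      "\<lbrakk>\<And>n. X n \<in> carrier K;
        \<forall>e>0. \<exists>M::nat. \<forall>m\<ge>M. \<forall>n\<ge>M. dst K (X m) (X n) < e\<rbrakk>
       \<Longrightarrow> \<exists>l\<in>carrier K. (\<lambda>n. dst K (X n) l) \<longlonglongrightarrow> 0"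

definition bounded_op_on :: "'k hilbert_struct \<Rightarrow> ('k \<Rightarrow> 'k) \<Rightarrow> bool" where
  "bounded_op_on K N \<longleftrightarrow>
     (\<forall>x\<in>carrier K. N x \<in> carrier K) \<and>
     (\<forall>x\<in>carrier K. \<forall>y\<in>carrier K. N (add K x y) = add K (N x) (N y)) \<and>
     (\<forall>a. \<forall>x\<in>carrier K. N (scl K a x) = scl K a (N x)) \<and>
     (\<exists>C. \<forall>x\<in>carrier K. nrm K (N x) \<le> C * nrm K x)"

definition adjoint_on :: "'k hilbert_struct \<Rightarrow> ('k \<Rightarrow> 'k) \<Rightarrow> ('k \<Rightarrow> 'k) \<Rightarrow> bool" where
  "adjoint_on K N M \<longleftrightarrow> bounded_op_on K M \<and>
     (\<forall>x\<in>carrier K. \<forall>y\<in>carrier K. ip K (N x) y = ip K x (M y))"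

definition normal_op_on :: "'k hilbert_struct \<Rightarrow> ('k \<Rightarrow> 'k) \<Rightarrow> bool" where
  "normal_op_on K N \<longleftrightarrow> bounded_op_on K N \<and>
     (\<exists>M. adjoint_on K N M \<and> (\<forall>x\<in>carrier K. N (M x) = M (N x)))"

definition isometric_embedding :: "('h::chilbert_space \<Rightarrow> 'k) \<Rightarrow> 'k hilbert_struct \<Rightarrow> bool" where
  "isometric_embedding J K \<longleftrightarrow>
     (\<forall>x. J x \<in> carrier K) \<and>
     (\<forall>x y. J (x + y) = add K (J x) (J y)) \<and>
     (\<forall>a x. J (a *\<^sub>C x) = scl K a (J x)) \<and>
     (\<forall>x y. ip K (J x) (J y) = cinner x y)"

definition normal_extension ::
    "('h::chilbert_space \<Rightarrow> 'h) \<Rightarrow> 'k hilbert_struct \<Rightarrow> ('h \<Rightarrow> 'k) \<Rightarrow> ('k \<Rightarrow> 'k) \<Rightarrow> bool" where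
  "normal_extension T K J N \<longleftrightarrow>
     hilbert_space_on K \<and> isometric_embedding J K \<and> normal_op_on K N \<and> (\<forall>h. N (J h) = J (T h))"

text \<open>
  The underlying set of \<open>K\<close> is taken inside \<open>nat \<Rightarrow> 'h\<close>. This is no restriction:
  \<open>subnormalI\<close> at the end of this theory accepts a normal extension over any type.
\<close>

definition subnormal :: "('h::chilbert_space \<Rightarrow> 'h) \<Rightarrow> bool" where
  "subnormal T \<longleftrightarrow> (\<exists>(K :: (nat \<Rightarrow> 'h) hilbert_struct) J N. normal_extension T K J N)"


section \<open>The class \<open>\<Q>\<close>\<close>

text \<open>
  Here \<open>H\<^sub>1 = 'a\<close>, \<open>H\<^sub>2 = 'b\<close> and \<open>H = 'a \<times> 'b\<close>. The functions below take the blocks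
  \<open>V, E, Q\<close>, which the operator \<open>T = block_op V E Q\<close> determines, in place of \<open>T\<close>.
\<close>

definition block_op ::
    "('a::chilbert_space \<Rightarrow> 'a) \<Rightarrow> ('b::chilbert_space \<Rightarrow> 'a) \<Rightarrow> ('b \<Rightarrow> 'b) \<Rightarrow> 'a \<times> 'b \<Rightarrow> 'a \<times> 'b"
  where "block_op V E Q z = (V (fst z) + E (snd z), Q (snd z))"

definition class_Q ::
    "('a::chilbert_space \<Rightarrow> 'a) \<Rightarrow> ('b::chilbert_space \<Rightarrow> 'a) \<Rightarrow> ('b \<Rightarrow> 'b) \<Rightarrow> bool" where
  "class_Q V E Q \<longleftrightarrow>
     bounded_clinear V \<and> bounded_clinear E \<and> bounded_clinear Q \<and>
     cadj V \<circ> V = id \<and> cadj V \<circ> E = (\<lambda>_. 0) \<and>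
     Q \<circ> cadj E \<circ> E = cadj E \<circ> E \<circ> Q \<and> quasinormal Q"

definition dagger ::
    "('a::chilbert_space \<Rightarrow> 'a) \<Rightarrow> ('b::chilbert_space \<Rightarrow> 'a) \<Rightarrow> ('b \<Rightarrow> 'b) \<Rightarrow> complex
      \<Rightarrow> 'a \<times> 'b \<Rightarrow> 'a \<times> 'b"
  where "dagger V E Q c = block_op V (\<lambda>y. c *\<^sub>C E y) Q"

definition S_dagger ::
    "('a::chilbert_space \<Rightarrow> 'a) \<Rightarrow> ('b::chilbert_space \<Rightarrow> 'a) \<Rightarrow> ('b \<Rightarrow> 'b) \<Rightarrow> real set" where
  "S_dagger V E Q = {\<alpha>. 0 \<le> \<alpha> \<and> subnormal (dagger V E Q (complex_of_real \<alpha>))}"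

definition sigma_sharp ::
    "('b::chilbert_space \<Rightarrow> 'a::chilbert_space) \<Rightarrow> ('b \<Rightarrow> 'b) \<Rightarrow> (real \<times> real) set" where
  "sigma_sharp E Q =
     {(s, t). (complex_of_real s, complex_of_real t) \<in> taylor_spectrum (op_abs Q) (op_abs E)}
     \<inter> {0..} \<times> {0<..}"

text \<open>
  As in the source, only meaningful if \<^term>\<open>sigma_sharp E Q\<close> is nonempty and contained in
  \<^term>\<open>{0..1} \<times> {0<..}\<close>.
\<close>

definition beta_dagger ::
    "('b::chilbert_space \<Rightarrow> 'a::chilbert_space) \<Rightarrow> ('b \<Rightarrow> 'b) \<Rightarrow> real" where
  "beta_dagger E Q = (INF (s, t)\<in>sigma_sharp E Q. sqrt ((1 - s\<^sup>2) / t\<^sup>2))"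


section \<open>Independence of \<open>subnormal\<close> from the choice of carrier type\<close>

lemma (in hilbert_space_on) ip_add_right:
  assumes "x \<in> carrier K" "y \<in> carrier K" "z \<in> carrier K"
  shows "ip K x (add K y z) = ip K x y + ip K x z"
proof -
  have "ip K x (add K y z) = cnj (ip K y x + ip K z x)"
    using assms ip_commute[of x "add K y z"] by (simp add: ip_add_left add_closed)
  then show ?thesis
    using assms ip_commute[of x y] ip_commute[of x z] by simp
qed

lemma (in hilbert_space_on) ip_scl_right:
  assumes "x \<in> carrier K" "y \<in> carrier K"
  shows "ip K x (scl K a y) = cnj a * ip K x y"
proof -
  have "ip K x (scl K a y) = cnj (a * ip K y x)"
    using assms ip_commute[of x "scl K a y"] by (simp add: ip_scl_left scl_closed)
  then show ?thesis
    using assms ip_commute[of x y] by simp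
qed

lemma (in hilbert_space_on) Re_ip_commute:
  assumes "x \<in> carrier K" "y \<in> carrier K"
  shows "Re (ip K y x) = Re (ip K x y)"
  using ip_commute[OF assms] by simp

lemma (in hilbert_space_on) dst_sq:
  assumes "x \<in> carrier K" "y \<in> carrier K"
  shows "(dst K x y)\<^sup>2 = Re (ip K x x) + Re (ip K y y) - 2 * Re (ip K x y)"
proof -
  have "(dst K x y)\<^sup>2 = Re (ip K (add K x (scl K (- 1) y)) (add K x (scl K (- 1) y)))"
    using assms by (simp add: dst_def nrm_def ip_ge_0 add_closed scl_closed)
  also have "\<dots> = Re (ip K x x) + Re (ip K y y) - 2 * Re (ip K x y)"
    using assms Re_ip_commute[OF assms]
    by (simp add: ip_add_left ip_add_right ip_scl_left ip_scl_right add_closed scl_closed)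
  finally show ?thesis .
qed

lemma (in hilbert_space_on) dst_ge_0:
  assumes "x \<in> carrier K" "y \<in> carrier K"
  shows "0 \<le> dst K x y"
  using assms by (simp add: dst_def nrm_def ip_ge_0 add_closed scl_closed)

lemma (in hilbert_space_on) dst_commute:
  assumes "x \<in> carrier K" "y \<in> carrier K"
  shows "dst K x y = dst K y x"
proof (rule power2_eq_imp_eq)
  show "(dst K x y)\<^sup>2 = (dst K y x)\<^sup>2"
    using assms by (simp add: dst_sq Re_ip_commute)
qed (use assms dst_ge_0 in auto)

lemma (in hilbert_space_on) add_minus:
  assumes "x \<in> carrier K"
  shows "add K x (scl K (- 1) x) = zer K"
  using assms scl_add_left[of x 1 "- 1"] by (simp add: scl_one scl_0)

lemma (in hilbert_space_on) dst_self:
  assumes "x \<in> carrier K"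
  shows "dst K x x = 0"
proof -
  have "(dst K x x)\<^sup>2 = 0"
    using assms by (simp add: dst_sq)
  then show ?thesis by simp
qed

lemma (in hilbert_space_on) dst_eq_0:
  assumes xy: "x \<in> carrier K" "y \<in> carrier K" and "dst K x y = 0"
  shows "x = y"
proof -
  let ?d = "add K x (scl K (- 1) y)"
  have d: "?d \<in> carrier K"
    using xy by (simp add: add_closed scl_closed)
  have "Re (ip K ?d ?d) = 0"
    using assms(3) ip_ge_0[OF d] by (simp add: dst_def nrm_def)
  moreover have "Im (ip K ?d ?d) = 0"
    using ip_commute[OF d d] by (metis complex_In_mult_cnj_zero cnj.simps(2) neg_equal_zero)
  ultimately have "?d = zer K"
    using ip_eq_0[OF d] by (simp add: complex_eq_iff)
  then have "add K ?d y = add K (zer K) y" by simp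
  moreover have "add K ?d y = add K x (add K (scl K (- 1) y) y)"
    using xy by (simp add: add_assoc scl_closed)
  moreover have "add K (scl K (- 1) y) y = zer K"
    using xy add_minus add_commute scl_closed by metis
  ultimately show ?thesis
    using xy add_zer add_commute zer_closed by metis
qed

lemma (in hilbert_space_on) dst_triangle:
  assumes "x \<in> carrier K" "y \<in> carrier K" "z \<in> carrier K"
  shows "dst K x z \<le> 2 * dst K x y + 2 * dst K y z"
proof (rule power2_le_imp_le)
  let ?w = "add K (add K x z) (scl K (- 2) y)"
  have "0 \<le> Re (ip K ?w ?w)"
    using assms by (simp add: ip_ge_0 add_closed scl_closed)
  also have "Re (ip K ?w ?w) = 2 * (dst K x y)\<^sup>2 + 2 * (dst K y z)\<^sup>2 - (dst K x z)\<^sup>2"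
    using assms Re_ip_commute[of x y] Re_ip_commute[of y z] Re_ip_commute[of x z]
    by (simp add: dst_sq ip_add_left ip_add_right ip_scl_left ip_scl_right add_closed scl_closed)
  finally have "(dst K x z)\<^sup>2 \<le> 2 * (dst K x y)\<^sup>2 + 2 * (dst K y z)\<^sup>2" by simp
  also have "\<dots> \<le> (2 * dst K x y + 2 * dst K y z)\<^sup>2"
    using assms dst_ge_0[of x y] dst_ge_0[of y z]
    by (simp add: power2_sum power_mult_distrib)
  finally show "(dst K x z)\<^sup>2 \<le> (2 * dst K x y + 2 * dst K y z)\<^sup>2" .
qed (use assms dst_ge_0 in auto)

lemma (in hilbert_space_on) dst_add:
  assumes "x \<in> carrier K" "y \<in> carrier K" "u \<in> carrier K" "v \<in> carrier K"
  shows "dst K (add K x u) (add K y v) \<le> 2 * dst K x y + 2 * dst K u v"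
proof -
  have 1: "dst K (add K x u) (add K y u) = dst K x y"
    if "x \<in> carrier K" "y \<in> carrier K" "u \<in> carrier K" for x y u
  proof (rule power2_eq_imp_eq)
    show "(dst K (add K x u) (add K y u))\<^sup>2 = (dst K x y)\<^sup>2"
      using that Re_ip_commute[of x u] Re_ip_commute[of y u] Re_ip_commute[of x y]
      by (simp add: dst_sq ip_add_left ip_add_right add_closed)
  qed (use that dst_ge_0 add_closed in auto)
  have "dst K (add K x u) (add K y v)
      \<le> 2 * dst K (add K x u) (add K y u) + 2 * dst K (add K y u) (add K y v)"
    using assms by (intro dst_triangle) (auto simp: add_closed)
  then show ?thesis
    using 1[of x y u] 1[of u v y] assms by (simp add: add_commute)
qed

lemma (in hilbert_space_on) dst_bounded_op:
  assumes "bounded_op_on K N"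
  obtains C where "C > 0"
    "\<And>x y. x \<in> carrier K \<Longrightarrow> y \<in> carrier K \<Longrightarrow> dst K (N x) (N y) \<le> C * dst K x y"
proof -
  obtain C where C: "\<forall>x\<in>carrier K. nrm K (N x) \<le> C * nrm K x"
    using assms unfolding bounded_op_on_def by blast
  show thesis
  proof
    show "max C 1 > 0" by simp
    fix x y assume xy: "x \<in> carrier K" "y \<in> carrier K"
    let ?d = "add K x (scl K (- 1) y)"
    have d: "?d \<in> carrier K" using xy by (simp add: add_closed scl_closed)
    have "dst K (N x) (N y) = nrm K (N ?d)"
      using assms xy by (simp add: dst_def bounded_op_on_def scl_closed)
    also have "\<dots> \<le> C * dst K x y" using C d by (simp add: dst_def)
    also have "\<dots> \<le> max C 1 * dst K x y"
      using dst_ge_0[OF xy] by (intro mult_right_mono) auto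
    finally show "dst K (N x) (N y) \<le> max C 1 * dst K x y" .
  qed
qed

lemma (in hilbert_space_on) bounded_op_on_scl: "bounded_op_on K (scl K a)"
proof -
  have "nrm K (scl K a x) \<le> cmod a * nrm K x" if x: "x \<in> carrier K" for x
  proof -
    have "Re (ip K (scl K a x) (scl K a x)) = Re ((a * cnj a) * ip K x x)"
      using x by (simp add: ip_scl_left ip_scl_right scl_closed algebra_simps)
    also have "\<dots> = (cmod a)\<^sup>2 * Re (ip K x x)"
      by (simp only: complex_norm_square[symmetric]) simp
    finally show ?thesis by (simp add: nrm_def real_sqrt_mult)
  qed
  then show ?thesis
    unfolding bounded_op_on_def
    by (auto simp: scl_closed scl_add_right scl_scl mult.commute)
qed

text \<open>A complex subspace \<open>D\<close> has a Hilbert space as its closure.\<close>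

definition clos :: "'k hilbert_struct \<Rightarrow> 'k set \<Rightarrow> 'k set" where
  "clos K D = {l \<in> carrier K. \<forall>e>0. \<exists>x\<in>D. dst K x l < e}"

lemma (in hilbert_space_on) clos_image:
  assumes "bounded_op_on K N" "D \<subseteq> carrier K" "\<And>x. x \<in> D \<Longrightarrow> N x \<in> D" "l \<in> clos K D"
  shows "N l \<in> clos K D"
proof -
  obtain C where C: "C > 0"
    "\<And>x y. x \<in> carrier K \<Longrightarrow> y \<in> carrier K \<Longrightarrow> dst K (N x) (N y) \<le> C * dst K x y"
    using dst_bounded_op[OF assms(1)] by metis
  have l: "l \<in> carrier K" using assms(4) by (simp add: clos_def)
  have "\<exists>y\<in>D. dst K y (N l) < e" if "e > 0" for e
  proof -
    have "e / C > 0" using that C by simp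
    then obtain x where x: "x \<in> D" "dst K x l < e / C"
      using assms(4) unfolding clos_def by blast
    have "dst K (N x) (N l) \<le> C * dst K x l" using C x l assms(2) by blast
    also have "\<dots> < e" using x(2) C by (simp add: field_simps)
    finally show ?thesis using assms(3) x by blast
  qed
  then show ?thesis
    using assms(1) l by (simp add: clos_def bounded_op_on_def)
qed

lemma (in hilbert_space_on) clos_add:
  assumes "D \<subseteq> carrier K" "\<And>x y. x \<in> D \<Longrightarrow> y \<in> D \<Longrightarrow> add K x y \<in> D"
    and "l \<in> clos K D" "m \<in> clos K D"
  shows "add K l m \<in> clos K D"
proof -
  have lm: "l \<in> carrier K" "m \<in> carrier K" using assms by (auto simp: clos_def)
  have "\<exists>y\<in>D. dst K y (add K l m) < e" if "e > 0" for e
  proof -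
    have "e / 4 > 0" using that by simp
    then obtain x y where xy: "x \<in> D" "dst K x l < e / 4" "y \<in> D" "dst K y m < e / 4"
      using assms(3,4) unfolding clos_def by blast
    have "dst K (add K x y) (add K l m) \<le> 2 * dst K x l + 2 * dst K y m"
      using xy lm assms(1) by (intro dst_add) auto
    then have "dst K (add K x y) (add K l m) < e" using xy by simp
    then show ?thesis using assms(2) xy by blast
  qed
  then show ?thesis using lm by (simp add: clos_def add_closed)
qed

lemma (in hilbert_space_on) subset_clos: "D \<subseteq> carrier K \<Longrightarrow> D \<subseteq> clos K D"
  using dst_self by (force simp: clos_def)

lemma (in hilbert_space_on) hilbert_space_on_clos:
  assumes D: "D \<subseteq> carrier K" "zer K \<in> D"
    and D_add: "\<And>x y. x \<in> D \<Longrightarrow> y \<in> D \<Longrightarrow> add K x y \<in> D"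
    and D_scl: "\<And>a x. x \<in> D \<Longrightarrow> scl K a x \<in> D"
  shows "hilbert_space_on (K\<lparr>carrier := clos K D\<rparr>)"
proof -
  let ?K = "K\<lparr>carrier := clos K D\<rparr>"
  have car: "x \<in> carrier K" if "x \<in> clos K D" for x
    using that by (simp add: clos_def)
  have dst: "dst ?K = dst K"
    by (intro ext) (simp add: dst_def nrm_def)
  show ?thesis
  proof
    show "zer ?K \<in> carrier ?K" using subset_clos[OF D(1)] D(2) by auto
    show "add ?K x y \<in> carrier ?K" if "x \<in> carrier ?K" "y \<in> carrier ?K" for x y
      using clos_add[OF D(1) D_add] that by simp
    show "scl ?K a x \<in> carrier ?K" if "x \<in> carrier ?K" for a x
      using clos_image[OF bounded_op_on_scl D(1) D_scl] that by simp
    fix X :: "nat \<Rightarrow> _"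
    assume X: "\<And>n. X n \<in> carrier ?K"
      and "\<forall>e>0. \<exists>M::nat. \<forall>m\<ge>M. \<forall>n\<ge>M. dst ?K (X m) (X n) < e"
    then obtain l where l: "l \<in> carrier K" "(\<lambda>n. dst K (X n) l) \<longlonglongrightarrow> 0"
      using complete[of X] car by (auto simp: dst)
    have "\<exists>x\<in>D. dst K x l < e" if "e > 0" for e
    proof -
      have "e / 4 > 0" using that by simp
      then obtain n where n: "dst K (X n) l < e / 4"
        using order_tendstoD(2)[OF l(2)] by (metis eventually_sequentially order_refl)
      obtain x where x: "x \<in> D" "dst K x (X n) < e / 4"
        using X[of n, simplified] \<open>e / 4 > 0\<close> unfolding clos_def by blast
      have "dst K x l \<le> 2 * dst K x (X n) + 2 * dst K (X n) l"
        using x D(1) X car l by (intro dst_triangle) auto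
      then show ?thesis using x n by force
    qed
    then have "l \<in> carrier ?K" using l by (simp add: clos_def)
    then show "\<exists>l\<in>carrier ?K. (\<lambda>n. dst ?K (X n) l) \<longlonglongrightarrow> 0"
      using l by (auto simp: dst)
  qed (auto simp: car add_assoc add_commute add_zer scl_add_right scl_add_left scl_scl scl_one
      scl_0 ip_add_left ip_scl_left ip_ge_0 ip_eq_0 intro: ip_commute)
qed

text \<open>Transport of a structure along an injection of its carrier.\<close>

definition transport :: "('k \<Rightarrow> 'l) \<Rightarrow> 'k hilbert_struct \<Rightarrow> 'l hilbert_struct" where
  "transport c K = (let d = inv_into (carrier K) c in
     \<lparr>carrier = c ` carrier K, zer = c (zer K), add = \<lambda>x y. c (add K (d x) (d y)),
      scl = \<lambda>a x. c (scl K a (d x)), ip = \<lambda>x y. ip K (d x) (d y)\<rparr>)"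

lemma carrier_transport: "carrier (transport c K) = c ` carrier K"
  and zer_transport: "zer (transport c K) = c (zer K)"
  by (simp_all add: transport_def Let_def)

lemma
  assumes "inj_on c (carrier K)"
  shows add_transport: "x \<in> carrier K \<Longrightarrow> y \<in> carrier K \<Longrightarrow>
      add (transport c K) (c x) (c y) = c (add K x y)"
    and scl_transport: "x \<in> carrier K \<Longrightarrow> scl (transport c K) a (c x) = c (scl K a x)"
    and ip_transport: "x \<in> carrier K \<Longrightarrow> y \<in> carrier K \<Longrightarrow>
      ip (transport c K) (c x) (c y) = ip K x y"
  using assms by (simp_all add: transport_def Let_def)

lemma (in hilbert_space_on) normal_extension_transport:
  assumes inj: "inj_on c (carrier K)" and ext: "normal_extension T K J N"
  shows "normal_extension T (transport c K) (c \<circ> J) (c \<circ> N \<circ> inv_into (carrier K) c)"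
proof -
  let ?K = "transport c K" and ?op = "\<lambda>N. c \<circ> N \<circ> inv_into (carrier K) c"
  note tr = carrier_transport zer_transport add_transport[OF inj] scl_transport[OF inj]
    ip_transport[OF inj]
  have nrm: "nrm ?K (c x) = nrm K x" if "x \<in> carrier K" for x
    using that by (simp add: nrm_def tr)
  have dst: "dst ?K (c x) (c y) = dst K x y" if "x \<in> carrier K" "y \<in> carrier K" for x y
    using that by (simp add: dst_def tr nrm scl_closed add_closed)
  have op: "?op N (c x) = c (N x)" if "x \<in> carrier K" for x N
    using that inj by simp
  have bdd: "bounded_op_on ?K (?op N)" if "bounded_op_on K N" for N
    using that inj
    by (auto simp: bounded_op_on_def tr nrm add_closed scl_closed)
  have "hilbert_space_on ?K"
  proof
    fix X :: "nat \<Rightarrow> _"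
    assume X: "\<And>n. X n \<in> carrier ?K"
      and cau: "\<forall>e>0. \<exists>M::nat. \<forall>m\<ge>M. \<forall>n\<ge>M. dst ?K (X m) (X n) < e"
    have "\<forall>n. \<exists>y. y \<in> carrier K \<and> X n = c y"
      using X by (auto simp: tr)
    then obtain Y where Y: "\<And>n. Y n \<in> carrier K" "\<And>n. X n = c (Y n)" by metis
    obtain l where "l \<in> carrier K" "(\<lambda>n. dst K (Y n) l) \<longlonglongrightarrow> 0"
      using complete[of Y] Y cau dst by auto
    then show "\<exists>l\<in>carrier ?K. (\<lambda>n. dst ?K (X n) l) \<longlonglongrightarrow> 0"
      by (auto simp: tr Y dst)
  next
    fix x y assume "x \<in> carrier ?K" "y \<in> carrier ?K"
    then show "add ?K x y = add ?K y x" using add_commute by (force simp: tr)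
  next
    fix x assume x: "x \<in> carrier ?K" "ip ?K x x = 0"
    then show "x = zer ?K" using ip_eq_0 by (auto simp: tr)
  qed (auto simp: tr zer_closed add_closed scl_closed add_assoc add_zer scl_add_right
      scl_add_left scl_scl scl_one scl_0 ip_add_left ip_scl_left ip_ge_0
      
      intro: ip_commute)
  moreover have "isometric_embedding (c \<circ> J) ?K"
    using ext by (simp add: normal_extension_def isometric_embedding_def tr)
  moreover have "normal_op_on ?K (?op N)"
  proof -
    obtain M where M: "adjoint_on K N M" "\<forall>x\<in>carrier K. N (M x) = M (N x)"
      and N: "bounded_op_on K N"
      using ext unfolding normal_extension_def normal_op_on_def by blast
    have in_K: "N x \<in> carrier K" "M x \<in> carrier K" if "x \<in> carrier K" for x
      using that N M(1) by (auto simp: adjoint_on_def bounded_op_on_def)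
    have "adjoint_on ?K (?op N) (?op M)"
      using M(1) bdd inj in_K by (auto simp: adjoint_on_def tr)
    moreover have "\<forall>x\<in>carrier ?K. ?op N (?op M x) = ?op M (?op N x)"
      using M(2) inj in_K by (auto simp: tr)
    ultimately show ?thesis
      using bdd[OF N] unfolding normal_op_on_def by blast
  qed
  moreover have "\<forall>h. ?op N ((c \<circ> J) h) = (c \<circ> J) (T h)"
    using ext inj by (simp add: normal_extension_def isometric_embedding_def)
  ultimately show ?thesis unfolding normal_extension_def by blast
qed

text \<open>
  Finite sums \<open>\<Sum>n<m. M\<^sup>n (J (g n))\<close>; with \<open>M\<close> the adjoint of a normal extension, these
  form a subspace reducing the extension, whose closure injects into \<open>nat \<Rightarrow> 'h\<close>.
\<close>

primrec psum :: "'k hilbert_struct \<Rightarrow> ('k \<Rightarrow> 'k) \<Rightarrow> ('h \<Rightarrow> 'k) \<Rightarrow> (nat \<Rightarrow> 'h) \<Rightarrow> nat \<Rightarrow> 'k" where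
  "psum K M J g 0 = zer K"
| "psum K M J g (Suc m) = add K (psum K M J g m) ((M ^^ m) (J (g m)))"

theorem subnormalI:
  fixes K :: "'k hilbert_struct" and T :: "'h::chilbert_space \<Rightarrow> 'h"
  assumes ext: "normal_extension T K J N"
  shows "subnormal T"
proof -
  interpret hilbert_space_on K
    using ext by (simp add: normal_extension_def)
  obtain M where adj: "adjoint_on K N M" and NM: "\<And>x. x \<in> carrier K \<Longrightarrow> N (M x) = M (N x)"
    and N: "bounded_op_on K N"
    using ext unfolding normal_extension_def normal_op_on_def by blast
  have M: "bounded_op_on K M" using adj by (simp add: adjoint_on_def)
  have J: "J x \<in> carrier K" "J (x + y) = add K (J x) (J y)" "J (a *\<^sub>C x) = scl K a (J x)"
    "ip K (J x) (J y) = cinner x y" for a x y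
    using ext by (auto simp: normal_extension_def isometric_embedding_def)
  have NJ: "N (J h) = J (T h)" for h using ext by (simp add: normal_extension_def)
  have scaleC_0: "0 *\<^sub>C (x::'h) = 0" for x
    using scaleR_scaleC[of 0 x] by simp
  have J0: "J 0 = zer K" using J(3)[of 0 0] J(1) scl_0 by (simp add: scaleC_0)
  have opz: "A (zer K) = zer K" if "bounded_op_on K A" for A
  proof -
    have "A (scl K 0 (zer K)) = scl K 0 (A (zer K))"
      using that zer_closed by (simp add: bounded_op_on_def)
    moreover have "A (zer K) \<in> carrier K" using that zer_closed by (simp add: bounded_op_on_def)
    ultimately show ?thesis by (simp add: scl_0 zer_closed)
  qed
  have M_in: "M x \<in> carrier K" and M_add: "y \<in> carrier K \<Longrightarrow> M (add K x y) = add K (M x) (M y)"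
    and M_scl: "M (scl K a x) = scl K a (M x)" if "x \<in> carrier K" for x y a
    using M that by (auto simp: bounded_op_on_def)
  have N_in: "N x \<in> carrier K" and N_add: "y \<in> carrier K \<Longrightarrow> N (add K x y) = add K (N x) (N y)"
    if "x \<in> carrier K" for x y
    using N that by (auto simp: bounded_op_on_def)
  have P_in: "(M ^^ n) x \<in> carrier K" if "x \<in> carrier K" for n x
    using that by (induction n) (auto simp: M_in)
  have P_add: "(M ^^ n) (add K x y) = add K ((M ^^ n) x) ((M ^^ n) y)"
    if "x \<in> carrier K" "y \<in> carrier K" for n x y
    using that by (induction n) (auto simp: M_add P_in)
  have P_scl: "(M ^^ n) (scl K a x) = scl K a ((M ^^ n) x)" if "x \<in> carrier K" for n x a
    using that by (induction n) (auto simp: M_scl P_in)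
  have P_zer: "(M ^^ n) (zer K) = zer K" for n
    by (induction n) (auto simp: opz[OF M])
  have P_N: "N ((M ^^ n) x) = (M ^^ n) (N x)" if "x \<in> carrier K" for n x
    using that by (induction n) (auto simp: NM P_in)
  let ?S = "psum K M J"
  have S_in: "?S g m \<in> carrier K" for g m
    by (induction m) (auto simp: zer_closed add_closed P_in J)
  have add4: "add K (add K p q) (add K r s) = add K (add K p r) (add K q s)"
    if "p \<in> carrier K" "q \<in> carrier K" "r \<in> carrier K" "s \<in> carrier K" for p q r s
    using that by (metis add_assoc add_closed add_commute)
  have S_add: "?S (\<lambda>n. g n + h n) m = add K (?S g m) (?S h m)" for g h m
    by (induction m) (auto simp: zer_closed add_zer J P_add P_in S_in add4)
  have scl_zer: "scl K a (zer K) = zer K" for a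
    using scl_scl[of "zer K" a 0] by (simp add: scl_0 zer_closed)
  have S_scl: "?S (\<lambda>n. a *\<^sub>C g n) m = scl K a (?S g m)" for g a m
    by (induction m) (auto simp: scl_zer J P_scl P_in S_in scl_add_right)
  have S_N: "N (?S g m) = ?S (\<lambda>n. T (g n)) m" for g m
    by (induction m) (auto simp: opz[OF N] J NJ N_add P_in S_in P_N)
  have S_M: "M (?S g m) = ?S (\<lambda>n. case n of 0 \<Rightarrow> 0 | Suc k \<Rightarrow> g k) (Suc m)" for g m
  proof (induction m)
    case 0
    show ?case by (simp add: opz[OF M] J0 add_zer zer_closed)
  next
    case (Suc m)
    then show ?case by (simp add: M_add S_in P_in J)
  qed
  have S_pad: "?S g (m + j) = ?S g m" if "\<forall>n\<ge>m. g n = 0" for g m j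
    using that by (induction j) (auto simp: J0 P_zer add_zer S_in)
  have S_cut: "?S (\<lambda>n. if n < m then g n else 0) j = ?S g j" if "j \<le> m" for g m j
    using that by (induction j) auto
  define D where "D = {?S g m |g m. \<forall>n\<ge>m. g n = 0}"
  have S_D: "?S g m \<in> D" for g m
  proof -
    have "?S g m = ?S (\<lambda>n. if n < m then g n else 0) m" by (simp add: S_cut)
    then show ?thesis unfolding D_def by force
  qed
  have D: "D \<subseteq> carrier K" using S_in by (auto simp: D_def)
  have D_zer: "zer K \<in> D" using S_D[of _ 0] by simp
  have D_add: "add K x y \<in> D" if xy: "x \<in> D" "y \<in> D" for x y
  proof -
    obtain g m h k where "x = ?S g m" "\<forall>n\<ge>m. g n = 0" "y = ?S h k" "\<forall>n\<ge>k. h n = 0"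
      using xy unfolding D_def by blast
    then have "x = ?S g (m + k)" "y = ?S h (m + k)"
      using S_pad[of m g k] S_pad[of k h m] by (auto simp: add.commute)
    then show ?thesis by (simp add: S_add[symmetric] S_D del: psum.simps)
  qed
  have D_scl: "scl K a x \<in> D" if x: "x \<in> D" for a x
  proof -
    obtain g m where "x = ?S g m" using x unfolding D_def by blast
    then show ?thesis by (simp add: S_scl[symmetric] S_D del: psum.simps)
  qed
  have D_N: "N x \<in> D" if x: "x \<in> D" for x
  proof -
    obtain g m where "x = ?S g m" using x unfolding D_def by blast
    then show ?thesis by (simp add: S_N S_D del: psum.simps)
  qed
  have D_M: "M x \<in> D" if x: "x \<in> D" for x
  proof -
    obtain g m where "x = ?S g m" using x unfolding D_def by blast
    then show ?thesis by (simp add: S_M S_D del: psum.simps)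
  qed
  have D_J: "J x \<in> D" for x
  proof -
    have "?S (\<lambda>_. x) (Suc 0) = J x"
      using add_commute[of "zer K" "J x"] by (simp add: add_zer J zer_closed)
    then show ?thesis using S_D by metis
  qed
  let ?K = "K\<lparr>carrier := clos K D\<rparr>"
  have cl: "x \<in> carrier K" if "x \<in> clos K D" for x using that by (simp add: clos_def)
  have bdd: "bounded_op_on ?K A" if A: "bounded_op_on K A" "\<And>x. x \<in> D \<Longrightarrow> A x \<in> D" for A
  proof -
    have nrm: "nrm ?K = nrm K" by (simp add: fun_eq_iff nrm_def)
    have A_clos: "A x \<in> clos K D" if "x \<in> clos K D" for x
      using clos_image[OF A(1) D A(2) that] .
    have "\<exists>C. \<forall>x\<in>clos K D. nrm K (A x) \<le> C * nrm K x"
      using A(1) cl unfolding bounded_op_on_def by blast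
    then show ?thesis
      using A(1) A_clos cl by (simp add: bounded_op_on_def nrm)
  qed
  have "normal_extension T ?K J N"
    unfolding normal_extension_def
  proof (intro conjI)
    show "hilbert_space_on ?K"
      using hilbert_space_on_clos[OF D D_zer D_add D_scl] .
    show "isometric_embedding J ?K"
      using subset_clos[OF D] D_J J by (auto simp: isometric_embedding_def)
    have "adjoint_on ?K N M"
      using adj bdd[OF M D_M] cl by (auto simp: adjoint_on_def)
    then show "normal_op_on ?K N"
      using bdd[OF N D_N] NM cl unfolding normal_op_on_def by auto
    show "\<forall>h. N (J h) = J (T h)" using NJ by simp
  qed
  moreover have "\<exists>c :: 'k \<Rightarrow> nat \<Rightarrow> 'h. inj_on c (clos K D)"
  proof -
    have "\<exists>g. \<exists>m. (\<forall>n\<ge>m. g n = 0) \<and> dst K (?S g m) l < 1 / real (Suc k)"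
      if l: "l \<in> clos K D" for l k
    proof -
      have "0 < 1 / real (Suc k)" by simp
      then obtain x where "x \<in> D" "dst K x l < 1 / real (Suc k)"
        using l unfolding clos_def by blast
      then show ?thesis unfolding D_def by blast
    qed
    then obtain G where G: "\<And>l k. l \<in> clos K D \<Longrightarrow>
        \<exists>m. (\<forall>n\<ge>m. G l k n = 0) \<and> dst K (?S (G l k) m) l < 1 / real (Suc k)"
      by metis
    define c where "c = (\<lambda>l j. G l (fst (prod_decode j)) (snd (prod_decode j)))"
    have "l = l'" if l: "l \<in> clos K D" "l' \<in> clos K D" and eq: "c l = c l'" for l l'
    proof -
      have G_eq: "G l k = G l' k" for k
      proof
        fix n show "G l k n = G l' k n"
          using fun_cong[OF eq, of "prod_encode (k, n)"] by (simp add: c_def)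
      qed
      have le: "dst K l l' \<le> 4 * (1 / real (Suc k))" for k
      proof -
        obtain m where m: "\<forall>n\<ge>m. G l k n = 0" "dst K (?S (G l k) m) l < 1 / real (Suc k)"
          using G[OF l(1)] by blast
        obtain m' where m': "\<forall>n\<ge>m'. G l' k n = 0"
            "dst K (?S (G l' k) m') l' < 1 / real (Suc k)"
          using G[OF l(2)] by blast
        have "?S (G l k) m = ?S (G l' k) m'"
          using S_pad[OF m(1), of m'] S_pad[OF m'(1), of m] by (simp add: G_eq add.commute)
        then have "dst K l l' \<le> 2 * dst K l (?S (G l k) m) + 2 * dst K (?S (G l' k) m') l'"
          using dst_triangle[of l "?S (G l k) m" l'] l cl S_in by simp
        then show ?thesis
          using m m' dst_commute[of l "?S (G l k) m"] l cl S_in by simp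
      qed
      have "(\<lambda>k. 4 * (1 / real (Suc k))) \<longlonglongrightarrow> 4 * 0"
        by (intro tendsto_mult tendsto_const lim_1_over_n[THEN LIMSEQ_Suc])
      then have "dst K l l' \<le> 4 * 0"
        by (rule LIMSEQ_le_const) (use le in blast)
      then have "dst K l l' = 0"
        using dst_ge_0[of l l'] l cl by simp
      then show ?thesis using dst_eq_0 l cl by blast
    qed
    then show ?thesis unfolding inj_on_def by blast
  qed
  then obtain c :: "'k \<Rightarrow> nat \<Rightarrow> 'h" where "inj_on c (carrier ?K)" by auto
  ultimately show ?thesis
    unfolding subnormal_def
    using hilbert_space_on.normal_extension_transport[of ?K c T J N]
    unfolding normal_extension_def by blast
qed

end

theory Submission
  imports Defs
begin

text \<open>
  Put \<open>F = \<alpha>E\<close>, \<open>L = Q\<^sup>*Q = |Q|\<^sup>2\<close> and \<open>G = F\<^sup>*F = \<alpha>\<^sup>2|E|\<^sup>2\<close>. For \<open>\<alpha> \<noteq> 0\<close> the operator \<open>T\<^sup>\<dagger>(\<alpha>)\<close> is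
  subnormal if and only if \<open>s\<^sup>2 + \<alpha>\<^sup>2t\<^sup>2 \<le> 1\<close> on \<open>\<sigma>\<^sub>\<sharp>(|Q|,|E|)\<close>, and everything else follows from this.

  A pair of reals belongs to the Taylor spectrum of two commuting positive operators exactly when it is
  a joint approximate eigenvalue. For necessity, a subnormal operator is paranormal, and the
  inequality \<open>\<parallel>T h\<parallel>\<^sup>2 \<le> \<parallel>h\<parallel> \<parallel>T\<^sup>2h\<parallel>\<close> at joint approximate eigenvectors \<open>h \<in> H\<^sub>2\<close> becomes
  \<open>(u + w)\<^sup>2 \<le> u\<^sup>2 + uw + w\<close> with \<open>u = s\<^sup>2\<close> and \<open>w = \<alpha>\<^sup>2t\<^sup>2\<close>, that is, \<open>u + w \<le> 1\<close>. For sufficiency, the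
  spectral condition gives \<open>G (1 - L - G) \<ge> 0\<close>, since otherwise \<open>G (L + G - 1)\<close> would be positive
  at some joint approximate eigenvalue. It follows that \<open>\<Sum>\<^sub>j \<parallel>F Q\<^sup>j y\<parallel>\<^sup>2 \<le> \<parallel>y\<parallel>\<^sup>2\<close>, so that the part of \<open>y\<close>
  that is eventually fed into the isometry \<open>V\<close> can be stored as the sequence \<open>(F Q\<^sup>j y)\<^sub>j\<close> in a unitary
  extension of \<open>V\<close>, while the rest of \<open>y\<close> evolves under a normal extension of \<open>Q\<close>.
\<close>

section \<open>Positive operators on real Hilbert spaces\<close>

text \<open>No spectral measures are used. An inequality between polynomials in commuting positive
  operators is proved by contradiction: a vector where it fails is turned into joint approximate
  eigenvectors at which it still fails, and there it is an inequality between numbers. Producing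
  these eigenvectors is the main obstacle. It needs only the real inner product, so this part is
  real; complex linearity returns because a square root commutes with whatever commutes with its
  square, scalars included.

  The bound on the sum has a scalar model: w > 0 and u + w <= 1 give w (1 + u + u^2 + ...) = w / (1
  - u) <= 1. Points with w = 0 contribute nothing, whatever u is. This is why only the part of the
  joint spectrum with t > 0 matters, and why \<open>Q\<close> may have norm above 1.

  Necessity tests only T and its square, and only on vectors of the second summand. For nonzero
  \<alpha> the paranormality inequality on these vectors is therefore already equivalent to
  subnormality.\<close>

definition pos_op :: "('a::real_inner \<Rightarrow> 'a) \<Rightarrow> bool" where
  "pos_op A \<longleftrightarrow> bounded_linear A \<and> (\<forall>x y. inner (A x) y = inner x (A y)) \<and>
     (\<forall>x. 0 \<le> inner (A x) x)"

lemma pos_opD: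
  assumes "pos_op A"
  shows "bounded_linear A" "inner (A x) y = inner x (A y)" "0 \<le> inner (A x) x"
  using assms unfolding pos_op_def by blast+

lemma pos_op_Cauchy_Schwarz:
  assumes A: "pos_op A"
  shows "(inner (A x) y)\<^sup>2 \<le> inner (A x) x * inner (A y) y"
proof -
  interpret A: bounded_linear A using pos_opD(1)[OF A] .
  define a b c where "a = inner (A x) x" and "b = inner (A x) y" and "c = inner (A y) y"
  have q: "0 \<le> a - 2 * t * b + t\<^sup>2 * c" for t
  proof -
    have "inner (A y) x = b"
      using pos_opD(2)[OF A, of y x] by (simp add: b_def inner_commute)
    then have "inner (A (x - t *\<^sub>R y)) (x - t *\<^sub>R y) = a - 2 * t * b + t\<^sup>2 * c"
      by (simp add: A.diff A.scaleR inner_diff_left inner_diff_right a_def b_def c_def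
          power2_eq_square algebra_simps)
    then show ?thesis using pos_opD(3)[OF A, of "x - t *\<^sub>R y"] by simp
  qed
  have "b\<^sup>2 \<le> a * c"
  proof (cases "c = 0")
    case True
    have "b = 0"
    proof (rule ccontr)
      assume "b \<noteq> 0"
      \<comment> \<open>With c = 0 the quadratic is affine in t, and this t gives it the value
        -1.\<close>
      then show False using q[of "(a + 1) / (2 * b)"] True by simp
    qed
    then show ?thesis using True by simp
  next
    case False
    then have "c > 0" using pos_opD(3)[OF A, of y] by (simp add: c_def)
    then show ?thesis using q[of "b / c"] by (simp add: field_simps power2_eq_square)
  qed
  then show ?thesis by (simp add: a_def b_def c_def)
qed

lemma pos_op_eq_0:
  assumes "pos_op A" "inner (A x) x = 0"
  shows "A x = 0"
  using pos_op_Cauchy_Schwarz[OF assms(1), of x "A x"] assms(2) by simp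

text \<open>Cauchy-Schwarz for the form of \<open>A\<close> at \<open>x\<close> and
  \<open>A x\<close> bounds ||A x||^4 by c^2 ||x||^2 ||A x||^2.\<close>

lemma pos_op_norm_le:
  assumes A: "pos_op A" and le: "\<And>x. inner (A x) x \<le> c * (norm x)\<^sup>2" and c: "0 \<le> c"
  shows "norm (A x) \<le> c * norm x"
proof (cases "A x = 0")
  case False
  have "((norm (A x))\<^sup>2)\<^sup>2 = (inner (A x) (A x))\<^sup>2"
    by (simp add: power2_norm_eq_inner)
  also have "\<dots> \<le> inner (A x) x * inner (A (A x)) (A x)"
    by (rule pos_op_Cauchy_Schwarz[OF A])
  also have "\<dots> \<le> (c * (norm x)\<^sup>2) * (c * (norm (A x))\<^sup>2)"
    using le pos_opD(3)[OF A] c by (intro mult_mono) auto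
  finally have "(norm (A x))\<^sup>2 * (norm (A x))\<^sup>2 \<le> (c * norm x)\<^sup>2 * (norm (A x))\<^sup>2"
    by (simp add: power2_eq_square algebra_simps)
  then have "(norm (A x))\<^sup>2 \<le> (c * norm x)\<^sup>2"
    by (rule mult_right_le_imp_le) (use False in simp)
  then show ?thesis using c by (simp add: power2_le_iff_abs_le)
qed (use c in auto)

subsection \<open>Square roots\<close>

text \<open>
  If \<open>\<parallel>X\<parallel> \<le> 1\<close>, then \<open>Y\<^sub>n\<^sub>+\<^sub>1 = (X + Y\<^sub>n\<^sup>2) / 2\<close> converges in norm, because its increments
  are dominated by those of the same iteration for the number \<open>1\<close>. The limit \<open>Y\<close> satisfies
  \<open>(1 - Y)\<^sup>2 = 1 - X\<close>.
\<close>

primrec sqrt_iter :: "('a::real_vector \<Rightarrow> 'a) \<Rightarrow> nat \<Rightarrow> 'a \<Rightarrow> 'a" where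
  "sqrt_iter X 0 = (\<lambda>x. 0)"
| "sqrt_iter X (Suc n) = (\<lambda>x. (1/2) *\<^sub>R (X x + sqrt_iter X n (sqrt_iter X n x)))"

primrec sqrt_iter_bound :: "nat \<Rightarrow> real" where
  "sqrt_iter_bound 0 = 0"
| "sqrt_iter_bound (Suc n) = (1 + (sqrt_iter_bound n)\<^sup>2) / 2"

lemma sqrt_iter_bound_range: "0 \<le> sqrt_iter_bound n" "sqrt_iter_bound n \<le> 1"
  by (induction n) (auto simp: power_le_one_iff)

lemma sqrt_iter_bound_mono: "incseq sqrt_iter_bound"
proof (rule incseq_SucI)
  fix n
  have "0 \<le> (1 - sqrt_iter_bound n)\<^sup>2" by simp
  then show "sqrt_iter_bound n \<le> sqrt_iter_bound (Suc n)"
    by (simp add: power2_eq_square algebra_simps)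
qed

lemma bounded_linear_sqrt_iter:
  assumes "bounded_linear X"
  shows "bounded_linear (sqrt_iter X n)"
proof (induction n)
  case (Suc n)
  have "bounded_linear (\<lambda>x. sqrt_iter X n (sqrt_iter X n x))"
    using bounded_linear_compose[OF Suc Suc] .
  then show ?case
    using assms by (auto intro!: bounded_linear_const_scaleR bounded_linear_add)
qed (simp add: bounded_linear_zero)

lemma sqrt_iter_commute:
  assumes "bounded_linear B" "\<And>x. B (X x) = X (B x)"
  shows "B (sqrt_iter X n x) = sqrt_iter X n (B x)"
proof -
  interpret B: bounded_linear B by fact
  show ?thesis
    by (induction n arbitrary: x) (auto simp: B.zero B.add B.scaleR assms(2))
qed

context
  fixes X :: "'a::{real_inner,complete_space} \<Rightarrow> 'a"
  assumes X: "bounded_linear X" and X_le: "\<And>x. norm (X x) \<le> norm x"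
begin

lemma sqrt_iter_norm: "norm (sqrt_iter X n x) \<le> sqrt_iter_bound n * norm x"
proof (induction n arbitrary: x)
  case (Suc n)
  have "norm (sqrt_iter X n (sqrt_iter X n x)) \<le> sqrt_iter_bound n * (sqrt_iter_bound n * norm x)"
    using Suc[of "sqrt_iter X n x"] mult_left_mono[OF Suc[of x] sqrt_iter_bound_range(1)[of n]]
    by simp
  then have le: "norm (X x + sqrt_iter X n (sqrt_iter X n x))
      \<le> norm x + sqrt_iter_bound n * (sqrt_iter_bound n * norm x)"
    using X_le[of x] norm_triangle_ineq[of "X x" "sqrt_iter X n (sqrt_iter X n x)"] by linarith
  have l: "norm (sqrt_iter X (Suc n) x) = (1/2) * norm (X x + sqrt_iter X n (sqrt_iter X n x))"
    unfolding sqrt_iter.simps norm_scaleR by simp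
  have r: "sqrt_iter_bound (Suc n) * norm x
      = (1/2) * (norm x + sqrt_iter_bound n * (sqrt_iter_bound n * norm x))"
    by (simp add: power2_eq_square algebra_simps)
  show ?case unfolding l r by (intro mult_left_mono le) simp
qed simp

text \<open>Successive iterates commute, so the difference of their squares factors as (Z - Y)(Z +
  Y). The scalar iteration factors in the same way, and the two bounds match factor by
  factor.\<close>

lemma sqrt_iter_step:
  "norm (sqrt_iter X (Suc n) x - sqrt_iter X n x)
    \<le> (sqrt_iter_bound (Suc n) - sqrt_iter_bound n) * norm x"
proof (induction n arbitrary: x)
  case 0
  show ?case using X_le[of x] by simp
next
  case (Suc n)
  let ?Y = "sqrt_iter X n" and ?Z = "sqrt_iter X (Suc n)"
  let ?r = "sqrt_iter_bound n" and ?q = "sqrt_iter_bound (Suc n)"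
  interpret Y: bounded_linear ?Y by (rule bounded_linear_sqrt_iter[OF X])
  interpret Z: bounded_linear ?Z by (rule bounded_linear_sqrt_iter[OF X])
  have "?Y (X y) = X (?Y y)" for y
    using sqrt_iter_commute[OF X, of X n y] by simp
  then have comm: "?Y (?Z y) = ?Z (?Y y)" for y
    by (rule sqrt_iter_commute[OF Y.bounded_linear_axioms])
  have "sqrt_iter X (Suc (Suc n)) x - ?Z x
      = (1/2) *\<^sub>R (?Z (?Z x + ?Y x) - ?Y (?Z x + ?Y x))"
    unfolding Z.add Y.add comm
    by (simp add: algebra_simps flip: scaleR_add_left)
  then have "norm (sqrt_iter X (Suc (Suc n)) x - ?Z x)
      = (1/2) * norm (?Z (?Z x + ?Y x) - ?Y (?Z x + ?Y x))"
    by simp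
  also have "\<dots> \<le> (1/2) * ((?q - ?r) * norm (?Z x + ?Y x))"
    using Suc[of "?Z x + ?Y x"] by simp
  also have "\<dots> \<le> (1/2) * ((?q - ?r) * ((?q + ?r) * norm x))"
  proof -
    have "norm (?Z x + ?Y x) \<le> (?q + ?r) * norm x"
      using norm_triangle_ineq[of "?Z x" "?Y x"] sqrt_iter_norm[of n x] sqrt_iter_norm[of "Suc n" x]
      by (simp only: distrib_right)
    then have "(?q - ?r) * norm (?Z x + ?Y x) \<le> (?q - ?r) * ((?q + ?r) * norm x)"
      using incseq_SucD[OF sqrt_iter_bound_mono, of n] by (intro mult_left_mono) simp_all
    then show ?thesis by linarith
  qed
  also have "\<dots> = (sqrt_iter_bound (Suc (Suc n)) - ?q) * norm x"
  proof -
    have *: "sqrt_iter_bound (Suc (Suc n)) = (1 + ?q\<^sup>2) / 2" "?q = (1 + ?r\<^sup>2) / 2"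
      by simp_all
    have "(1/2) * ((?q - ?r) * (?q + ?r)) = (1 + ?q\<^sup>2) / 2 - (1 + ?r\<^sup>2) / 2"
      by (simp only: power2_eq_square) (simp add: algebra_simps del: sqrt_iter_bound.simps)
    then have "(1/2) * ((?q - ?r) * (?q + ?r)) = sqrt_iter_bound (Suc (Suc n)) - ?q"
      using * by linarith
    then show ?thesis by (metis mult.assoc)
  qed
  finally show ?case .
qed

lemma sqrt_iter_diff:
  "norm (sqrt_iter X (n + k) x - sqrt_iter X n x)
    \<le> (sqrt_iter_bound (n + k) - sqrt_iter_bound n) * norm x"
proof (induction k)
  case (Suc k)
  have "norm (sqrt_iter X (n + Suc k) x - sqrt_iter X n x)
    \<le> norm (sqrt_iter X (Suc (n + k)) x - sqrt_iter X (n + k) x)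
      + norm (sqrt_iter X (n + k) x - sqrt_iter X n x)"
    using norm_triangle_ineq[of "sqrt_iter X (Suc (n + k)) x - sqrt_iter X (n + k) x"
        "sqrt_iter X (n + k) x - sqrt_iter X n x"] by simp
  also have "\<dots> \<le> (sqrt_iter_bound (Suc (n + k)) - sqrt_iter_bound (n + k)) * norm x
      + (sqrt_iter_bound (n + k) - sqrt_iter_bound n) * norm x"
    using sqrt_iter_step[of "n + k" x] Suc by linarith
  also have "\<dots> = (sqrt_iter_bound (n + Suc k) - sqrt_iter_bound n) * norm x"
    by (simp add: algebra_simps)
  finally show ?case .
qed simp

lemma sqrt_iter_Cauchy: "Cauchy (\<lambda>n. sqrt_iter X n x)"
proof -
  obtain r where r: "sqrt_iter_bound \<longlonglongrightarrow> r" "\<And>n. sqrt_iter_bound n \<le> r"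
    using incseq_convergent[OF sqrt_iter_bound_mono] sqrt_iter_bound_range(2) by metis
  have "(\<lambda>n. (r - sqrt_iter_bound n) * norm x) \<longlonglongrightarrow> (r - r) * norm x"
    by (intro tendsto_intros r)
  then have lim: "(\<lambda>n. (r - sqrt_iter_bound n) * norm x) \<longlonglongrightarrow> 0" by simp
  show ?thesis
  proof (rule CauchyI')
    fix e :: real assume "0 < e"
    then obtain N where N: "\<And>n. n \<ge> N \<Longrightarrow> (r - sqrt_iter_bound n) * norm x < e"
      using order_tendstoD(2)[OF lim] unfolding eventually_sequentially by blast
    have "norm (sqrt_iter X m x - sqrt_iter X n x) < e" if "N \<le> m" "m < n" for m n
    proof -
      have "norm (sqrt_iter X m x - sqrt_iter X n x) \<le> (sqrt_iter_bound n - sqrt_iter_bound m) * norm x"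
        using sqrt_iter_diff[of m "n - m" x] that by (simp add: norm_minus_commute)
      also have "\<dots> \<le> (r - sqrt_iter_bound m) * norm x"
        using r(2)[of n] by (intro mult_right_mono) auto
      also have "\<dots> < e" using N that by simp
      finally show ?thesis .
    qed
    then show "\<exists>M. \<forall>m\<ge>M. \<forall>n>m. dist (sqrt_iter X m x) (sqrt_iter X n x) < e"
      unfolding dist_norm by blast
  qed
qed

lemma sqrt_iter_limit:
  assumes X_sym: "\<And>x y. inner (X x) y = inner x (X y)"
  obtains Y where "bounded_linear Y" "\<And>x y. inner (Y x) y = inner x (Y y)"
    "\<And>x. norm (Y x) \<le> norm x" "\<And>x. 2 *\<^sub>R Y x = X x + Y (Y x)"
    "\<And>B x. bounded_linear B \<Longrightarrow> (\<And>x. B (X x) = X (B x)) \<Longrightarrow> B (Y x) = Y (B x)"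
proof -
  define Y where "Y x = lim (\<lambda>n. sqrt_iter X n x)" for x
  have lim: "(\<lambda>n. sqrt_iter X n x) \<longlonglongrightarrow> Y x" for x
    using sqrt_iter_Cauchy[of x] unfolding Y_def Cauchy_convergent_iff convergent_LIMSEQ_iff .
  note bl = bounded_linear_sqrt_iter[OF X]
  have le1: "norm (sqrt_iter X n x) \<le> norm x" for n x
    using sqrt_iter_norm[of n x] mult_right_mono[OF sqrt_iter_bound_range(2)[of n] norm_ge_zero[of x]]
    by simp
  have Y_le: "norm (Y x) \<le> norm x" for x
    by (rule Lim_bounded[OF tendsto_norm[OF lim], of 0]) (use le1 in auto)
  have Y_bl: "bounded_linear Y"
  proof (rule bounded_linear_intro[where K=1])
    fix x y and c :: real
    have "(\<lambda>n. sqrt_iter X n (x + y)) \<longlonglongrightarrow> Y x + Y y"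
      using tendsto_add[OF lim lim] by (simp add: linear_simps[OF bl])
    then show "Y (x + y) = Y x + Y y" using lim LIMSEQ_unique by blast
    have "(\<lambda>n. sqrt_iter X n (c *\<^sub>R x)) \<longlonglongrightarrow> c *\<^sub>R Y x"
      using tendsto_scaleR[OF tendsto_const lim] by (simp add: linear_simps[OF bl])
    then show "Y (c *\<^sub>R x) = c *\<^sub>R Y x" using lim LIMSEQ_unique by blast
    show "norm (Y x) \<le> norm x * 1" using Y_le by simp
  qed
  have sym_n: "inner (sqrt_iter X n x) y = inner x (sqrt_iter X n y)" for n x y
    by (induction n arbitrary: x y) (auto simp: inner_add_left inner_add_right X_sym)
  have Y_sym: "inner (Y x) y = inner x (Y y)" for x y
  proof -
    have "(\<lambda>n. inner (sqrt_iter X n x) y) \<longlonglongrightarrow> inner (Y x) y"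
      by (intro tendsto_intros lim)
    moreover have "(\<lambda>n. inner (sqrt_iter X n x) y) \<longlonglongrightarrow> inner x (Y y)"
      unfolding sym_n by (intro tendsto_intros lim)
    ultimately show ?thesis by (rule LIMSEQ_unique)
  qed
  \<comment> \<open>Pointwise limits need not compose. Here the iterates are contractions, so
    applying the n-th one to \<open>sqrt_iter X n x - Y x\<close> still gives a null
    sequence.\<close>
  have sq: "(\<lambda>n. sqrt_iter X n (sqrt_iter X n x)) \<longlonglongrightarrow> Y (Y x)" for x
  proof -
    have "(\<lambda>n. norm (sqrt_iter X n x - Y x)) \<longlonglongrightarrow> 0"
      using lim[of x] by (simp add: LIM_zero tendsto_norm_zero)
    then have "(\<lambda>n. sqrt_iter X n (sqrt_iter X n x - Y x)) \<longlonglongrightarrow> 0"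
      by (rule Lim_null_comparison[rotated]) (use le1 in auto)
    from tendsto_add[OF this lim[of "Y x"]] show ?thesis
      by (simp add: linear_simps[OF bl])
  qed
  have eq: "2 *\<^sub>R Y x = X x + Y (Y x)" for x
  proof -
    have "(\<lambda>n. sqrt_iter X (Suc n) x) \<longlonglongrightarrow> (1/2) *\<^sub>R (X x + Y (Y x))"
      unfolding sqrt_iter.simps by (intro tendsto_intros sq)
    moreover have "(\<lambda>n. sqrt_iter X (Suc n) x) \<longlonglongrightarrow> Y x"
      using lim LIMSEQ_Suc by blast
    ultimately have "Y x = (1/2) *\<^sub>R (X x + Y (Y x))" by (metis LIMSEQ_unique)
    then have "2 *\<^sub>R Y x = 2 *\<^sub>R ((1/2) *\<^sub>R (X x + Y (Y x)))" by simp
    then show ?thesis by simp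
  qed
  have comm: "B (Y x) = Y (B x)" if B: "bounded_linear B" "\<And>x. B (X x) = X (B x)" for B x
  proof -
    have "(\<lambda>n. B (sqrt_iter X n x)) \<longlonglongrightarrow> B (Y x)"
      using bounded_linear.tendsto[OF B(1) lim] .
    then have "(\<lambda>n. sqrt_iter X n (B x)) \<longlonglongrightarrow> B (Y x)"
      by (simp add: sqrt_iter_commute[where B=B and X=X, OF B])
    then show ?thesis using lim LIMSEQ_unique by blast
  qed
  show thesis using that Y_bl Y_sym Y_le eq comm by blast
qed

end

definition commutes :: "('a \<Rightarrow> 'a) \<Rightarrow> ('a \<Rightarrow> 'a) \<Rightarrow> bool" where
  "commutes A B \<longleftrightarrow> (\<forall>x. A (B x) = B (A x))"

lemma commutesD: "commutes A B \<Longrightarrow> A (B x) = B (A x)"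
  by (simp add: commutes_def)

lemma commutes_sym: "commutes A B \<Longrightarrow> commutes B A"
  by (simp add: commutes_def)

text \<open>For a bound K of \<open>A\<close> the iteration is run on the positive contraction 1 - A
  / K, and the root is sqrt K (1 - Y). The clause on commuting operators later gives complex
  linearity of roots, commutation of |Q| with |E|, and commutation of \<open>Q\<close> with the root
  that makes the embedding isometric.\<close>

lemma pos_op_sqrt:
  fixes A :: "'a::{real_inner,complete_space} \<Rightarrow> 'a"
  assumes A: "pos_op A"
  obtains S where "pos_op S" "\<And>x. S (S x) = A x"
    "\<And>B. bounded_linear B \<Longrightarrow> commutes B A \<Longrightarrow> commutes B S"
proof -
  interpret A: bounded_linear A using pos_opD(1)[OF A] .
  obtain K where K: "K > 0" "\<And>x. norm (A x) \<le> norm x * K"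
    using A.pos_bounded by blast
  have K_le: "inner (A x) x \<le> K * (norm x)\<^sup>2" for x
    using norm_cauchy_schwarz[of "A x" x] mult_right_mono[OF K(2)[of x] norm_ge_zero[of x]]
    by (simp add: power2_eq_square algebra_simps)
  define X where "X x = x - (1/K) *\<^sub>R A x" for x
  have X_bl: "bounded_linear X"
    unfolding X_def by (intro bounded_linear_sub bounded_linear_ident bounded_linear_const_scaleR
        A.bounded_linear_axioms)
  have X_sym: "inner (X x) y = inner x (X y)" for x y
    by (simp add: X_def inner_diff_left inner_diff_right pos_opD(2)[OF A])
  have X_inner: "inner (X x) x = (norm x)\<^sup>2 - (1/K) * inner (A x) x" for x
    by (simp add: X_def inner_diff_left power2_norm_eq_inner)
  have "0 \<le> inner (X x) x" for x
    using K_le[of x] K(1) by (simp add: X_inner field_simps)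
  then have X_pos: "pos_op X" using X_bl X_sym by (simp add: pos_op_def)
  have X_le: "norm (X x) \<le> norm x" for x
  proof -
    have "norm (X x) \<le> 1 * norm x"
      by (rule pos_op_norm_le[OF X_pos]) (use pos_opD(3)[OF A] K(1) in \<open>auto simp: X_inner\<close>)
    then show ?thesis by simp
  qed
  obtain Y where Y: "bounded_linear Y" "\<And>x y. inner (Y x) y = inner x (Y y)"
    "\<And>x. norm (Y x) \<le> norm x" "\<And>x. 2 *\<^sub>R Y x = X x + Y (Y x)"
    "\<And>B x. bounded_linear B \<Longrightarrow> (\<And>x. B (X x) = X (B x)) \<Longrightarrow> B (Y x) = Y (B x)"
    using sqrt_iter_limit[OF X_bl X_le X_sym] by blast
  interpret Y: bounded_linear Y by fact
  define S where "S x = sqrt K *\<^sub>R (x - Y x)" for x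
  show thesis
  proof
    have "0 \<le> inner (S x) x" for x
    proof -
      have "inner (Y x) x \<le> (norm x)\<^sup>2"
        using norm_cauchy_schwarz[of "Y x" x] mult_right_mono[OF Y(3)[of x] norm_ge_zero[of x]]
        by (simp add: power2_eq_square)
      then show ?thesis
        using K(1) by (simp add: S_def inner_diff_left power2_norm_eq_inner)
    qed
    moreover have "bounded_linear S"
      unfolding S_def by (intro bounded_linear_sub bounded_linear_ident bounded_linear_const_scaleR
          Y.bounded_linear_axioms)
    ultimately show "pos_op S"
      by (simp add: pos_op_def S_def inner_diff_left inner_diff_right Y(2))
    show "S (S x) = A x" for x
    proof -
      have "S (S x) = K *\<^sub>R (x - 2 *\<^sub>R Y x + Y (Y x))"
        using K(1) by (simp add: S_def Y.diff Y.scaleR algebra_simps scaleR_2)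
      also have "\<dots> = A x"
        unfolding Y(4) using K(1) by (simp add: X_def)
      finally show ?thesis .
    qed
    fix B :: "'a \<Rightarrow> 'a" assume B: "bounded_linear B" "commutes B A"
    interpret B: bounded_linear B by fact
    have "B (Y x) = Y (B x)" for x
      by (rule Y(5)) (use B in \<open>simp_all add: X_def B.diff B.scaleR commutesD\<close>)
    then show "commutes B S"
      by (simp add: commutes_def S_def B.diff B.scaleR)
  qed
qed

text \<open>If two roots P, R of the same operator commute, then y = P x - R x satisfies (P + R) y =
  0; positivity gives P y = R y = 0, hence <y, y> = 0. Arbitrary roots are each compared with the
  one from \<open>pos_op_sqrt\<close>, which commutes with both of them.\<close>

lemma pos_op_sqrt_unique:
  fixes P S :: "'a::{real_inner,complete_space} \<Rightarrow> 'a"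
  assumes P: "pos_op P" and S: "pos_op S" and eq: "\<And>x. P (P x) = S (S x)"
  shows "P = S"
proof -
  have *: "P = R" if P: "pos_op P" and R: "pos_op R" and eq: "\<And>x. P (P x) = R (R x)"
    and comm: "commutes P R" for P R :: "'a \<Rightarrow> 'a"
  proof
    fix x
    interpret P: bounded_linear P using pos_opD(1)[OF P] .
    interpret R: bounded_linear R using pos_opD(1)[OF R] .
    define y where "y = P x - R x"
    have "P y + R y = 0"
      by (simp add: y_def P.diff R.diff eq commutesD[OF comm])
    then have "inner (P y) y + inner (R y) y = 0"
      by (metis inner_add_left inner_zero_left)
    then have "inner (P y) y = 0" "inner (R y) y = 0"
      using pos_opD(3)[OF P, of y] pos_opD(3)[OF R, of y] by linarith+
    then have "P y = 0" "R y = 0"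
      using P R pos_op_eq_0 by blast+
    then have "inner y y = 0"
      by (simp add: y_def inner_diff_left pos_opD(2)[OF P] pos_opD(2)[OF R])
    then show "P x = R x" by (simp add: y_def)
  qed
  have "pos_op (\<lambda>x. P (P x))"
    using bounded_linear_compose[OF pos_opD(1)[OF P] pos_opD(1)[OF P]] pos_opD(2)[OF P]
    unfolding pos_op_def by (metis inner_ge_zero)
  from pos_op_sqrt[OF this] obtain R where R: "pos_op R" "\<And>x. R (R x) = P (P x)"
    "\<And>B. bounded_linear B \<Longrightarrow> commutes B (\<lambda>x. P (P x)) \<Longrightarrow> commutes B R" by blast
  have "P = R"
    by (rule *) (use P R pos_opD(1)[OF P] in \<open>auto simp: commutes_def\<close>)
  moreover have "commutes S R"
    by (rule R(3)) (use pos_opD(1)[OF S] eq in \<open>auto simp: commutes_def\<close>)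
  then have "S = R"
    by (intro *) (use S R eq in auto)
  ultimately show ?thesis by simp
qed

subsection \<open>Joint approximate eigenvectors\<close>

definition sym_op :: "('a::real_inner \<Rightarrow> 'a) \<Rightarrow> bool" where
  "sym_op M \<longleftrightarrow> bounded_linear M \<and> (\<forall>x y. inner (M x) y = inner x (M y))"

lemma sym_opD:
  assumes "sym_op M"
  shows "bounded_linear M" "inner (M x) y = inner x (M y)"
  using assms unfolding sym_op_def by blast+

lemma pos_op_imp_sym_op: "pos_op A \<Longrightarrow> sym_op A"
  by (simp add: pos_op_def sym_op_def)

lemma sym_op_diff: "sym_op A \<Longrightarrow> sym_op B \<Longrightarrow> sym_op (\<lambda>x. A x - B x)"
  by (simp add: sym_op_def bounded_linear_sub inner_diff_left inner_diff_right)

lemma sym_op_scaleR: "sym_op A \<Longrightarrow> sym_op (\<lambda>x. c *\<^sub>R A x)"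
  by (simp add: sym_op_def bounded_linear_const_scaleR)

lemma sym_op_ident: "sym_op (\<lambda>x. x)"
  by (simp add: sym_op_def bounded_linear_ident)

lemma sym_op_compose:
  assumes "sym_op A" "sym_op B" "commutes A B"
  shows "sym_op (\<lambda>x. A (B x))"
  using bounded_linear_compose[OF sym_opD(1)[OF assms(1)] sym_opD(1)[OF assms(2)]] assms
  unfolding sym_op_def commutes_def by metis

lemma sym_op_square: "sym_op A \<Longrightarrow> sym_op (\<lambda>x. A (A x))"
  by (rule sym_op_compose) (auto simp: commutes_def)

text \<open>
  With \<open>S\<^sup>2 = A\<close> and \<open>R\<^sup>2 = 1 - A\<close>, the moves \<open>y \<mapsto> S y\<close> and \<open>y \<mapsto> R y\<close> imitate one toss of a
  coin with success probability \<open>A\<close>. After \<open>k\<close> successes and with \<open>m\<close> of \<open>n\<close> tosses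
  to come, the quadratic form below is the conditional expectation of
  \<open>M - K (A - (number of successes) / n)\<^sup>2\<close>, so that it is positive for one of the two moves
  whenever it is positive before the move. At the start the variance term is \<open>K A (1 - A) / n\<close>.
\<close>

definition toss_form ::
    "('a::real_inner \<Rightarrow> 'a) \<Rightarrow> ('a \<Rightarrow> 'a) \<Rightarrow> real \<Rightarrow> nat \<Rightarrow> nat \<Rightarrow> nat \<Rightarrow> 'a \<Rightarrow> real" where
  "toss_form M A K n m k y = inner (M y) y - (K / (real n)\<^sup>2) *
     ((norm ((real n - real m) *\<^sub>R A y - real k *\<^sub>R y))\<^sup>2
       + real m * (inner (A y) y - inner (A y) (A y)))"

lemma toss_form_expand:
  "toss_form M A K n m k y = inner (M y) y - (K / (real n)\<^sup>2) *
     ((real n - real m)\<^sup>2 * inner (A y) (A y) - 2 * (real n - real m) * real k * inner (A y) y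
       + (real k)\<^sup>2 * inner y y + real m * (inner (A y) y - inner (A y) (A y)))"
  unfolding toss_form_def power2_norm_eq_inner
  by (simp add: inner_commute[of y "A y"] power2_eq_square algebra_simps)

text \<open>The law of total expectation for one toss. As S^2 = A and R^2 = 1 - A, both forms on the
  right are combinations of <M y, y>, <M y, A y> and the moments <A^i y, y> with i <= 3; a
  polynomial identity remains.\<close>

lemma toss_form_step:
  assumes A: "sym_op A" and S: "sym_op S" and R: "sym_op R"
    and SS: "\<And>x. S (S x) = A x" and RR: "\<And>x. R (R x) = x - A x"
    and SA: "commutes S A" and RA: "commutes R A" and SM: "commutes S M" and RM: "commutes R M"
  shows "toss_form M A K n (Suc m) k y
    = toss_form M A K n m (Suc k) (S y) + toss_form M A K n m k (R y)"
proof -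
  define a0 a1 a2 a3 b0 b1 where "a0 = inner y y" and "a1 = inner (A y) y"
    and "a2 = inner (A y) (A y)" and "a3 = inner (A (A y)) (A y)"
    and "b0 = inner (M y) y" and "b1 = inner (M y) (A y)"
  have s: "inner (S u) (S v) = inner (A u) v" for u v
    by (simp add: sym_opD(2)[OF S] SS sym_opD(2)[OF A])
  have r: "inner (R u) (R v) = inner u v - inner (A u) v" for u v
    by (simp add: sym_opD(2)[OF R] RR inner_diff_right sym_opD(2)[OF A])
  note com = commutesD[OF SA, symmetric] commutesD[OF RA, symmetric]
    commutesD[OF SM, symmetric] commutesD[OF RM, symmetric]
  have "toss_form M A K n m (Suc k) (S y) = b1 - (K / (real n)\<^sup>2) *
     ((real n - real m)\<^sup>2 * a3 - 2 * (real n - real m) * real (Suc k) * a2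
       + (real (Suc k))\<^sup>2 * a1 + real m * (a2 - a3))"
    unfolding toss_form_expand com s
    by (simp add: a1_def a2_def a3_def b1_def sym_opD(2)[OF A])
  moreover have "toss_form M A K n m k (R y) = (b0 - b1) - (K / (real n)\<^sup>2) *
     ((real n - real m)\<^sup>2 * (a2 - a3) - 2 * (real n - real m) * real k * (a1 - a2)
       + (real k)\<^sup>2 * (a0 - a1) + real m * ((a1 - a2) - (a2 - a3)))"
    unfolding toss_form_expand com r
    by (simp add: a0_def a1_def a2_def a3_def b0_def b1_def sym_opD(2)[OF A])
  moreover have "toss_form M A K n (Suc m) k y = b0 - (K / (real n)\<^sup>2) *
     ((real n - real (Suc m))\<^sup>2 * a2 - 2 * (real n - real (Suc m)) * real k * a1
       + (real k)\<^sup>2 * a0 + real (Suc m) * (a1 - a2))"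
    unfolding toss_form_expand by (simp add: a0_def a1_def a2_def b0_def)
  moreover have id: "(real n - real (Suc m))\<^sup>2 * a2 - 2 * (real n - real (Suc m)) * real k * a1
       + (real k)\<^sup>2 * a0 + real (Suc m) * (a1 - a2)
     = ((real n - real m)\<^sup>2 * a3 - 2 * (real n - real m) * real (Suc k) * a2
       + (real (Suc k))\<^sup>2 * a1 + real m * (a2 - a3))
     + ((real n - real m)\<^sup>2 * (a2 - a3) - 2 * (real n - real m) * real k * (a1 - a2)
       + (real k)\<^sup>2 * (a0 - a1) + real m * ((a1 - a2) - (a2 - a3)))"
    by (simp add: power2_eq_square algebra_simps)
  ultimately show ?thesis unfolding id distrib_left by linarith
qed

text \<open>When no toss is left, the form is <M y, y> - K ||A y - (j/n) y||^2 with j the number of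
  successes, so s = j/n. Since <M y, y> is at most a constant times ||y||^2, a large K makes y
  nearly an eigenvector of \<open>A\<close> while the form of \<open>M\<close> stays
  positive.\<close>

lemma localize_contraction:
  fixes A M :: "'a::{real_inner,complete_space} \<Rightarrow> 'a"
  assumes A: "pos_op A" and A1: "pos_op (\<lambda>x. x - A x)" and M: "bounded_linear M"
    and MA: "commutes M A" and K: "0 \<le> K" and x: "0 < inner (M x) x"
  obtains s y where "0 \<le> s" "s \<le> 1" "K * (norm (A y - s *\<^sub>R y))\<^sup>2 < inner (M y) y"
proof -
  interpret M: bounded_linear M by fact
  interpret A: bounded_linear A using pos_opD(1)[OF A] .
  obtain S where S: "pos_op S" "\<And>x. S (S x) = A x"
    "\<And>B. bounded_linear B \<Longrightarrow> commutes B A \<Longrightarrow> commutes B S" using pos_op_sqrt[OF A] by blast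
  obtain R where R: "pos_op R" "\<And>x. R (R x) = x - A x"
    "\<And>B. bounded_linear B \<Longrightarrow> commutes B (\<lambda>x. x - A x) \<Longrightarrow> commutes B R"
    using pos_op_sqrt[OF A1] by blast
  have com: "commutes S A" "commutes R A" "commutes S M" "commutes R M"
    using S(3)[OF A.bounded_linear_axioms] S(3)[OF M MA] R(3)[OF A.bounded_linear_axioms] R(3)[OF M]
      MA by (auto simp: commutes_def A.diff M.diff)
  note step = toss_form_step[OF pos_op_imp_sym_op[OF A] pos_op_imp_sym_op[OF S(1)]
      pos_op_imp_sym_op[OF R(1)] S(2) R(2) com]
  \<comment> \<open>The variance term at the start is at most K <A x, x> / n, which this n makes
    smaller than <M x, x>.\<close>
  obtain n :: nat where n: "K * inner (A x) x / inner (M x) x < real n" "0 < n"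
    using reals_Archimedean2[of "max 0 (K * inner (A x) x / inner (M x) x)"]
    by (metis max_less_iff_conj of_nat_0_less_iff)
  have desc: "\<exists>j\<le>n. \<exists>z. 0 < toss_form M A K n 0 j z"
    if "0 < toss_form M A K n m k y" "k + m \<le> n" for m k y
    using that
  proof (induction m arbitrary: k y)
    case 0
    then show ?case by auto
  next
    case (Suc m)
    then have "0 < toss_form M A K n m (Suc k) (S y) \<or> 0 < toss_form M A K n m k (R y)"
      unfolding step by linarith
    then show ?case
    proof
      assume "0 < toss_form M A K n m (Suc k) (S y)"
      then show ?case using Suc.IH[of "Suc k" "S y"] Suc.prems(2) by simp
    next
      assume "0 < toss_form M A K n m k (R y)"
      then show ?case using Suc.IH[of k "R y"] Suc.prems(2) by simp
    qed
  qed
  have "(K / (real n)\<^sup>2) * (real n * (inner (A x) x - inner (A x) (A x))) < inner (M x) x"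
  proof -
    have "(K / (real n)\<^sup>2) * (real n * (inner (A x) x - inner (A x) (A x)))
        \<le> (K / (real n)\<^sup>2) * (real n * inner (A x) x)"
      using K by (intro mult_left_mono) auto
    also have "\<dots> = K * inner (A x) x / real n"
      using n(2) by (simp add: power2_eq_square field_simps)
    also have "\<dots> < inner (M x) x"
      using n x by (simp add: field_simps)
    finally show ?thesis .
  qed
  then have "0 < toss_form M A K n n 0 x" by (simp add: toss_form_def)
  from desc[OF this] obtain j z where j: "j \<le> n" and z: "0 < toss_form M A K n 0 j z" by auto
  show thesis
  proof
    show "0 \<le> real j / real n" "real j / real n \<le> 1" using j n(2) by auto
    have "real n *\<^sub>R (A z - (real j / real n) *\<^sub>R z) = real n *\<^sub>R A z - real j *\<^sub>R z"
      using n(2) by (simp add: scaleR_diff_right)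
    then have "(norm (real n *\<^sub>R A z - real j *\<^sub>R z))\<^sup>2
        = (real n)\<^sup>2 * (norm (A z - (real j / real n) *\<^sub>R z))\<^sup>2"
      by (metis norm_scaleR power_mult_distrib power2_abs)
    then show "K * (norm (A z - (real j / real n) *\<^sub>R z))\<^sup>2 < inner (M z) z"
      using z n(2) by (simp add: toss_form_def)
  qed
qed

lemma localize:
  fixes A M :: "'a::{real_inner,complete_space} \<Rightarrow> 'a"
  assumes A: "pos_op A" and a: "0 < a" "\<And>x. norm (A x) \<le> a * norm x" and M: "bounded_linear M"
    and MA: "commutes M A" and K: "0 \<le> K" and x: "0 < inner (M x) x"
  obtains s y where "0 \<le> s" "s \<le> a" "K * (norm (A y - s *\<^sub>R y))\<^sup>2 < inner (M y) y"
proof -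
  interpret M: bounded_linear M by fact
  let ?A = "\<lambda>x. (1/a) *\<^sub>R A x"
  have sym: "sym_op ?A"
    by (intro sym_op_scaleR pos_op_imp_sym_op A)
  then have 1: "pos_op ?A"
    using a(1) pos_opD(3)[OF A] by (simp add: pos_op_def sym_op_def)
  have "inner (A x) x \<le> a * inner x x" for x
    using norm_cauchy_schwarz[of "A x" x] mult_right_mono[OF a(2)[of x] norm_ge_zero[of x]]
    by (simp add: power2_norm_eq_inner[symmetric] power2_eq_square algebra_simps)
  then have "(1/a) * inner (A x) x \<le> inner x x" for x
    using a(1) by (simp add: pos_divide_le_eq mult.commute)
  then have "0 \<le> inner (x - ?A x) x" for x
    by (simp add: inner_diff_left)
  then have 2: "pos_op (\<lambda>x. x - ?A x)"
    using sym_op_diff[OF sym_op_ident sym] unfolding pos_op_def sym_op_def by blast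
  have 3: "commutes M ?A"
    using MA by (simp add: commutes_def M.scaleR)
  \<comment> \<open>The factor a^2 compensates for the rescaling of \<open>A\<close> to a
    contraction.\<close>
  obtain s y where s: "0 \<le> s" "s \<le> 1" "K * a\<^sup>2 * (norm (?A y - s *\<^sub>R y))\<^sup>2 < inner (M y) y"
    using localize_contraction[OF 1 2 M 3 _ x, of "K * a\<^sup>2"] K by auto
  show thesis
  proof
    show "0 \<le> a * s" "a * s \<le> a" using s a(1) by auto
    have "A y - (a * s) *\<^sub>R y = a *\<^sub>R (?A y - s *\<^sub>R y)"
      using a(1) by (simp add: scaleR_diff_right)
    then have "(norm (A y - (a * s) *\<^sub>R y))\<^sup>2 = a\<^sup>2 * (norm (?A y - s *\<^sub>R y))\<^sup>2"
      by (metis norm_scaleR power_mult_distrib power2_abs)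
    then show "K * (norm (A y - (a * s) *\<^sub>R y))\<^sup>2 < inner (M y) y"
      using s(3) by (simp add: mult.assoc)
  qed
qed

definition joint_approx_eigen ::
    "('a::real_normed_vector \<Rightarrow> 'a) \<Rightarrow> ('a \<Rightarrow> 'a) \<Rightarrow> real \<Rightarrow> real \<Rightarrow> (nat \<Rightarrow> 'a) \<Rightarrow> bool" where
  "joint_approx_eigen A B s t y \<longleftrightarrow> (\<forall>n. norm (y n) = 1) \<and>
     (\<lambda>n. A (y n) - s *\<^sub>R y n) \<longlonglongrightarrow> 0 \<and> (\<lambda>n. B (y n) - t *\<^sub>R y n) \<longlonglongrightarrow> 0"

lemma bounded_linear_norm_bound:
  assumes "bounded_linear A"
  obtains a where "0 < a" "\<And>x. norm (A x) \<le> a * norm x"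
  using bounded_linear.pos_bounded[OF assms] by (metis mult.commute)

text \<open>After \<open>A\<close> has been localized, its penalty is absorbed into the form: N = M
  - K (A - s)^2 still commutes with \<open>B\<close> and is positive at the vector found, so
  localizing \<open>B\<close> against N keeps what was achieved for \<open>A\<close>.\<close>

lemma joint_localize:
  fixes A B M :: "'a::{real_inner,complete_space} \<Rightarrow> 'a"
  assumes A: "pos_op A" and a: "0 < a" "\<And>x. norm (A x) \<le> a * norm x"
    and B: "pos_op B" and b: "0 < b" "\<And>x. norm (B x) \<le> b * norm x"
    and M: "bounded_linear M" and AB: "commutes A B" and MA: "commutes M A" and MB: "commutes M B"
    and K: "0 \<le> K" and x: "0 < inner (M x) x"
  obtains s t y where "0 \<le> s" "s \<le> a" "0 \<le> t" "t \<le> b"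
    "K * (norm (A y - s *\<^sub>R y))\<^sup>2 + K * (norm (B y - t *\<^sub>R y))\<^sup>2 < inner (M y) y"
proof -
  obtain s u where s: "0 \<le> s" "s \<le> a" "K * (norm (A u - s *\<^sub>R u))\<^sup>2 < inner (M u) u"
    using localize[OF A a M MA K x] by blast
  define P where "P y = A y - s *\<^sub>R y" for y
  have P: "sym_op P"
    unfolding P_def by (intro sym_op_diff sym_op_scaleR sym_op_ident pos_op_imp_sym_op A)
  define N where "N y = M y - K *\<^sub>R P (P y)" for y
  interpret B: bounded_linear B using pos_opD(1)[OF B] .
  have PB: "P (B y) = B (P y)" for y
    by (simp add: P_def B.diff B.scaleR commutesD[OF AB])
  have N_bl: "bounded_linear N"
    unfolding N_def by (intro bounded_linear_sub M bounded_linear_const_scaleR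
        sym_opD(1)[OF sym_op_square[OF P]])
  have N_inner: "inner (N y) y = inner (M y) y - K * (norm (P y))\<^sup>2" for y
    by (simp add: N_def inner_diff_left sym_opD(2)[OF P] power2_norm_eq_inner)
  have NB: "commutes N B"
    by (simp add: commutes_def N_def PB B.diff B.scaleR commutesD[OF MB])
  have "0 < inner (N u) u" using s(3) by (simp add: N_inner P_def)
  from localize[OF B b N_bl NB K this] obtain t y where
    "0 \<le> t" "t \<le> b" "K * (norm (B y - t *\<^sub>R y))\<^sup>2 < inner (N y) y" by blast
  then show thesis
    using that[of s t y] s by (simp add: N_inner P_def)
qed

text \<open>Localize with K = n + 1 and normalise: the penalties stay below the bound C of
  \<open>M\<close>, so both errors are O(1/n) in square. The uniform lower bound c survives passage
  to the limit, so if \<open>M\<close> is a polynomial in \<open>A\<close> and \<open>B\<close>, its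
  value at (s, t) is positive.\<close>

theorem joint_approx_eigen_exists:
  fixes A B M :: "'a::{real_inner,complete_space} \<Rightarrow> 'a"
  assumes A: "pos_op A" and B: "pos_op B" and M: "bounded_linear M"
    and AB: "commutes A B" and MA: "commutes M A" and MB: "commutes M B"
    and x: "0 < inner (M x) x"
  obtains s t y c where "0 \<le> s" "0 \<le> t" "joint_approx_eigen A B s t y"
    "0 < c" "\<And>n. c \<le> inner (M (y n)) (y n)"
proof -
  obtain a where a: "0 < a" "\<And>x. norm (A x) \<le> a * norm x"
    using bounded_linear_norm_bound[OF pos_opD(1)[OF A]] by blast
  obtain b where b: "0 < b" "\<And>x. norm (B x) \<le> b * norm x"
    using bounded_linear_norm_bound[OF pos_opD(1)[OF B]] by blast
  obtain C where C: "0 < C" "\<And>x. norm (M x) \<le> C * norm x"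
    using bounded_linear_norm_bound[OF M] by blast
  interpret M: bounded_linear M by fact
  interpret A: bounded_linear A using pos_opD(1)[OF A] .
  interpret B: bounded_linear B using pos_opD(1)[OF B] .
  have "x \<noteq> 0" using x by auto
  \<comment> \<open>Half the Rayleigh quotient, so that M - c is still positive at x and the gap c
    is inherited by all the vectors produced.\<close>
  define c where "c = inner (M x) x / (2 * inner x x)"
  have c: "0 < c" using x \<open>x \<noteq> 0\<close> by (simp add: c_def)
  define N where "N y = M y - c *\<^sub>R y" for y
  have N: "bounded_linear N"
    unfolding N_def by (intro bounded_linear_sub M bounded_linear_const_scaleR bounded_linear_ident)
  have NA: "commutes N A" and NB: "commutes N B"
    by (simp_all add: commutes_def N_def A.diff A.scaleR B.diff B.scaleR commutesD[OF MA]
        commutesD[OF MB])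
  have "c * inner x x = inner (M x) x / 2" using \<open>x \<noteq> 0\<close> by (simp add: c_def)
  then have Nx: "0 < inner (N x) x" using x by (simp add: N_def inner_diff_left)
  have "\<exists>p. fst p \<in> {0..a} \<and> fst (snd p) \<in> {0..b} \<and> norm (snd (snd p)) = 1 \<and>
      c \<le> inner (M (snd (snd p))) (snd (snd p)) \<and>
      (norm (A (snd (snd p)) - fst p *\<^sub>R snd (snd p)))\<^sup>2 \<le> C / real (Suc n) \<and>
      (norm (B (snd (snd p)) - fst (snd p) *\<^sub>R snd (snd p)))\<^sup>2 \<le> C / real (Suc n)" (is "\<exists>p. ?P n p") for n
  proof -
    obtain s t z where st: "0 \<le> s" "s \<le> a" "0 \<le> t" "t \<le> b"
      and z: "real (Suc n) * (norm (A z - s *\<^sub>R z))\<^sup>2 + real (Suc n) * (norm (B z - t *\<^sub>R z))\<^sup>2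
        < inner (N z) z"
      using joint_localize[OF A a B b N AB NA NB _ Nx, of "real (Suc n)"] by auto
    have "z \<noteq> 0" using z by (auto simp: N_def)
    define y where "y = z /\<^sub>R norm z"
    have y: "norm y = 1" using \<open>z \<noteq> 0\<close> by (simp add: y_def)
    have z_y: "z = norm z *\<^sub>R y" using \<open>z \<noteq> 0\<close> by (simp add: y_def)
    have "A z - s *\<^sub>R z = norm z *\<^sub>R (A y - s *\<^sub>R y)" "B z - t *\<^sub>R z = norm z *\<^sub>R (B y - t *\<^sub>R y)"
      by (subst (1 2) z_y, simp add: A.scaleR B.scaleR scaleR_diff_right)+
    then have e: "(norm (A z - s *\<^sub>R z))\<^sup>2 = (norm z)\<^sup>2 * (norm (A y - s *\<^sub>R y))\<^sup>2"
      "(norm (B z - t *\<^sub>R z))\<^sup>2 = (norm z)\<^sup>2 * (norm (B y - t *\<^sub>R y))\<^sup>2"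
      by (simp_all add: power_mult_distrib)
    have "inner (N z) z = (norm z)\<^sup>2 * (inner (M y) y - c)"
      using y by (subst (1 2) z_y) (simp add: N_def M.scaleR inner_diff_left power2_eq_square
          power2_norm_eq_inner[symmetric] algebra_simps)
    with z have "(norm z)\<^sup>2 * (real (Suc n) * (norm (A y - s *\<^sub>R y))\<^sup>2
        + real (Suc n) * (norm (B y - t *\<^sub>R y))\<^sup>2) < (norm z)\<^sup>2 * (inner (M y) y - c)"
      unfolding e by (simp add: algebra_simps)
    then have *: "real (Suc n) * (norm (A y - s *\<^sub>R y))\<^sup>2
        + real (Suc n) * (norm (B y - t *\<^sub>R y))\<^sup>2 < inner (M y) y - c"
      by (rule mult_left_less_imp_less) simp
    have nn: "0 \<le> real (Suc n) * (norm (A y - s *\<^sub>R y))\<^sup>2" "0 \<le> real (Suc n) * (norm (B y - t *\<^sub>R y))\<^sup>2"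
      by simp_all
    have "inner (M y) y \<le> C"
      using norm_cauchy_schwarz[of "M y" y] C(2)[of y] y by simp
    then have "real (Suc n) * (norm (A y - s *\<^sub>R y))\<^sup>2 \<le> C"
      "real (Suc n) * (norm (B y - t *\<^sub>R y))\<^sup>2 \<le> C"
      using * nn c by linarith+
    then have "(norm (A y - s *\<^sub>R y))\<^sup>2 \<le> C / real (Suc n)"
      "(norm (B y - t *\<^sub>R y))\<^sup>2 \<le> C / real (Suc n)"
      by (simp_all add: pos_le_divide_eq mult.commute)
    moreover have "c \<le> inner (M y) y" using * nn by linarith
    ultimately show ?thesis using st y by (intro exI[of _ "(s, t, y)"]) simp
  qed
  then obtain f where f: "\<And>n. ?P n (f n)" by metis
  define s t y where "s n = fst (f n)" and "t n = fst (snd (f n))" and "y n = snd (snd (f n))" for n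
  have sy: "\<And>n. s n \<in> {0..a}" "\<And>n. t n \<in> {0..b}" "\<And>n. norm (y n) = 1"
    "\<And>n. c \<le> inner (M (y n)) (y n)"
    "\<And>n. (norm (A (y n) - s n *\<^sub>R y n))\<^sup>2 \<le> C / real (Suc n)"
    "\<And>n. (norm (B (y n) - t n *\<^sub>R y n))\<^sup>2 \<le> C / real (Suc n)"
    unfolding s_def t_def y_def using f by blast+
  \<comment> \<open>The approximate eigenvalues vary with n; a convergent subsequence replaces them
    by fixed numbers.\<close>
  have "compact ({0..a} \<times> {0..b})" by (intro compact_Times compact_Icc)
  then have "seq_compact ({0..a} \<times> {0..b})" by (rule compact_imp_seq_compact)
  moreover have "\<forall>n. (s n, t n) \<in> {0..a} \<times> {0..b}" using sy(1,2) by simp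
  ultimately obtain l r where l: "l \<in> {0..a} \<times> {0..b}" and r: "strict_mono r"
    and lim: "((\<lambda>n. (s n, t n)) \<circ> r) \<longlonglongrightarrow> l"
    by (rule seq_compactE)
  obtain s' t' where l_eq: "l = (s', t')" by fastforce
  have s': "(\<lambda>n. s (r n)) \<longlonglongrightarrow> s'" and t': "(\<lambda>n. t (r n)) \<longlonglongrightarrow> t'"
    using tendsto_fst[OF lim] tendsto_snd[OF lim] by (simp_all add: l_eq o_def)
  have lim0: "(\<lambda>n. D (y (r n)) - w' *\<^sub>R y (r n)) \<longlonglongrightarrow> 0"
    if sq: "\<And>n. (norm (D (y n) - w n *\<^sub>R y n))\<^sup>2 \<le> C / real (Suc n)" and w: "(\<lambda>n. w (r n)) \<longlonglongrightarrow> w'"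
    for D :: "'a \<Rightarrow> 'a" and w w'
  proof -
    have "(\<lambda>n. C * (1 / real (Suc n))) \<longlonglongrightarrow> C * 0"
      by (intro tendsto_mult tendsto_const lim_1_over_n[THEN LIMSEQ_Suc])
    then have "(\<lambda>n. C / real (Suc n)) \<longlonglongrightarrow> 0" by simp
    then have "(\<lambda>n. (norm (D (y n) - w n *\<^sub>R y n))\<^sup>2) \<longlonglongrightarrow> 0"
      by (rule Lim_null_comparison[rotated]) (use sq in simp)
    from tendsto_real_sqrt[OF this] have "(\<lambda>n. norm (D (y n) - w n *\<^sub>R y n)) \<longlonglongrightarrow> 0"
      by simp
    from LIMSEQ_subseq_LIMSEQ[OF tendsto_norm_zero_cancel[OF this] r]
    have 1: "(\<lambda>n. D (y (r n)) - w (r n) *\<^sub>R y (r n)) \<longlonglongrightarrow> 0"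
      by (simp add: o_def)
    have "(\<lambda>n. w (r n) - w') \<longlonglongrightarrow> 0" using w by (simp add: LIM_zero)
    then have "(\<lambda>n. (w (r n) - w') *\<^sub>R y (r n)) \<longlonglongrightarrow> 0"
      using sy(3) by (intro tendsto_norm_zero_cancel[of "\<lambda>n. (w (r n) - w') *\<^sub>R y (r n)"])
        (simp add: tendsto_rabs_zero)
    from tendsto_add[OF 1 this] show ?thesis by (simp add: algebra_simps)
  qed
  show thesis
  proof
    show "0 \<le> s'" "0 \<le> t'" using l l_eq by auto
    show "joint_approx_eigen A B s' t' (\<lambda>n. y (r n))"
      unfolding joint_approx_eigen_def using lim0[OF sy(5) s'] lim0[OF sy(6) t'] sy(3) by blast
    show "0 < c" by fact
    show "c \<le> inner (M (y (r n))) (y (r n))" for n using sy(4) .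
  qed
qed

section \<open>Complex Hilbert spaces\<close>

lemma cinner_add_right: "cinner x (y + z) = cinner x y + cinner x (z :: 'a::chilbert_space)"
  by (metis cinner_add_left cinner_commute complex_cnj_add)

lemma cinner_scaleC_right: "cinner x (a *\<^sub>C y) = cnj a * cinner x (y :: 'a::chilbert_space)"
  by (metis cinner_scaleC_left cinner_commute complex_cnj_mult)

lemma scaleC_of_real: "complex_of_real r *\<^sub>C x = r *\<^sub>R (x :: 'a::chilbert_space)"
  by (simp add: scaleR_scaleC)

lemma scaleC_1 [simp]: "1 *\<^sub>C x = (x :: 'a::chilbert_space)"
  using scaleC_of_real[of 1 x] by simp

lemma scaleC_zero_left [simp]: "0 *\<^sub>C x = (0 :: 'a::chilbert_space)"
  using scaleC_of_real[of 0 x] by simp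

lemma scaleC_zero_right [simp]: "c *\<^sub>C 0 = (0 :: 'a::chilbert_space)"
  using scaleC_add_right[of c 0 0] by simp

lemma scaleC_minus_1: "(- 1) *\<^sub>C x = - (x :: 'a::chilbert_space)"
  using scaleC_of_real[of "-1" x] by simp

lemma scaleC_minus_right: "c *\<^sub>C (- x) = - (c *\<^sub>C (x :: 'a::chilbert_space))"
  using scaleC_add_right[of c x "- x"] by (simp add: eq_neg_iff_add_eq_0 add.commute)

lemma scaleC_diff_right: "c *\<^sub>C (x - y) = c *\<^sub>C x - c *\<^sub>C (y :: 'a::chilbert_space)"
  using scaleC_add_right[of c x "- y"] by (simp add: scaleC_minus_right)

lemma scaleC_scaleR_commute: "c *\<^sub>C (r *\<^sub>R x) = r *\<^sub>R (c *\<^sub>C (x :: 'a::chilbert_space))"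
  by (simp add: scaleR_scaleC scaleC_scaleC mult.commute)

lemma cinner_zero_left [simp]: "cinner 0 (x :: 'a::chilbert_space) = 0"
  using cinner_add_left[of 0 0 x] by simp

lemma cinner_zero_right [simp]: "cinner (x :: 'a::chilbert_space) 0 = 0"
  using cinner_add_right[of x 0 0] by simp

lemma cinner_minus_left: "cinner (- x) y = - cinner (x :: 'a::chilbert_space) y"
  using cinner_add_left[of x "- x" y] by (simp add: eq_neg_iff_add_eq_0 add.commute)

lemma cinner_minus_right: "cinner x (- y) = - cinner (x :: 'a::chilbert_space) y"
  using cinner_add_right[of x y "- y"] by (simp add: eq_neg_iff_add_eq_0 add.commute)

lemma cinner_diff_left: "cinner (x - y) z = cinner x z - cinner (y :: 'a::chilbert_space) z"
  using cinner_add_left[of x "- y" z] by (simp add: cinner_minus_left)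

lemma cinner_diff_right: "cinner x (y - z) = cinner x y - cinner (x :: 'a::chilbert_space) z"
  using cinner_add_right[of x y "- z"] by (simp add: cinner_minus_right)

lemma Im_cinner_left: "Im (cinner x y) = inner ((- \<i>) *\<^sub>C x) (y :: 'a::chilbert_space)"
  by (simp add: inner_eq_Re_cinner cinner_scaleC_left)

lemma Im_cinner_right: "Im (cinner x y) = inner x (\<i> *\<^sub>C (y :: 'a::chilbert_space))"
  by (simp add: inner_eq_Re_cinner cinner_scaleC_right)

lemma cinner_self: "cinner x x = complex_of_real ((norm (x :: 'a::chilbert_space))\<^sup>2)"
proof (rule complex_eqI)
  show "Re (cinner x x) = Re (complex_of_real ((norm x)\<^sup>2))"
    by (simp add: power2_norm_eq_inner inner_eq_Re_cinner)
  have "Im (cinner x x) = - Im (cinner x x)"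
    by (metis cinner_commute cnj.simps(2))
  then show "Im (cinner x x) = Im (complex_of_real ((norm x)\<^sup>2))" by simp
qed

lemma norm_scaleC: "norm (c *\<^sub>C x) = cmod c * norm (x :: 'a::chilbert_space)"
proof -
  have "complex_of_real ((norm (c *\<^sub>C x))\<^sup>2) = (c * cnj c) * complex_of_real ((norm x)\<^sup>2)"
    by (simp only: cinner_self[symmetric] cinner_scaleC_left cinner_scaleC_right ac_simps)
  also have "\<dots> = complex_of_real ((cmod c * norm x)\<^sup>2)"
    by (simp add: complex_norm_square[symmetric] power_mult_distrib)
  finally have "(norm (c *\<^sub>C x))\<^sup>2 = (cmod c * norm x)\<^sup>2"
    using of_real_eq_iff by blast
  then show ?thesis by simp
qed

lemma bounded_linear_scaleC: "bounded_linear (\<lambda>x :: 'a::chilbert_space. c *\<^sub>C x)"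
  by (rule bounded_linear_intro[where K="cmod c"])
    (simp_all add: scaleC_add_right scaleC_scaleR_commute norm_scaleC)

lemma bounded_clinearD:
  assumes "bounded_clinear A"
  shows "bounded_linear A" "A (c *\<^sub>C x) = c *\<^sub>C A x"
  using assms by (simp_all add: bounded_clinear_def)

lemma bounded_clinear_compose:
  "bounded_clinear A \<Longrightarrow> bounded_clinear B \<Longrightarrow> bounded_clinear (\<lambda>x. A (B x))"
  by (simp add: bounded_clinear_def bounded_linear_compose)

lemma bounded_clinear_ident: "bounded_clinear (\<lambda>x. x)"
  by (simp add: bounded_clinear_def bounded_linear_ident)

lemma bounded_clinear_add:
  "bounded_clinear A \<Longrightarrow> bounded_clinear B \<Longrightarrow> bounded_clinear (\<lambda>x. A x + B x)"
  by (simp add: bounded_clinear_def bounded_linear_add scaleC_add_right)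

lemma bounded_clinear_diff:
  "bounded_clinear A \<Longrightarrow> bounded_clinear B \<Longrightarrow> bounded_clinear (\<lambda>x. A x - B x)"
  by (simp add: bounded_clinear_def bounded_linear_sub scaleC_diff_right)

lemma bounded_clinear_scaleC: "bounded_clinear A \<Longrightarrow> bounded_clinear (\<lambda>x. c *\<^sub>C A x)"
  by (simp add: bounded_clinear_def bounded_linear_compose[OF bounded_linear_scaleC]
      scaleC_scaleC mult.commute)

lemma bounded_clinear_funpow:
  fixes A :: "'a::chilbert_space \<Rightarrow> 'a"
  assumes "bounded_clinear A"
  shows "bounded_clinear (A ^^ n)"
proof (induction n)
  case (Suc n)
  then show ?case using bounded_clinear_compose[OF assms, of "A ^^ n"] by (simp add: o_def)
qed (simp add: id_def bounded_clinear_ident)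

lemma cinner_eqI:
  assumes "\<And>x. cinner x y = cinner x z"
  shows "y = (z :: 'a::chilbert_space)"
proof -
  have "cinner (y - z) (y - z) = 0"
    using assms[of "y - z"] by (simp add: cinner_diff_right)
  then show ?thesis by (simp add: cinner_self)
qed

subsection \<open>Adjoints\<close>

lemma norm_add_sq:
  "(norm (x + y))\<^sup>2 + (norm (x - y))\<^sup>2 = 2 * (norm x)\<^sup>2 + 2 * (norm (y :: 'a::real_inner))\<^sup>2"
  by (simp add: power2_norm_eq_inner inner_add_left inner_add_right inner_diff_left inner_diff_right)

text \<open>The representing vector minimises \<open>\<parallel>x\<parallel>\<^sup>2 / 2 - f x\<close>.\<close>

theorem Riesz_representation:
  fixes f :: "'a::{real_inner,complete_space} \<Rightarrow> real"
  assumes f: "bounded_linear f"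
  obtains z where "\<And>x. f x = inner x z"
proof -
  interpret f: bounded_linear f by fact
  obtain K where K: "\<And>x. norm (f x) \<le> norm x * K" using f.bounded by blast
  define g where "g x = (norm x)\<^sup>2 / 2 - f x" for x
  have g_ge: "- K\<^sup>2 / 2 \<le> g x" for x
  proof -
    have "f x \<le> norm x * K" using K[of x] by simp
    moreover have "0 \<le> (norm x - K)\<^sup>2" by simp
    ultimately show ?thesis by (simp add: g_def power2_eq_square algebra_simps)
  qed
  define m where "m = (INF x. g x)"
  have bdd: "bdd_below (range g)" by (rule bdd_belowI2) (rule g_ge)
  have m_le: "m \<le> g x" for x
    unfolding m_def by (rule cINF_lower[OF bdd]) simp
  have "\<exists>x. g x < m + 1 / real (Suc n)" for n
    using cINF_less_iff[OF _ bdd, of "m + 1 / real (Suc n)"] by (simp add: m_def)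
  then obtain x where x: "\<And>n. g (x n) < m + 1 / real (Suc n)" by metis
  \<comment> \<open>By the parallelogram law ||u - v||^2 = 4 (g u + g v - 2 g w) at the midpoint w,
    so a minimising sequence is Cauchy.\<close>
  have close: "(norm (u - v))\<^sup>2 \<le> 4 * (g u + g v - 2 * m)" for u v
  proof -
    define w where "w = (1/2) *\<^sub>R (u + v)"
    have "g w = (norm (u + v))\<^sup>2 / 8 - (f u + f v) / 2"
      by (simp add: w_def g_def f.scaleR f.add power2_eq_square)
    moreover have "(norm (u + v))\<^sup>2 = 2 * (norm u)\<^sup>2 + 2 * (norm v)\<^sup>2 - (norm (u - v))\<^sup>2"
      using norm_add_sq[of u v] by linarith
    ultimately show ?thesis
      using m_le[of w] unfolding g_def[of u] g_def[of v] by argo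
  qed
  have "Cauchy x"
  proof (rule CauchyI)
    fix e :: real assume e: "0 < e"
    obtain N :: nat where N: "8 / e\<^sup>2 < real N" using reals_Archimedean2 by blast
    have "norm (x i - x j) < e" if "N \<le> i" "N \<le> j" for i j
    proof -
      have pos: "0 < 8 / e\<^sup>2" using e by simp
      have b: "1 / real (Suc k) < e\<^sup>2 / 8" if "N \<le> k" for k
      proof -
        have "8 / e\<^sup>2 < real (Suc k)" using N that by simp
        then have "1 / real (Suc k) < 1 / (8 / e\<^sup>2)" using pos by (intro divide_strict_left_mono) auto
        then show ?thesis by simp
      qed
      have "(norm (x i - x j))\<^sup>2 < e\<^sup>2"
        using close[of "x i" "x j"] x[of i] x[of j] b[OF that(1)] b[OF that(2)] by argo
      then show ?thesis using e by (simp add: power2_less_imp_less)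
    qed
    then show "\<exists>M. \<forall>i\<ge>M. \<forall>j\<ge>M. norm (x i - x j) < e" by blast
  qed
  then obtain z where z: "x \<longlonglongrightarrow> z"
    using Cauchy_convergent_iff convergent_def by blast
  have "(\<lambda>n. g (x n)) \<longlonglongrightarrow> g z"
    unfolding g_def by (intro tendsto_intros f.tendsto z) auto
  moreover have "(\<lambda>n. m + 1 / real (Suc n)) \<longlonglongrightarrow> m + 0"
    by (intro tendsto_add tendsto_const lim_1_over_n[THEN LIMSEQ_Suc])
  ultimately have "g z \<le> m + 0"
    using x by (intro LIMSEQ_le) (auto intro!: exI[of _ 0] less_imp_le)
  then have gz: "g z \<le> g y" for y using m_le[of y] by simp
  have "f y = inner y z" for y
  proof (cases "y = 0")
    case True
    then show ?thesis by (simp add: f.zero)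
  next
    case False
    define d where "d = f y - inner y z"
    \<comment> \<open>Moving from z by t y changes g by t^2 ||y||^2 / 2 - t d. This t minimises the
      change, to -d^2 / (2 ||y||^2), which forces d = 0.\<close>
    define t where "t = d / (norm y)\<^sup>2"
    have ty: "t * (norm y)\<^sup>2 = d" using False by (simp add: t_def)
    have "g (z + t *\<^sub>R y) = g z + (t\<^sup>2 * (norm y)\<^sup>2) / 2 - t * d"
      unfolding g_def d_def power2_norm_eq_inner
      by (simp add: f.add f.scaleR inner_add_left inner_add_right inner_commute[of z y]
          power2_eq_square algebra_simps)
    also have "\<dots> = g z - (t * d) / 2"
      using ty by (simp add: power2_eq_square mult.assoc)
    finally have "t * d \<le> 0" using gz[of "z + t *\<^sub>R y"] by simp
    then have "d\<^sup>2 / (norm y)\<^sup>2 \<le> 0" by (simp add: t_def power2_eq_square)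
    then have "d = 0" using False by (simp add: divide_le_0_iff)
    then show ?thesis by (simp add: d_def)
  qed
  then show thesis using that by blast
qed

text \<open>The real relation at x is the real part of the claim; at (- \<i>) x, by complex
  linearity of \<open>A\<close>, it is the imaginary part.\<close>

lemma cinner_adjointI:
  fixes A :: "'a::chilbert_space \<Rightarrow> 'b::chilbert_space"
  assumes "bounded_clinear A" "\<And>x y. inner (A x) y = inner x (B y)"
  shows "cinner (A x) y = cinner x (B y)"
proof (rule complex_eqI)
  show "Re (cinner (A x) y) = Re (cinner x (B y))"
    using assms(2)[of x y] by (simp add: inner_eq_Re_cinner)
  show "Im (cinner (A x) y) = Im (cinner x (B y))"
    using assms(2)[of "(- \<i>) *\<^sub>C x" y] bounded_clinearD(2)[OF assms(1)]
    by (simp only: Im_cinner_left)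
qed

lemma adjoint_exists:
  fixes A :: "'a::chilbert_space \<Rightarrow> 'b::chilbert_space"
  assumes A: "bounded_clinear A"
  obtains B where "bounded_clinear B" "\<And>x y. cinner (A x) y = cinner x (B y)"
proof -
  interpret A: bounded_linear A using bounded_clinearD(1)[OF A] .
  have "\<exists>z. \<forall>x. inner (A x) y = inner x z" for y
  proof -
    have "bounded_linear (\<lambda>x. inner (A x) y)"
      by (rule bounded_linear_compose[OF bounded_linear_inner_left A.bounded_linear_axioms])
    then show ?thesis using Riesz_representation by metis
  qed
  then obtain B where B: "\<And>x y. inner (A x) y = inner x (B y)" by metis
  note cB = cinner_adjointI[OF A B]
  obtain K where K: "0 < K" "\<And>x. norm (A x) \<le> K * norm x"
    using bounded_linear_norm_bound[OF A.bounded_linear_axioms] by blast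
  have B_scaleC: "B (c *\<^sub>C y) = c *\<^sub>C B y" for c y
    by (rule cinner_eqI) (simp add: cB[symmetric] cinner_scaleC_right)
  have "bounded_linear B"
  proof (rule bounded_linear_intro[where K=K])
    fix x y and r :: real
    show "B (x + y) = B x + B y"
      by (rule cinner_eqI) (simp add: cB[symmetric] cinner_add_right)
    show "B (r *\<^sub>R x) = r *\<^sub>R B x"
      by (simp add: scaleR_scaleC B_scaleC)
    show "norm (B x) \<le> norm x * K"
    proof (cases "B x = 0")
      case False
      have "norm (B x) * norm (B x) = inner (A (B x)) x"
        by (simp add: B power2_norm_eq_inner[symmetric] power2_eq_square)
      also have "\<dots> \<le> (K * norm (B x)) * norm x"
        using norm_cauchy_schwarz[of "A (B x)" x] mult_right_mono[OF K(2)[of "B x"] norm_ge_zero[of x]]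
        by linarith
      finally have "norm (B x) * norm (B x) \<le> norm (B x) * (norm x * K)"
        by (simp add: algebra_simps)
      then show ?thesis by (rule mult_left_le_imp_le) (use False in simp)
    qed (use K in auto)
  qed
  then have "bounded_clinear B" using B_scaleC by (simp add: bounded_clinear_def)
  then show thesis using that cB by blast
qed

lemma cadj_unique:
  assumes "\<And>x y. cinner (A x) y = cinner x (B y)"
  shows "cadj A = B"
  unfolding cadj_def
proof (rule the_equality)
  show "\<forall>x y. cinner (A x) y = cinner x (B y)" using assms by blast
  fix C assume "\<forall>x y. cinner (A x) y = cinner x (C y)"
  then show "C = B" using assms by (intro ext cinner_eqI) metis
qed

lemma
  assumes "bounded_clinear A"
  shows cinner_cadj_right: "cinner (A x) y = cinner x (cadj A y)"
    and bounded_clinear_cadj: "bounded_clinear (cadj A)"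
proof -
  obtain B where B: "bounded_clinear B" "\<And>x y. cinner (A x) y = cinner x (B y)"
    using adjoint_exists[OF assms] by blast
  then show "cinner (A x) y = cinner x (cadj A y)" "bounded_clinear (cadj A)"
    using cadj_unique[OF B(2)] by auto
qed

lemma cinner_cadj_left:
  assumes "bounded_clinear A"
  shows "cinner (cadj A x) y = cinner x (A y)"
  by (metis assms cinner_cadj_right cinner_commute)

lemma inner_cadj_right: "bounded_clinear A \<Longrightarrow> inner (A x) y = inner x (cadj A y)"
  by (simp add: inner_eq_Re_cinner cinner_cadj_right)

lemma inner_cadj_left: "bounded_clinear A \<Longrightarrow> inner (cadj A x) y = inner x (A y)"
  by (simp add: inner_eq_Re_cinner cinner_cadj_left)

lemma cadj_cadj: "bounded_clinear A \<Longrightarrow> cadj (cadj A) = A"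
  by (rule cadj_unique) (rule cinner_cadj_left)

lemma cadj_scaleC:
  assumes "bounded_clinear A"
  shows "cadj (\<lambda>x. c *\<^sub>C A x) = (\<lambda>y. cnj c *\<^sub>C cadj A y)"
  by (rule cadj_unique)
    (simp add: cinner_scaleC_left cinner_scaleC_right cinner_cadj_right[OF assms])

lemma commutes_cadj:
  assumes A: "bounded_clinear A" and M: "bounded_clinear M" "sym_op M" and AM: "commutes A M"
  shows "commutes (cadj A) M"
  unfolding commutes_def
proof (intro allI cinner_eqI)
  fix x y
  have "cinner y (M z) = cinner (M y) z" for y z
    using cinner_adjointI[OF M(1) sym_opD(2)[OF M(2)]] by simp
  then show "cinner y (cadj A (M x)) = cinner y (M (cadj A x))"
    by (simp add: cinner_cadj_right[OF A, symmetric] commutesD[OF AM])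
qed

section \<open>Positivity, square roots and absolute values over the complex scalars\<close>

lemma pos_op_cadj_self:
  assumes "bounded_clinear E"
  shows "pos_op (\<lambda>x. cadj E (E x))"
  using bounded_clinearD(1)[OF bounded_clinear_compose[OF bounded_clinear_cadj[OF assms] assms]]
  by (simp add: pos_op_def inner_cadj_left[OF assms] inner_cadj_right[OF assms, symmetric])

text \<open>Symmetry comes from polarisation: reality of the form means that the real inner product
  of P x and \<i> x vanishes for all x, and this is expanded at x + z with \<i> z = y.\<close>

lemma positive_op_iff: "positive_op P \<longleftrightarrow> bounded_clinear P \<and> pos_op P"
proof
  assume P: "positive_op P"
  then have bc: "bounded_clinear P" and re: "\<And>x. cinner (P x) x \<in> \<real>" "\<And>x. 0 \<le> Re (cinner (P x) x)"
    by (auto simp: positive_op_def)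
  interpret P: bounded_linear P using bounded_clinearD(1)[OF bc] .
  have im: "inner (P x) (\<i> *\<^sub>C x) = 0" for x
    using re(1)[of x] by (simp add: complex_is_Real_iff flip: Im_cinner_right)
  have "inner (P x) y = inner x (P y)" for x y
  proof -
    define z where "z = (- \<i>) *\<^sub>C y"
    have iz: "\<i> *\<^sub>C z = y" by (simp add: z_def scaleC_scaleC)
    have "inner (P (x + z)) (\<i> *\<^sub>C (x + z)) = inner (P x) (\<i> *\<^sub>C z) + inner (P z) (\<i> *\<^sub>C x)"
      using im[of x] im[of z] by (simp add: P.add scaleC_add_right inner_add_left inner_add_right)
    then have "inner (P x) y = - inner (P z) (\<i> *\<^sub>C x)"
      using im[of "x + z"] iz by simp
    also have "\<dots> = inner (P y) x"
      by (simp add: z_def bounded_clinearD(2)[OF bc] inner_eq_Re_cinner cinner_scaleC_left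
          cinner_scaleC_right)
    finally show ?thesis by (simp add: inner_commute)
  qed
  then show "bounded_clinear P \<and> pos_op P"
    using bc re(2) P.bounded_linear_axioms by (simp add: pos_op_def inner_eq_Re_cinner)
next
  assume P: "bounded_clinear P \<and> pos_op P"
  then have sym: "cinner (P x) y = cinner x (P y)" for x y
    using cinner_adjointI[of P P] pos_opD(2)[of P] by blast
  have "cinner (P x) x = cnj (cinner (P x) x)" for x
    using sym[of x x] cinner_commute[of x "P x"] by simp
  then have "cinner (P x) x \<in> \<real>" for x
    by (metis Reals_cnj_iff)
  then show "positive_op P"
    using P pos_opD(3)[of P] by (simp add: positive_op_def inner_eq_Re_cinner)
qed

lemma positive_op_sqrt:
  fixes A :: "'a::chilbert_space \<Rightarrow> 'a"
  assumes A: "pos_op A" "bounded_clinear A"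
  obtains S where "bounded_clinear S" "pos_op S" "\<And>x. S (S x) = A x"
    "\<And>B. bounded_linear B \<Longrightarrow> commutes B A \<Longrightarrow> commutes B S"
proof -
  obtain S where S: "pos_op S" "\<And>x. S (S x) = A x"
    "\<And>B. bounded_linear B \<Longrightarrow> commutes B A \<Longrightarrow> commutes B S"
    using pos_op_sqrt[OF A(1)] by blast
  have "commutes (\<lambda>x. c *\<^sub>C x) S" for c
    by (rule S(3)[OF bounded_linear_scaleC]) (simp add: commutes_def bounded_clinearD(2)[OF A(2)])
  then have "bounded_clinear S"
    using pos_opD(1)[OF S(1)] by (simp add: bounded_clinear_def commutes_def)
  then show thesis using that S by blast
qed

lemma
  assumes E: "bounded_clinear E"
  shows pos_op_op_abs: "pos_op (op_abs E)"
    and op_abs_square: "op_abs E (op_abs E x) = cadj E (E x)"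
    and commutes_op_abs:
      "bounded_linear B \<Longrightarrow> commutes B (\<lambda>x. cadj E (E x)) \<Longrightarrow> commutes B (op_abs E)"
proof -
  obtain S where S: "bounded_clinear S" "pos_op S" "\<And>x. S (S x) = cadj E (E x)"
    "\<And>B. bounded_linear B \<Longrightarrow> commutes B (\<lambda>x. cadj E (E x)) \<Longrightarrow> commutes B S"
    using positive_op_sqrt[OF pos_op_cadj_self[OF E]
        bounded_clinear_compose[OF bounded_clinear_cadj[OF E] E]] by blast
  have "op_abs E = S"
    unfolding op_abs_def
  proof (rule the_equality)
    show "positive_op S \<and> S \<circ> S = cadj E \<circ> E"
      using S by (simp add: positive_op_iff fun_eq_iff)
    fix P assume "positive_op P \<and> P \<circ> P = cadj E \<circ> E"
    then show "P = S"
      using S by (intro pos_op_sqrt_unique) (auto simp: positive_op_iff fun_eq_iff)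
  qed
  then show "pos_op (op_abs E)" "op_abs E (op_abs E x) = cadj E (E x)"
    "bounded_linear B \<Longrightarrow> commutes B (\<lambda>x. cadj E (E x)) \<Longrightarrow> commutes B (op_abs E)"
    using S by simp_all
qed

section \<open>The Taylor spectrum of commuting positive operators\<close>

text \<open>The Lax-Milgram argument: a solution of C x = y is a fixed point of x - t (C x - y), a
  contraction for small t.\<close>

lemma coercive_surj:
  fixes C :: "'a::{real_inner,complete_space} \<Rightarrow> 'a"
  assumes C: "bounded_linear C" and e: "0 < e" "\<And>x. e * (norm x)\<^sup>2 \<le> inner (C x) x"
  obtains x where "C x = y"
proof -
  interpret C: bounded_linear C by fact
  obtain K0 where K0: "0 < K0" "\<And>x. norm (C x) \<le> K0 * norm x"
    using bounded_linear_norm_bound[OF C] by blast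
  \<comment> \<open>The maximum ensures e <= K, hence q >= 0 below.\<close>
  define K where "K = max K0 e"
  have K: "0 < K" "e \<le> K" using e(1) by (auto simp: K_def)
  have K_le: "norm (C x) \<le> K * norm x" for x
    using K0(2)[of x] mult_right_mono[of K0 K "norm x"] by (simp add: K_def)
  \<comment> \<open>This t minimises 1 - 2 t e + t^2 K^2, and q is the minimum.\<close>
  define t where "t = e / K\<^sup>2"
  define q where "q = 1 - e\<^sup>2 / K\<^sup>2"
  have t: "0 < t" using e K by (simp add: t_def)
  have q: "0 \<le> q" "q < 1"
    using e(1) K power_mono[of e K 2] by (simp_all add: q_def)
  have contr: "norm (u - t *\<^sub>R C u) \<le> sqrt q * norm u" for u
  proof -
    have "(norm (u - t *\<^sub>R C u))\<^sup>2 = (norm u)\<^sup>2 - 2 * t * inner (C u) u + t\<^sup>2 * (norm (C u))\<^sup>2"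
      unfolding power2_norm_eq_inner
      by (simp add: inner_commute[of u "C u"] power2_eq_square algebra_simps)
    also have "\<dots> \<le> (norm u)\<^sup>2 - 2 * t * (e * (norm u)\<^sup>2) + t\<^sup>2 * (K * norm u)\<^sup>2"
    proof -
      have "2 * t * (e * (norm u)\<^sup>2) \<le> 2 * t * inner (C u) u"
        using t e(2)[of u] by (intro mult_left_mono) auto
      moreover have "t\<^sup>2 * (norm (C u))\<^sup>2 \<le> t\<^sup>2 * (K * norm u)\<^sup>2"
        using K_le[of u] by (intro mult_left_mono power_mono) auto
      ultimately show ?thesis by linarith
    qed
    also have "\<dots> = q * (norm u)\<^sup>2"
      using K(1) by (simp add: q_def t_def power2_eq_square field_simps)
    finally have "(norm (u - t *\<^sub>R C u))\<^sup>2 \<le> (sqrt q * norm u)\<^sup>2"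
      using q by (simp add: power_mult_distrib)
    then show ?thesis by (rule power2_le_imp_le) (use q in simp)
  qed
  have "\<exists>!x. x - t *\<^sub>R (C x - y) = x"
  proof (rule banach_fix_type)
    show "0 \<le> sqrt q" "sqrt q < 1" using q by auto
    have "(u - t *\<^sub>R (C u - y)) - (v - t *\<^sub>R (C v - y)) = (u - v) - t *\<^sub>R C (u - v)" for u v
      by (simp add: C.diff algebra_simps)
    then show "\<forall>u v. dist (u - t *\<^sub>R (C u - y)) (v - t *\<^sub>R (C v - y)) \<le> sqrt q * dist u v"
      using contr unfolding dist_norm by metis
  qed
  then obtain x where "x - t *\<^sub>R (C x - y) = x" by blast
  then have "C x = y" using t by simp
  then show thesis by (rule that)
qed

text \<open>The uniform boundedness principle: by Baire some closed set F k contains a ball, and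
  each x is tested on a vector of length r/2 parallel to itself.\<close>

lemma weakly_bounded_imp_bounded:
  fixes X :: "'a::{real_inner,complete_space} set"
  assumes "\<And>y. \<exists>k. \<forall>x\<in>X. \<bar>inner x y\<bar> \<le> k"
  obtains c where "\<And>x. x \<in> X \<Longrightarrow> norm x \<le> c"
proof -
  define F where "F k = {y. \<forall>x\<in>X. \<bar>inner x y\<bar> \<le> real k}" for k :: nat
  have closed: "closed (F k)" for k
  proof -
    have "F k = (\<Inter>x\<in>X. {y. \<bar>inner x y\<bar> \<le> real k})" by (auto simp: F_def)
    then show ?thesis
      by (auto intro!: closed_INT closed_Collect_le continuous_intros)
  qed
  have cover: "\<Union> (range F) = UNIV"
  proof -
    have "\<exists>k. y \<in> F k" for y
    proof -
      obtain k where "\<forall>x\<in>X. \<bar>inner x y\<bar> \<le> k" using assms by blast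
      moreover obtain j :: nat where "k \<le> real j" using real_arch_simple by blast
      ultimately show ?thesis unfolding F_def by (intro exI[of _ j]) force
    qed
    then show ?thesis by blast
  qed
  have "\<exists>k. interior (F k) \<noteq> {}"
  proof (rule ccontr)
    assume "\<nexists>k. interior (F k) \<noteq> {}"
    then have "Met_TC.mtopology interior_of \<Union> (range F) = {}"
      using closed by (intro Met_TC.metric_Baire_category_alt) (auto simp: complete_UNIV)
    then show False unfolding cover by simp
  qed
  then obtain k y where "y \<in> interior (F k)" by blast
  then obtain r where r: "0 < r" "ball y r \<subseteq> F k"
    unfolding mem_interior by blast
  show thesis
  proof
    fix x assume x: "x \<in> X"
    \<comment> \<open>Testing at y and at y + z bounds <x, z> = (r/2) ||x|| by 2k.\<close>
    show "norm x \<le> 4 * real k / r"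
    proof (cases "x = 0")
      case False
      define z where "z = (r / (2 * norm x)) *\<^sub>R x"
      have "norm z = r / 2" using False r(1) by (simp add: z_def)
      then have "y + z \<in> F k" "y \<in> F k"
        using r by (auto simp: dist_norm)
      then have "\<bar>inner x (y + z)\<bar> \<le> real k" "\<bar>inner x y\<bar> \<le> real k"
        using x by (auto simp: F_def)
      then have "inner x z \<le> 2 * real k" by (simp add: inner_add_right)
      moreover have "inner x z = r / 2 * norm x"
        using False by (simp add: z_def power2_norm_eq_inner[symmetric] power2_eq_square)
      ultimately show ?thesis using r(1) by (simp add: field_simps)
    qed (use r in simp)
  qed
qed

text \<open>Forwards, surjectivity writes every y as P p2 - R p1, so the set where ||P x|| and ||R
  x|| are at most 1 is weakly bounded, hence bounded; scaling gives the estimate. Backwards, C = P^2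
  + R^2 is coercive, hence bijective, and commutes with P and R; its inverse splits the complex: y
  is the image of (- R x, P x) with C x = y, and a cycle p is the image of the solution of C x = P
  p1 + R p2.\<close>

lemma koszul_exact_iff:
  fixes P R :: "'a::chilbert_space \<Rightarrow> 'a"
  assumes P: "sym_op P" and R: "sym_op R" and PR: "commutes P R"
  shows "koszul_exact P R \<longleftrightarrow> (\<exists>e>0. \<forall>x. e * (norm x)\<^sup>2 \<le> (norm (P x))\<^sup>2 + (norm (R x))\<^sup>2)"
proof
  interpret P: bounded_linear P using sym_opD(1)[OF P] .
  interpret R: bounded_linear R using sym_opD(1)[OF R] .
  assume ex: "koszul_exact P R"
  define X where "X = {x. norm (P x) \<le> 1 \<and> norm (R x) \<le> 1}"
  have "\<exists>k. \<forall>x\<in>X. \<bar>inner x y\<bar> \<le> k" for y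
  proof -
    obtain p where "y = koszul1 P R p"
      using ex unfolding koszul_exact_def by (metis rangeE UNIV_I)
    then have y: "y = P (snd p) - R (fst p)" by (simp add: koszul1_def)
    have "\<bar>inner x y\<bar> \<le> norm (snd p) + norm (fst p)" if "x \<in> X" for x
    proof -
      have "inner x y = inner (P x) (snd p) - inner (R x) (fst p)"
        by (simp add: y inner_diff_right sym_opD(2)[OF P] sym_opD(2)[OF R])
      moreover have "\<bar>inner (P x) (snd p)\<bar> \<le> 1 * norm (snd p)"
        using Cauchy_Schwarz_ineq2[of "P x" "snd p"] that
          mult_right_mono[of "norm (P x)" 1 "norm (snd p)"] by (simp add: X_def)
      moreover have "\<bar>inner (R x) (fst p)\<bar> \<le> 1 * norm (fst p)"
        using Cauchy_Schwarz_ineq2[of "R x" "fst p"] that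
          mult_right_mono[of "norm (R x)" 1 "norm (fst p)"] by (simp add: X_def)
      ultimately show ?thesis by linarith
    qed
    then show ?thesis by blast
  qed
  then obtain c where c: "\<And>x. x \<in> X \<Longrightarrow> norm x \<le> c"
    using weakly_bounded_imp_bounded by blast
  define d where "d = max c 1"
  have d: "1 \<le> d" "\<And>x. x \<in> X \<Longrightarrow> norm x \<le> d" using c by (auto simp: d_def le_max_iff_disj)
  have "(1 / d\<^sup>2) * (norm x)\<^sup>2 \<le> (norm (P x))\<^sup>2 + (norm (R x))\<^sup>2" for x
  proof -
    define e where "e = sqrt ((norm (P x))\<^sup>2 + (norm (R x))\<^sup>2)"
    have Pe: "norm (P x) \<le> e" and Re: "norm (R x) \<le> e"
      by (auto simp: e_def intro!: real_le_rsqrt)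
    have e0: "0 \<le> e" by (simp add: e_def)
    have "norm x \<le> d * e"
    proof (cases "e = 0")
      case True
      then have Px: "P x = 0" and Rx: "R x = 0" using Pe Re by simp_all
      have "x = 0"
      proof (rule ccontr)
        assume "x \<noteq> 0"
        then have "norm ((2 * d / norm x) *\<^sub>R x) = 2 * d" using d(1) by simp
        moreover have "(2 * d / norm x) *\<^sub>R x \<in> X"
          by (simp add: X_def P.scaleR R.scaleR Px Rx)
        ultimately show False using d by fastforce
      qed
      then show ?thesis using e0 d by simp
    next
      case False
      then have "0 < e" using e0 by simp
      then have "(1 / e) *\<^sub>R x \<in> X"
        using Pe Re by (simp add: X_def P.scaleR R.scaleR)
      from d(2)[OF this] show ?thesis using \<open>0 < e\<close> by (simp add: field_simps)
    qed
    then have "(norm x)\<^sup>2 \<le> (d * e)\<^sup>2" by (intro power_mono) auto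
    also have "\<dots> = d\<^sup>2 * ((norm (P x))\<^sup>2 + (norm (R x))\<^sup>2)"
      by (simp add: power_mult_distrib e_def)
    finally show ?thesis using d(1) by (simp add: divide_le_eq mult.commute)
  qed
  moreover have "0 < 1 / d\<^sup>2" using d(1) by simp
  ultimately show "\<exists>e>0. \<forall>x. e * (norm x)\<^sup>2 \<le> (norm (P x))\<^sup>2 + (norm (R x))\<^sup>2" by blast
next
  interpret P: bounded_linear P using sym_opD(1)[OF P] .
  interpret R: bounded_linear R using sym_opD(1)[OF R] .
  assume "\<exists>e>0. \<forall>x. e * (norm x)\<^sup>2 \<le> (norm (P x))\<^sup>2 + (norm (R x))\<^sup>2"
  then obtain e where e: "0 < e" "\<And>x. e * (norm x)\<^sup>2 \<le> (norm (P x))\<^sup>2 + (norm (R x))\<^sup>2" by blast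
  define C where "C x = P (P x) + R (R x)" for x
  have C: "bounded_linear C"
    unfolding C_def by (intro bounded_linear_add sym_opD(1) sym_op_square P R)
  interpret C: bounded_linear C by fact
  have C_inner: "inner (C x) x = (norm (P x))\<^sup>2 + (norm (R x))\<^sup>2" for x
    by (simp add: C_def inner_add_left sym_opD(2)[OF P] sym_opD(2)[OF R] power2_norm_eq_inner)
  have C_surj: "\<exists>x. C x = y" for y
    using coercive_surj[OF C e(1)] e(2) C_inner by metis
  have inj0: "x = 0" if "P x = 0" "R x = 0" for x
    using e(1) e(2)[of x] that by (simp add: mult_le_0_iff)
  have C_inj: "x = y" if "C x = C y" for x y
  proof -
    have "inner (C (x - y)) (x - y) = 0" using that by (simp add: C.diff)
    then have "P (x - y) = 0" "R (x - y) = 0"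
      by (simp_all add: C_inner sum_power2_eq_zero_iff)
    then show ?thesis using inj0[of "x - y"] by simp
  qed
  note com = commutesD[OF PR]
  show "koszul_exact P R"
    unfolding koszul_exact_def
  proof (intro conjI)
    show "{x. koszul0 P R x = 0} = {0}"
      using inj0 by (auto simp: koszul0_def zero_prod_def P.zero R.zero)
    show "range (koszul1 P R) = UNIV"
    proof -
      have "\<exists>p. y = koszul1 P R p" for y
      proof -
        obtain x where "C x = y" using C_surj by blast
        then have "y = koszul1 P R (- R x, P x)" by (simp add: koszul1_def C_def R.neg)
        then show ?thesis by blast
      qed
      then show ?thesis by blast
    qed
    show "range (koszul0 P R) = {p. koszul1 P R p = 0}"
    proof
      show "range (koszul0 P R) \<subseteq> {p. koszul1 P R p = 0}"
        by (auto simp: koszul0_def koszul1_def com)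
      show "{p. koszul1 P R p = 0} \<subseteq> range (koszul0 P R)"
      proof
        fix p assume "p \<in> {p. koszul1 P R p = 0}"
        then have p: "P (snd p) = R (fst p)" by (simp add: koszul1_def)
        obtain x where x: "C x = P (fst p) + R (snd p)" using C_surj by blast
        have CP: "C (P x) = P (C x)" and CR: "C (R x) = R (C x)"
          by (simp_all add: C_def P.add R.add com)
        have "C (P x) = C (fst p)"
          unfolding CP x by (simp add: C_def P.add com p)
        moreover have "C (R x) = C (snd p)"
          unfolding CR x by (simp add: C_def R.add com[symmetric] p[symmetric])
        ultimately have "p = koszul0 P R x"
          using C_inj by (simp add: koszul0_def prod_eq_iff)
        then show "p \<in> range (koszul0 P R)" by blast
      qed
    qed
  qed
qed

text \<open>Non-exactness denies every lower bound e = 1/(n+1) for ||P x||^2 + ||R x||^2, and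
  normalised witnesses of this failure are the approximate eigenvectors.\<close>

theorem taylor_spectrum_iff:
  fixes A B :: "'a::chilbert_space \<Rightarrow> 'a"
  assumes A: "pos_op A" and B: "pos_op B" and AB: "commutes A B"
  shows "(complex_of_real s, complex_of_real t) \<in> taylor_spectrum A B
    \<longleftrightarrow> (\<exists>y. joint_approx_eigen A B s t y)"
proof -
  interpret A: bounded_linear A using pos_opD(1)[OF A] .
  interpret B: bounded_linear B using pos_opD(1)[OF B] .
  define P where "P x = A x - s *\<^sub>R x" for x
  define R where "R x = B x - t *\<^sub>R x" for x
  have P: "sym_op P" and R: "sym_op R"
    unfolding P_def R_def
    by (intro sym_op_diff sym_op_scaleR sym_op_ident pos_op_imp_sym_op A B)+
  have PR: "commutes P R"
    by (simp add: commutes_def P_def R_def A.diff A.scaleR B.diff B.scaleR commutesD[OF AB]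
        algebra_simps)
  interpret P: bounded_linear P using sym_opD(1)[OF P] .
  interpret R: bounded_linear R using sym_opD(1)[OF R] .
  have "(complex_of_real s, complex_of_real t) \<in> taylor_spectrum A B \<longleftrightarrow> \<not> koszul_exact P R"
    by (simp add: taylor_spectrum_def scaleC_of_real P_def[abs_def] R_def[abs_def])
  also have "\<dots> \<longleftrightarrow> (\<exists>y. (\<forall>n. norm (y n) = 1) \<and> (\<lambda>n. P (y n)) \<longlonglongrightarrow> 0 \<and> (\<lambda>n. R (y n)) \<longlonglongrightarrow> 0)"
    (is "?l \<longleftrightarrow> ?r")
  proof
    assume ?l
    then have no: "\<exists>x. (norm (P x))\<^sup>2 + (norm (R x))\<^sup>2 < e * (norm x)\<^sup>2" if "0 < e" for e
      using that unfolding koszul_exact_iff[OF P R PR] by (meson not_le)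
    have "\<exists>y. norm y = 1 \<and> (norm (P y))\<^sup>2 + (norm (R y))\<^sup>2 < 1 / real (Suc n)" for n
    proof -
      obtain x where x: "(norm (P x))\<^sup>2 + (norm (R x))\<^sup>2 < 1 / real (Suc n) * (norm x)\<^sup>2"
        using no[of "1 / real (Suc n)"] by auto
      have "x \<noteq> 0" using x by (auto simp: P.zero R.zero)
      then have "norm ((1 / norm x) *\<^sub>R x) = 1" by simp
      moreover have "(norm (P ((1 / norm x) *\<^sub>R x)))\<^sup>2 + (norm (R ((1 / norm x) *\<^sub>R x)))\<^sup>2
          = ((norm (P x))\<^sup>2 + (norm (R x))\<^sup>2) / (norm x)\<^sup>2"
        by (simp add: P.scaleR R.scaleR power_divide add_divide_distrib)
      moreover have "\<dots> < 1 / real (Suc n)"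
        using x \<open>x \<noteq> 0\<close> by (simp add: pos_divide_less_eq)
      ultimately show ?thesis by metis
    qed
    then obtain y where y: "\<And>n. norm (y n) = 1"
      "\<And>n. (norm (P (y n)))\<^sup>2 + (norm (R (y n)))\<^sup>2 < 1 / real (Suc n)" by metis
    have lim0: "D \<longlonglongrightarrow> 0" if "\<And>n. (norm (D n))\<^sup>2 \<le> 1 / real (Suc n)" for D :: "nat \<Rightarrow> 'a"
    proof -
      have "(\<lambda>n. 1 / real (Suc n)) \<longlonglongrightarrow> 0" by (rule lim_1_over_n[THEN LIMSEQ_Suc])
      then have "(\<lambda>n. (norm (D n))\<^sup>2) \<longlonglongrightarrow> 0"
        by (rule Lim_null_comparison[rotated]) (use that in simp)
      from tendsto_real_sqrt[OF this] have "(\<lambda>n. norm (D n)) \<longlonglongrightarrow> 0" by simp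
      then show ?thesis by (rule tendsto_norm_zero_cancel)
    qed
    have "(norm (P (y n)))\<^sup>2 \<le> 1 / real (Suc n)" "(norm (R (y n)))\<^sup>2 \<le> 1 / real (Suc n)" for n
      using y(2)[of n] zero_le_power2[of "norm (P (y n))"] zero_le_power2[of "norm (R (y n))"]
      by linarith+
    then have "(\<lambda>n. P (y n)) \<longlonglongrightarrow> 0" "(\<lambda>n. R (y n)) \<longlonglongrightarrow> 0"
      by (auto intro: lim0)
    then show ?r using y(1) by blast
  next
    assume ?r
    then obtain y where y: "\<And>n. norm (y n) = 1" "(\<lambda>n. P (y n)) \<longlonglongrightarrow> 0" "(\<lambda>n. R (y n)) \<longlonglongrightarrow> 0"
      by blast
    show ?l
    proof
      assume "koszul_exact P R"
      then obtain e where e: "0 < e" "\<And>x. e * (norm x)\<^sup>2 \<le> (norm (P x))\<^sup>2 + (norm (R x))\<^sup>2"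
        unfolding koszul_exact_iff[OF P R PR] by blast
      have "(\<lambda>n. (norm (P (y n)))\<^sup>2 + (norm (R (y n)))\<^sup>2) \<longlonglongrightarrow> (norm (0::'a))\<^sup>2 + (norm (0::'a))\<^sup>2"
        by (intro tendsto_intros y)
      then have "e \<le> (norm (0::'a))\<^sup>2 + (norm (0::'a))\<^sup>2"
        by (rule LIMSEQ_le_const) (use e(2) y(1) in \<open>auto intro!: exI[of _ 0] dest: spec\<close>, metis mult.right_neutral power_one)
      then show False using e(1) by simp
    qed
  qed
  finally show ?thesis by (simp add: joint_approx_eigen_def P_def R_def)
qed

section \<open>Square-summable sequences\<close>

text \<open>Holds the sequences (F Q^j y)_j and the defect part of the unitary extension. Being a
  type of class \<open>chilbert_space\<close>, it lets the results on adjoints apply to maps into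
  it.\<close>

typedef (overloaded) 'a ell2 = "{f :: nat \<Rightarrow> 'a::chilbert_space. summable (\<lambda>n. (norm (f n))\<^sup>2)}"
  morphisms ell2_nth Abs_ell2
  by (intro exI[of _ "\<lambda>_. 0"]) simp

setup_lifting type_definition_ell2

lemma ell2_eqI: "(\<And>n. ell2_nth x n = ell2_nth y n) \<Longrightarrow> x = y"
  by (metis ell2_nth_inject ext)

lemma summable_ell2: "summable (\<lambda>n. (norm (ell2_nth x n))\<^sup>2)"
  using ell2_nth by auto

lemma norm_add_sq_le: "(norm (x + y))\<^sup>2 \<le> 2 * (norm x)\<^sup>2 + 2 * (norm (y :: 'a::real_inner))\<^sup>2"
  using norm_add_sq[of x y] zero_le_power2[of "norm (x - y)"] by linarith

lemma summable_norm_sq_add: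
  fixes f g :: "nat \<Rightarrow> 'a::real_inner"
  assumes "summable (\<lambda>n. (norm (f n))\<^sup>2)" "summable (\<lambda>n. (norm (g n))\<^sup>2)"
  shows "summable (\<lambda>n. (norm (f n + g n))\<^sup>2)"
proof (rule summable_comparison_test')
  show "summable (\<lambda>n. 2 * (norm (f n))\<^sup>2 + 2 * (norm (g n))\<^sup>2)"
    using assms by (intro summable_add summable_mult)
  show "norm ((norm (f n + g n))\<^sup>2) \<le> 2 * (norm (f n))\<^sup>2 + 2 * (norm (g n))\<^sup>2" for n
    using norm_add_sq_le[of "f n" "g n"] by simp
qed

instantiation ell2 :: (chilbert_space) real_vector
begin

lift_definition zero_ell2 :: "'a ell2" is "\<lambda>_. 0" by simp
lift_definition plus_ell2 :: "'a ell2 \<Rightarrow> 'a ell2 \<Rightarrow> 'a ell2" is "\<lambda>f g n. f n + g n"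
  by (rule summable_norm_sq_add)
lift_definition uminus_ell2 :: "'a ell2 \<Rightarrow> 'a ell2" is "\<lambda>f n. - f n" by simp
lift_definition minus_ell2 :: "'a ell2 \<Rightarrow> 'a ell2 \<Rightarrow> 'a ell2" is "\<lambda>f g n. f n - g n"
  using summable_norm_sq_add[where g="\<lambda>n. - _ n"] by simp

lift_definition scaleR_ell2 :: "real \<Rightarrow> 'a ell2 \<Rightarrow> 'a ell2" is "\<lambda>r f n. r *\<^sub>R f n"
  by (simp add: power_mult_distrib summable_mult)

instance
  by standard (transfer, simp add: fun_eq_iff algebra_simps)+

end

text \<open>Real and imaginary part are each at most ||x|| ||y||, and 2 ||x|| ||y|| is at most the
  right-hand side. This constant suffices for summability.\<close>

lemma norm_cinner_le: "cmod (cinner x y) \<le> (norm x)\<^sup>2 + (norm (y :: 'a::chilbert_space))\<^sup>2"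
proof -
  have "\<bar>Re (cinner x y)\<bar> \<le> norm x * norm y"
    using Cauchy_Schwarz_ineq2[of x y] by (simp add: inner_eq_Re_cinner)
  moreover have "\<bar>Im (cinner x y)\<bar> \<le> norm x * norm y"
    using Cauchy_Schwarz_ineq2[of "(- \<i>) *\<^sub>C x" y] by (simp add: Im_cinner_left norm_scaleC)
  moreover have "0 \<le> (norm x - norm y)\<^sup>2" by simp
  ultimately show ?thesis
    using cmod_le[of "cinner x y"] by (simp add: power2_eq_square algebra_simps)
qed

lemma summable_cinner:
  fixes f g :: "nat \<Rightarrow> 'a::chilbert_space"
  assumes "summable (\<lambda>n. (norm (f n))\<^sup>2)" "summable (\<lambda>n. (norm (g n))\<^sup>2)"
  shows "summable (\<lambda>n. cinner (f n) (g n))"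
  by (rule summable_comparison_test'[OF summable_add[OF assms]]) (rule norm_cinner_le)

lemma summable_inner:
  fixes f g :: "nat \<Rightarrow> 'a::chilbert_space"
  assumes "summable (\<lambda>n. (norm (f n))\<^sup>2)" "summable (\<lambda>n. (norm (g n))\<^sup>2)"
  shows "summable (\<lambda>n. inner (f n) (g n))"
  using summable_Re[OF summable_cinner[OF assms]] by (simp add: inner_eq_Re_cinner)

instantiation ell2 :: (chilbert_space) real_inner
begin

definition inner_ell2 :: "'a ell2 \<Rightarrow> 'a ell2 \<Rightarrow> real" where
  "inner_ell2 x y = (\<Sum>n. inner (ell2_nth x n) (ell2_nth y n))"
definition norm_ell2 :: "'a ell2 \<Rightarrow> real" where
  "norm_ell2 x = sqrt (inner x x)"
definition sgn_ell2 :: "'a ell2 \<Rightarrow> 'a ell2" where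
  "sgn_ell2 x = x /\<^sub>R norm x"
definition dist_ell2 :: "'a ell2 \<Rightarrow> 'a ell2 \<Rightarrow> real" where
  "dist_ell2 x y = norm (x - y)"
definition uniformity_ell2 :: "('a ell2 \<times> 'a ell2) filter" where
  "uniformity_ell2 = (INF e\<in>{0 <..}. principal {(x, y). dist x y < e})"
definition open_ell2 :: "'a ell2 set \<Rightarrow> bool" where
  "open_ell2 U \<longleftrightarrow> (\<forall>x\<in>U. eventually (\<lambda>(x', y). x' = x \<longrightarrow> y \<in> U) uniformity)"

instance
proof
  fix x y z :: "'a ell2" and r s :: real and U :: "'a ell2 set"
  note summ = summable_inner[OF summable_ell2 summable_ell2]
  show "dist x y = norm (x - y)" by (rule dist_ell2_def)
  show "sgn x = x /\<^sub>R norm x" by (rule sgn_ell2_def)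
  show "uniformity = (INF e\<in>{0 <..}. principal {(x, y :: 'a ell2). dist x y < e})"
    by (rule uniformity_ell2_def)
  show "open U \<longleftrightarrow> (\<forall>x\<in>U. eventually (\<lambda>(x', y). x' = x \<longrightarrow> y \<in> U) uniformity)"
    by (rule open_ell2_def)
  show "inner x y = inner y x" by (simp add: inner_ell2_def inner_commute)
  show "inner (x + y) z = inner x z + inner y z"
    unfolding inner_ell2_def plus_ell2.rep_eq inner_add_left
    by (rule suminf_add[symmetric]) (rule summ)+
  show "inner (r *\<^sub>R x) y = r * inner x y"
    unfolding inner_ell2_def scaleR_ell2.rep_eq inner_scaleR_left
    by (rule suminf_mult) (rule summ)
  show "0 \<le> inner x x"
    unfolding inner_ell2_def by (rule suminf_nonneg[OF summ]) simp
  show "inner x x = 0 \<longleftrightarrow> x = 0"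
  proof
    assume "inner x x = 0"
    then have "inner (ell2_nth x n) (ell2_nth x n) = 0" for n
      unfolding inner_ell2_def by (subst (asm) suminf_eq_zero_iff[OF summ]) auto
    then show "x = 0" by (intro ell2_eqI) (simp add: zero_ell2.rep_eq)
  qed (simp add: inner_ell2_def zero_ell2.rep_eq)
  show "norm x = sqrt (inner x x)" by (rule norm_ell2_def)
qed

end

lemma norm_ell2_sq: "(norm x)\<^sup>2 = (\<Sum>n. (norm (ell2_nth x n))\<^sup>2)"
  by (simp add: power2_norm_eq_inner inner_ell2_def)

lemma norm_ell2_partial: "(\<Sum>n<k. (norm (ell2_nth x n))\<^sup>2) \<le> (norm x)\<^sup>2"
  unfolding norm_ell2_sq by (rule sum_le_suminf[OF summable_ell2]) auto

lemma norm_ell2_nth_le: "norm (ell2_nth x n) \<le> norm x"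
proof (rule power2_le_imp_le)
  have "(norm (ell2_nth x n))\<^sup>2 \<le> (\<Sum>k<Suc n. (norm (ell2_nth x k))\<^sup>2)"
    by (rule member_le_sum) auto
  also have "\<dots> \<le> (norm x)\<^sup>2" by (rule norm_ell2_partial)
  finally show "(norm (ell2_nth x n))\<^sup>2 \<le> (norm x)\<^sup>2" .
qed simp

instance ell2 :: (chilbert_space) complete_space
proof
  fix X :: "nat \<Rightarrow> 'a ell2"
  assume X: "Cauchy X"
  have "Cauchy (\<lambda>m. ell2_nth (X m) n)" for n
  proof (rule CauchyI)
    fix e :: real assume "0 < e"
    then obtain M where M: "\<And>i j. i \<ge> M \<Longrightarrow> j \<ge> M \<Longrightarrow> norm (X i - X j) < e"
      using CauchyD[OF X] by blast
    have "norm (ell2_nth (X i) n - ell2_nth (X j) n) < e" if "i \<ge> M" "j \<ge> M" for i j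
      using norm_ell2_nth_le[of "X i - X j" n] M[OF that] by (simp add: minus_ell2.rep_eq)
    then show "\<exists>M. \<forall>i\<ge>M. \<forall>j\<ge>M. norm (ell2_nth (X i) n - ell2_nth (X j) n) < e" by blast
  qed
  then have "\<exists>l. (\<lambda>m. ell2_nth (X m) n) \<longlonglongrightarrow> l" for n
    by (simp add: Cauchy_convergent_iff convergent_def)
  then obtain f where f: "\<And>n. (\<lambda>m. ell2_nth (X m) n) \<longlonglongrightarrow> f n" by metis
  \<comment> \<open>Finite partial sums pass to the limit in j; the bound does not depend on k, so
    it carries over to the full series.\<close>
  have bound: "(\<Sum>n<k. (norm (ell2_nth (X i) n - f n))\<^sup>2) \<le> e\<^sup>2"
    if M: "\<And>j. j \<ge> M \<Longrightarrow> norm (X i - X j) < e" for i k M and e :: real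
  proof (rule LIMSEQ_le_const2)
    show "(\<lambda>j. \<Sum>n<k. (norm (ell2_nth (X i) n - ell2_nth (X j) n))\<^sup>2)
        \<longlonglongrightarrow> (\<Sum>n<k. (norm (ell2_nth (X i) n - f n))\<^sup>2)"
      by (intro tendsto_intros f)
    have "(\<Sum>n<k. (norm (ell2_nth (X i) n - ell2_nth (X j) n))\<^sup>2) \<le> e\<^sup>2" if "j \<ge> M" for j
    proof -
      have "(\<Sum>n<k. (norm (ell2_nth (X i) n - ell2_nth (X j) n))\<^sup>2) \<le> (norm (X i - X j))\<^sup>2"
        using norm_ell2_partial[of "X i - X j" k] by (simp add: minus_ell2.rep_eq)
      also have "\<dots> \<le> e\<^sup>2" using M[OF that] by (intro power_mono) auto
      finally show ?thesis .
    qed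
    then show "\<exists>N. \<forall>j\<ge>N. (\<Sum>n<k. (norm (ell2_nth (X i) n - ell2_nth (X j) n))\<^sup>2) \<le> e\<^sup>2" by blast
  qed
  have summ: "summable (\<lambda>n. (norm (ell2_nth (X i) n - f n))\<^sup>2)"
    if M: "\<And>j. j \<ge> M \<Longrightarrow> norm (X i - X j) < e" for i M and e :: real
    by (rule summableI_nonneg_bounded[where x="e\<^sup>2"]) (use bound[OF M] in auto)
  obtain M where M: "\<And>i j. i \<ge> M \<Longrightarrow> j \<ge> M \<Longrightarrow> norm (X i - X j) < 1"
    using CauchyD[OF X, of 1] by auto
  \<comment> \<open>The limit is written as X_M - (X_M - f), a difference of square-summable
    sequences.\<close>
  have "summable (\<lambda>n. (norm (ell2_nth (X M) n + - (ell2_nth (X M) n - f n)))\<^sup>2)"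
    by (rule summable_norm_sq_add[OF summable_ell2])
      (use summ[OF M[OF order_refl]] in \<open>simp add: norm_minus_commute\<close>)
  then have "summable (\<lambda>n. (norm (f n))\<^sup>2)" by simp
  then have "ell2_nth (Abs_ell2 f) = f" by (simp add: Abs_ell2_inverse)
  then obtain l where l: "\<And>n. ell2_nth l n = f n" by metis
  have "X \<longlonglongrightarrow> l"
  proof (rule LIMSEQ_I)
    fix e :: real assume e: "0 < e"
    then obtain M where M: "\<And>i j. i \<ge> M \<Longrightarrow> j \<ge> M \<Longrightarrow> norm (X i - X j) < e / 2"
      using CauchyD[OF X, of "e / 2"] by auto
    have "norm (X i - l) < e" if "i \<ge> M" for i
    proof -
      have "(norm (X i - l))\<^sup>2 \<le> (e / 2)\<^sup>2"
        unfolding norm_ell2_sq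
        by (rule suminf_le_const[OF summable_ell2])
          (use bound[OF M[OF that]] in \<open>simp add: minus_ell2.rep_eq l\<close>)
      then have "norm (X i - l) \<le> e / 2" by (rule power2_le_imp_le) (use e in simp)
      then show ?thesis using e by simp
    qed
    then show "\<exists>no. \<forall>n\<ge>no. norm (X n - l) < e" by blast
  qed
  then show "convergent X" by (auto simp: convergent_def)
qed

instantiation ell2 :: (chilbert_space) chilbert_space
begin

lift_definition scaleC_ell2 :: "complex \<Rightarrow> 'a ell2 \<Rightarrow> 'a ell2" is "\<lambda>c f n. c *\<^sub>C f n"
  by (simp add: norm_scaleC power_mult_distrib summable_mult)
definition cinner_ell2 :: "'a ell2 \<Rightarrow> 'a ell2 \<Rightarrow> complex" where
  "cinner_ell2 x y = (\<Sum>n. cinner (ell2_nth x n) (ell2_nth y n))"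

instance
proof
  fix x y z :: "'a ell2" and a b :: complex and r :: real
  note summ = summable_cinner[OF summable_ell2 summable_ell2]
  show "a *\<^sub>C (x + y) = a *\<^sub>C x + a *\<^sub>C y" by transfer (simp add: scaleC_add_right)
  show "(a + b) *\<^sub>C x = a *\<^sub>C x + b *\<^sub>C x" by transfer (simp add: scaleC_add_left)
  show "a *\<^sub>C b *\<^sub>C x = (a * b) *\<^sub>C x" by transfer (simp add: scaleC_scaleC)
  show "r *\<^sub>R x = complex_of_real r *\<^sub>C x" by transfer (simp add: scaleR_scaleC)
  show "cinner (x + y) z = cinner x z + cinner y z"
    unfolding cinner_ell2_def plus_ell2.rep_eq cinner_add_left
    by (rule suminf_add[symmetric]) (rule summ)+
  show "cinner (a *\<^sub>C x) y = a * cinner x y"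
    unfolding cinner_ell2_def scaleC_ell2.rep_eq cinner_scaleC_left
    by (rule suminf_mult) (rule summ)
  show "cinner x y = cnj (cinner y x)"
    unfolding cinner_ell2_def
    by (subst bounded_linear.suminf[OF bounded_linear_cnj summ])
      (simp add: cinner_commute[symmetric])
  show "inner x y = Re (cinner x y)"
    unfolding cinner_ell2_def inner_ell2_def
    by (subst bounded_linear.suminf[OF bounded_linear_Re summ]) (simp add: inner_eq_Re_cinner)
qed

end

section \<open>Normal extensions\<close>

subsection \<open>Normal extensions on a type\<close>

definition type_struct :: "'k::chilbert_space hilbert_struct" where
  "type_struct = \<lparr>carrier = UNIV, zer = 0, add = (+), scl = (*\<^sub>C), ip = cinner\<rparr>"

lemma type_struct_simps [simp]:
  "carrier type_struct = UNIV" "zer type_struct = 0" "add type_struct = (+)"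
  "scl type_struct = (*\<^sub>C)" "ip type_struct = cinner"
  by (simp_all add: type_struct_def)

lemma nrm_type_struct [simp]: "nrm type_struct x = norm x"
  by (simp add: nrm_def norm_eq_sqrt_inner inner_eq_Re_cinner)

lemma dst_type_struct [simp]: "dst type_struct x y = dist x y"
  by (simp add: dst_def dist_norm scaleC_minus_1)

lemma hilbert_space_on_type_struct: "hilbert_space_on (type_struct :: 'k::chilbert_space hilbert_struct)"
proof
  fix X :: "nat \<Rightarrow> 'k"
  assume "\<forall>e>0. \<exists>M::nat. \<forall>m\<ge>M. \<forall>n\<ge>M. dst type_struct (X m) (X n) < e"
  then have "Cauchy X" by (simp add: Cauchy_def)
  then obtain l where "X \<longlonglongrightarrow> l"
    using Cauchy_convergent_iff convergent_def by blast
  then show "\<exists>l\<in>carrier type_struct. (\<lambda>n. dst type_struct (X n) l) \<longlonglongrightarrow> 0"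
    using tendsto_dist_iff by auto
qed (auto simp: scaleC_add_right scaleC_add_left scaleC_scaleC cinner_add_left cinner_scaleC_left
    cinner_self add.commute intro: cinner_commute)

lemma bounded_op_on_type_struct:
  assumes "bounded_clinear N"
  shows "bounded_op_on type_struct N"
proof -
  obtain C where "\<And>x. norm (N x) \<le> C * norm x"
    using bounded_linear_norm_bound[OF bounded_clinearD(1)[OF assms]] by blast
  then show ?thesis
    using bounded_clinearD[OF assms] unfolding bounded_op_on_def
    by (auto simp: linear_simps)
qed

theorem subnormalI_type:
  fixes T :: "'h::chilbert_space \<Rightarrow> 'h" and N M :: "'k::chilbert_space \<Rightarrow> 'k"
  assumes N: "bounded_clinear N" and M: "bounded_clinear M"
    and adj: "\<And>x y. cinner (N x) y = cinner x (M y)" and normal: "\<And>x. N (M x) = M (N x)"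
    and J: "\<And>x y. J (x + y) = J x + J y" "\<And>c x. J (c *\<^sub>C x) = c *\<^sub>C J x"
      "\<And>x y. cinner (J x) (J y) = cinner x y"
    and ext: "\<And>h. N (J h) = J (T h)"
  shows "subnormal T"
proof (rule subnormalI)
  have "adjoint_on type_struct N M"
    using adj bounded_op_on_type_struct[OF M] by (simp add: adjoint_on_def)
  then show "normal_extension T type_struct J N"
    unfolding normal_extension_def isometric_embedding_def normal_op_on_def
    using hilbert_space_on_type_struct bounded_op_on_type_struct[OF N] normal J ext
    by (auto intro!: exI[of _ M])
qed

lemma bounded_clinear_fst: "bounded_clinear fst"
  and bounded_clinear_snd: "bounded_clinear snd"
  by (simp_all add: bounded_clinear_def bounded_linear_fst bounded_linear_snd scaleC_prod_def)

lemma bounded_clinear_Pair: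
  "bounded_clinear A \<Longrightarrow> bounded_clinear B \<Longrightarrow> bounded_clinear (\<lambda>x. (A x, B x))"
  by (simp add: bounded_clinear_def bounded_linear_Pair scaleC_prod_def)

lemma bounded_clinear_isometryI:
  assumes "\<And>x y. A (x + y) = A x + A y" "\<And>c x. A (c *\<^sub>C x) = c *\<^sub>C A x"
    and "\<And>x. cinner (A x) (A x) = cinner x x"
  shows "bounded_clinear A"
proof -
  have "norm (A x) = norm x" for x
    using assms(3)[of x] by (simp add: cinner_self flip: of_real_power)
  then have "bounded_linear A"
    using assms(1,2) by (intro bounded_linear_intro[where K=1]) (auto simp: scaleR_scaleC)
  then show ?thesis using assms(2) by (simp add: bounded_clinear_def)
qed

subsection \<open>Isometries\<close>

text \<open>
  The unitary extension of an isometry \<open>V\<close> lives on \<open>H \<oplus> \<ell>\<^sup>2(ker V\<^sup>*)\<close>. To work on the type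
  \<open>H \<times> \<ell>\<^sup>2(H)\<close>, it is taken to be the identity on \<open>\<ell>\<^sup>2(ran V)\<close>.
\<close>

definition defect :: "('a::chilbert_space \<Rightarrow> 'a) \<Rightarrow> 'a \<Rightarrow> 'a" where
  "defect V x = x - V (cadj V x)"

text \<open>Here \<open>defect V\<close> is the projection onto the kernel of \<open>cadj V\<close>.
  Components in this kernel move one place to the left, the first one entering H; components in the
  range of \<open>V\<close> stay where they are.\<close>

definition unitary_ext :: "('a::chilbert_space \<Rightarrow> 'a) \<Rightarrow> 'a \<times> 'a ell2 \<Rightarrow> 'a \<times> 'a ell2" where
  "unitary_ext V z = (let u = ell2_nth (snd z) in
     (V (fst z) + defect V (u 0), Abs_ell2 (\<lambda>j. defect V (u (Suc j)) + (u j - defect V (u j)))))"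

definition unitary_ext_inv :: "('a::chilbert_space \<Rightarrow> 'a) \<Rightarrow> 'a \<times> 'a ell2 \<Rightarrow> 'a \<times> 'a ell2" where
  "unitary_ext_inv V z = (let u = ell2_nth (snd z) in
     (cadj V (fst z), Abs_ell2 (\<lambda>j. (case j of 0 \<Rightarrow> defect V (fst z) | Suc i \<Rightarrow> defect V (u i))
        + (u j - defect V (u j)))))"

lemma ell2_nth_Abs_ell2:
  "summable (\<lambda>n. (norm (f n))\<^sup>2) \<Longrightarrow> ell2_nth (Abs_ell2 f) n = f n"
  by (simp add: Abs_ell2_inverse)

lemma summable_norm_sq_contraction:
  assumes "summable (\<lambda>n. (norm (f n))\<^sup>2)" "\<And>x. norm (T x) \<le> norm x"
  shows "summable (\<lambda>n. (norm (T (f n)))\<^sup>2)"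
  by (rule summable_comparison_test'[OF assms(1)]) (simp add: assms(2) power_mono)

context
  fixes V :: "'a::chilbert_space \<Rightarrow> 'a"
  assumes V: "bounded_clinear V" and iso: "\<And>x. cadj V (V x) = x"
begin

interpretation V: bounded_linear V
  using bounded_clinearD(1)[OF V] .

interpretation V': bounded_linear "cadj V"
  using bounded_clinearD(1)[OF bounded_clinear_cadj[OF V]] .

lemma defect_range: "defect V (V x) = 0"
  by (simp add: defect_def iso)

lemma cadj_defect: "cadj V (defect V x) = 0"
  by (simp add: defect_def V'.diff iso)

lemma range_decomp: "V (cadj V x) = x - defect V x"
  by (simp add: defect_def)

lemma defect_defect: "defect V (defect V x) = defect V x"
  by (simp add: defect_def[of V "defect V x"] cadj_defect V.zero)

lemma bounded_clinear_defect: "bounded_clinear (defect V)"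
  unfolding defect_def[abs_def]
  by (intro bounded_clinear_diff bounded_clinear_ident bounded_clinear_compose[OF V]
      bounded_clinear_cadj[OF V])

interpretation P: bounded_linear "defect V"
  using bounded_clinearD(1)[OF bounded_clinear_defect] .

lemma cinner_defect: "cinner (defect V x) y = cinner x (defect V y)"
  by (simp add: defect_def cinner_diff_left cinner_diff_right cinner_cadj_right[OF V]
      cinner_cadj_left[OF V, symmetric])

lemma norm_defect_decomp: "(norm x)\<^sup>2 = (norm (defect V x))\<^sup>2 + (norm (x - defect V x))\<^sup>2"
proof -
  have "inner (defect V x) (x - defect V x) = 0"
    by (simp add: inner_eq_Re_cinner cinner_defect P.diff defect_defect)
  then have "orthogonal (defect V x) (x - defect V x)" by (simp only: orthogonal_def)
  from norm_add_Pythagorean[OF this] show ?thesis by simp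
qed

lemma norm_defect_le: "norm (defect V x) \<le> norm x" "norm (x - defect V x) \<le> norm x"
  using norm_defect_decomp[of x] by (auto intro!: power2_le_imp_le[OF _ norm_ge_zero])

lemma summable_unitary_ext:
  "summable (\<lambda>j. (norm (defect V (ell2_nth u (Suc j)) + (ell2_nth u j - defect V (ell2_nth u j))))\<^sup>2)"
proof (rule summable_norm_sq_add)
  have "summable (\<lambda>j. (norm (ell2_nth u (Suc j)))\<^sup>2)"
    using summable_ell2[of u] by (subst summable_Suc_iff)
  then show "summable (\<lambda>j. (norm (defect V (ell2_nth u (Suc j))))\<^sup>2)"
    by (rule summable_norm_sq_contraction) (rule norm_defect_le)
  show "summable (\<lambda>j. (norm (ell2_nth u j - defect V (ell2_nth u j)))\<^sup>2)"
    using summable_norm_sq_contraction[OF summable_ell2, of "\<lambda>x. x - defect V x"] norm_defect_le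
    by simp
qed

lemma summable_unitary_ext_inv:
  "summable (\<lambda>j. (norm ((case j of 0 \<Rightarrow> defect V x | Suc i \<Rightarrow> defect V (ell2_nth u i))
     + (ell2_nth u j - defect V (ell2_nth u j))))\<^sup>2)"
proof (rule summable_norm_sq_add)
  have "summable (\<lambda>j. (norm (defect V (ell2_nth u j)))\<^sup>2)"
    by (rule summable_norm_sq_contraction[OF summable_ell2]) (rule norm_defect_le)
  then show "summable (\<lambda>j. (norm (case j of 0 \<Rightarrow> defect V x | Suc i \<Rightarrow> defect V (ell2_nth u i)))\<^sup>2)"
    by (subst summable_Suc_iff[symmetric]) simp
  show "summable (\<lambda>j. (norm (ell2_nth u j - defect V (ell2_nth u j)))\<^sup>2)"
    using summable_norm_sq_contraction[OF summable_ell2, of "\<lambda>x. x - defect V x"] norm_defect_le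
    by simp
qed

lemma unitary_ext_coord:
  "fst (unitary_ext V z) = V (fst z) + defect V (ell2_nth (snd z) 0)"
  "ell2_nth (snd (unitary_ext V z)) j = defect V (ell2_nth (snd z) (Suc j))
     + (ell2_nth (snd z) j - defect V (ell2_nth (snd z) j))"
  by (simp_all add: unitary_ext_def Let_def ell2_nth_Abs_ell2[OF summable_unitary_ext])

lemma unitary_ext_inv_coord:
  "fst (unitary_ext_inv V z) = cadj V (fst z)"
  "ell2_nth (snd (unitary_ext_inv V z)) 0 = defect V (fst z)
     + (ell2_nth (snd z) 0 - defect V (ell2_nth (snd z) 0))"
  "ell2_nth (snd (unitary_ext_inv V z)) (Suc i) = defect V (ell2_nth (snd z) i)
     + (ell2_nth (snd z) (Suc i) - defect V (ell2_nth (snd z) (Suc i)))"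
  by (simp_all add: unitary_ext_inv_def Let_def ell2_nth_Abs_ell2[OF summable_unitary_ext_inv])

lemma unitary_ext_right_inv: "unitary_ext V (unitary_ext_inv V z) = z"
proof (rule prod_eqI)
  show "fst (unitary_ext V (unitary_ext_inv V z)) = fst z"
    by (simp add: unitary_ext_coord unitary_ext_inv_coord P.add P.diff defect_defect range_decomp)
  show "snd (unitary_ext V (unitary_ext_inv V z)) = snd z"
  proof (rule ell2_eqI)
    show "ell2_nth (snd (unitary_ext V (unitary_ext_inv V z))) n = ell2_nth (snd z) n" for n
      by (cases n) (simp_all add: unitary_ext_coord unitary_ext_inv_coord P.add P.diff defect_defect)
  qed
qed

lemma unitary_ext_left_inv: "unitary_ext_inv V (unitary_ext V z) = z"
proof (rule prod_eqI)
  show "fst (unitary_ext_inv V (unitary_ext V z)) = fst z"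
    by (simp add: unitary_ext_coord unitary_ext_inv_coord V'.add iso cadj_defect)
  show "snd (unitary_ext_inv V (unitary_ext V z)) = snd z"
  proof (rule ell2_eqI)
    show "ell2_nth (snd (unitary_ext_inv V (unitary_ext V z))) n = ell2_nth (snd z) n" for n
      by (cases n) (simp_all add: unitary_ext_coord unitary_ext_inv_coord P.add P.diff
          defect_defect defect_range)
  qed
qed

text \<open>The series a collects the shifted kernel components, b the fixed range components. The
  head b 0 is split off because the inverse treats entry 0 separately.\<close>

lemma unitary_ext_adjoint: "cinner (unitary_ext V z) w = cinner z (unitary_ext_inv V w)"
proof -
  obtain x u y v where zw: "z = (x, u)" "w = (y, v)" by fastforce
  let ?P = "defect V" and ?u = "ell2_nth u" and ?v = "ell2_nth v"
  define a where "a j = cinner (?u (Suc j)) (?P (?v j))" for j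
  define b where "b j = cinner (?u j) (?v j - ?P (?v j))" for j
  have sP: "summable (\<lambda>j. (norm (?P (?v j)))\<^sup>2)"
    by (rule summable_norm_sq_contraction[OF summable_ell2]) (rule norm_defect_le)
  have sP': "summable (\<lambda>j. (norm (?v j - ?P (?v j)))\<^sup>2)"
    using summable_norm_sq_contraction[OF summable_ell2, of "\<lambda>x. x - ?P x"] norm_defect_le by simp
  have "summable (\<lambda>j. (norm (?u (Suc j)))\<^sup>2)"
    using summable_ell2[of u] by (subst summable_Suc_iff)
  then have sa: "summable a"
    unfolding a_def by (rule summable_cinner[OF _ sP])
  have sb: "summable b"
    unfolding b_def by (rule summable_cinner[OF summable_ell2 sP'])
  have "cinner (snd (unitary_ext V z)) v = (\<Sum>j. a j + b j)"
    unfolding cinner_ell2_def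
    by (simp add: unitary_ext_coord zw a_def b_def cinner_add_left cinner_diff_left
        cinner_diff_right cinner_defect)
  also have "\<dots> = suminf a + suminf b"
    by (rule suminf_add[symmetric, OF sa sb])
  also have "suminf b = b 0 + (\<Sum>j. b (Suc j))"
    using suminf_split_head[OF sb] by simp
  finally have l: "cinner (unitary_ext V z) w
      = cinner (V x) y + cinner (?P (?u 0)) y + (suminf a + (b 0 + (\<Sum>j. b (Suc j))))"
    by (simp add: cinner_prod_def zw unitary_ext_coord cinner_add_left)
  have sv: "summable (\<lambda>j. cinner (?u j) (ell2_nth (snd (unitary_ext_inv V w)) j))"
    by (rule summable_cinner[OF summable_ell2 summable_ell2])
  have "cinner u (snd (unitary_ext_inv V w))
      = cinner (?u 0) (ell2_nth (snd (unitary_ext_inv V w)) 0)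
        + (\<Sum>j. cinner (?u (Suc j)) (ell2_nth (snd (unitary_ext_inv V w)) (Suc j)))"
    unfolding cinner_ell2_def using suminf_split_head[OF sv] by simp
  also have "(\<lambda>j. cinner (?u (Suc j)) (ell2_nth (snd (unitary_ext_inv V w)) (Suc j)))
      = (\<lambda>j. a j + b (Suc j))"
    by (simp add: unitary_ext_inv_coord zw a_def b_def cinner_add_right fun_eq_iff)
  also have "(\<Sum>j. a j + b (Suc j)) = suminf a + (\<Sum>j. b (Suc j))"
    by (rule suminf_add[symmetric, OF sa]) (use sb in \<open>subst summable_Suc_iff\<close>)
  also have "cinner (?u 0) (ell2_nth (snd (unitary_ext_inv V w)) 0) = cinner (?P (?u 0)) y + b 0"
    by (simp add: unitary_ext_inv_coord zw b_def cinner_add_right cinner_defect)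
  finally have "cinner z (unitary_ext_inv V w)
      = cinner (V x) y + (cinner (?P (?u 0)) y + b 0 + (suminf a + (\<Sum>j. b (Suc j))))"
    by (simp add: cinner_prod_def zw unitary_ext_inv_coord cinner_cadj_right[OF V])
  with l show ?thesis by simp
qed

lemma bounded_clinear_unitary_ext: "bounded_clinear (unitary_ext V)"
proof (rule bounded_clinear_isometryI)
  note PC = bounded_clinearD(2)[OF bounded_clinear_defect] and VC = bounded_clinearD(2)[OF V]
  fix z w and c :: complex
  show "unitary_ext V (z + w) = unitary_ext V z + unitary_ext V w"
    by (rule prod_eqI) (auto intro!: ell2_eqI simp: unitary_ext_coord plus_ell2.rep_eq V.add P.add)
  show "unitary_ext V (c *\<^sub>C z) = c *\<^sub>C unitary_ext V z"
    by (rule prod_eqI) (auto intro!: ell2_eqI simp: unitary_ext_coord scaleC_prod_def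
        scaleC_ell2.rep_eq PC VC scaleC_add_right scaleC_diff_right)
  show "cinner (unitary_ext V z) (unitary_ext V z) = cinner z z"
    by (simp add: unitary_ext_adjoint unitary_ext_left_inv)
qed

lemma bounded_clinear_unitary_ext_inv: "bounded_clinear (unitary_ext_inv V)"
proof (rule bounded_clinear_isometryI)
  fix z w and c :: complex
  have inj: "unitary_ext V x = unitary_ext V y \<Longrightarrow> x = y" for x y
    by (metis unitary_ext_left_inv)
  interpret U: bounded_linear "unitary_ext V"
    using bounded_clinearD(1)[OF bounded_clinear_unitary_ext] .
  show "unitary_ext_inv V (z + w) = unitary_ext_inv V z + unitary_ext_inv V w"
    by (rule inj) (simp add: U.add unitary_ext_right_inv)
  show "unitary_ext_inv V (c *\<^sub>C z) = c *\<^sub>C unitary_ext_inv V z"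
    by (rule inj) (simp add: bounded_clinearD(2)[OF bounded_clinear_unitary_ext] unitary_ext_right_inv)
  show "cinner (unitary_ext_inv V z) (unitary_ext_inv V z) = cinner z z"
    by (simp add: unitary_ext_adjoint[symmetric] unitary_ext_right_inv)
qed

end

subsection \<open>Quasinormal operators\<close>

definition approx_eigen :: "('a::real_normed_vector \<Rightarrow> 'a) \<Rightarrow> real \<Rightarrow> (nat \<Rightarrow> 'a) \<Rightarrow> bool" where
  "approx_eigen A s y \<longleftrightarrow> (\<lambda>n. A (y n) - s *\<^sub>R y n) \<longlonglongrightarrow> 0"

lemma joint_approx_eigenD:
  assumes "joint_approx_eigen A B s t y"
  shows "norm (y n) = 1" "approx_eigen A s y" "approx_eigen B t y"
  using assms by (simp_all add: joint_approx_eigen_def approx_eigen_def)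

lemma approx_eigen_ident: "approx_eigen (\<lambda>x. x) 1 y"
  by (simp add: approx_eigen_def)

lemma approx_eigen_add:
  assumes "approx_eigen A s y" "approx_eigen B t y"
  shows "approx_eigen (\<lambda>x. A x + B x) (s + t) y"
  using tendsto_add[OF assms[unfolded approx_eigen_def]]
  by (simp add: approx_eigen_def algebra_simps)

lemma approx_eigen_diff:
  assumes "approx_eigen A s y" "approx_eigen B t y"
  shows "approx_eigen (\<lambda>x. A x - B x) (s - t) y"
  using tendsto_diff[OF assms[unfolded approx_eigen_def]]
  by (simp add: approx_eigen_def algebra_simps)

lemma approx_eigen_scaleR:
  assumes "approx_eigen A s y"
  shows "approx_eigen (\<lambda>x. r *\<^sub>R A x) (r * s) y"
  using tendsto_scaleR[OF tendsto_const[of r] assms[unfolded approx_eigen_def]]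
  by (simp add: approx_eigen_def scaleR_diff_right)

lemma approx_eigen_compose:
  assumes A: "bounded_linear A" "approx_eigen A s y" and B: "approx_eigen B t y"
  shows "approx_eigen (\<lambda>x. A (B x)) (s * t) y"
proof -
  interpret A: bounded_linear A by fact
  have "(\<lambda>n. A (B (y n) - t *\<^sub>R y n) + t *\<^sub>R (A (y n) - s *\<^sub>R y n)) \<longlonglongrightarrow> A 0 + t *\<^sub>R 0"
    by (intro tendsto_add A.tendsto tendsto_scaleR tendsto_const B[unfolded approx_eigen_def]
        A(2)[unfolded approx_eigen_def])
  then show ?thesis
    by (simp add: approx_eigen_def A.diff A.scaleR A.zero scaleR_diff_right mult.commute)
qed

lemma approx_eigen_inner:
  assumes y: "\<And>n. norm (y n) = 1" and A: "approx_eigen A s y"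
  shows "(\<lambda>n. inner (A (y n)) (y n)) \<longlonglongrightarrow> s"
proof -
  have "(\<lambda>n. norm (A (y n) - s *\<^sub>R y n)) \<longlonglongrightarrow> 0"
    using A unfolding approx_eigen_def by (rule tendsto_norm_zero)
  then have "(\<lambda>n. inner (A (y n) - s *\<^sub>R y n) (y n)) \<longlonglongrightarrow> 0"
  proof (rule Lim_null_comparison[rotated])
    have "norm (inner (A (y n) - s *\<^sub>R y n) (y n)) \<le> norm (A (y n) - s *\<^sub>R y n)" for n
      using Cauchy_Schwarz_ineq2[of "A (y n) - s *\<^sub>R y n" "y n"] y[of n] by simp
    then show "\<forall>\<^sub>F n in sequentially. norm (inner (A (y n) - s *\<^sub>R y n) (y n))
        \<le> norm (A (y n) - s *\<^sub>R y n)" by simp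
  qed
  moreover have "inner (A (y n) - s *\<^sub>R y n) (y n) = inner (A (y n)) (y n) - s" for n
    using y[of n] by (simp add: inner_diff_left power2_norm_eq_inner[symmetric])
  ultimately show ?thesis by (simp add: LIM_zero_iff)
qed

lemma approx_eigen_unique:
  fixes A :: "'a::real_inner \<Rightarrow> 'a"
  assumes "\<And>n. norm (y n) = 1" "approx_eigen A s y" "approx_eigen A t y"
  shows "s = t"
  using approx_eigen_inner[OF assms(1,2)] approx_eigen_inner[OF assms(1,3)] LIMSEQ_unique by blast

lemma quasinormalD:
  assumes "quasinormal Q"
  shows "bounded_clinear Q" "Q (cadj Q (Q x)) = cadj Q (Q (Q x))"
  using assms unfolding quasinormal_def by (simp_all add: fun_eq_iff)

text \<open>
  With \<open>L = Q\<^sup>*Q\<close> and \<open>K = QQ\<^sup>*\<close> quasinormality gives \<open>LK = K\<^sup>2\<close>. If \<open>K \<le> L\<close> failed, then there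
  would be a joint approximate eigenvalue \<open>s\<close> of \<open>K\<close> and \<open>t\<close> of \<open>L\<close> with \<open>s > t \<ge> 0\<close> and \<open>ts = s\<^sup>2\<close>.
\<close>

lemma quasinormal_imp_hyponormal:
  assumes Q: "quasinormal Q"
  shows "pos_op (\<lambda>x. cadj Q (Q x) - Q (cadj Q x))"
proof -
  define L where "L x = cadj Q (Q x)" for x
  define K where "K x = Q (cadj Q x)" for x
  note bQ = quasinormalD(1)[OF Q]
  have L: "pos_op L" unfolding L_def[abs_def] by (rule pos_op_cadj_self[OF bQ])
  have K: "pos_op K"
    using pos_op_cadj_self[OF bounded_clinear_cadj[OF bQ]]
    by (simp add: K_def[abs_def] cadj_cadj[OF bQ])
  interpret K: bounded_linear K using pos_opD(1)[OF K] .
  interpret L: bounded_linear L using pos_opD(1)[OF L] .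
  have LK: "L (K x) = K (K x)" for x
    by (simp add: L_def K_def quasinormalD(2)[OF Q])
  \<comment> \<open>Taking adjoints in L K = K^2, whose right side is self-adjoint, gives K L = K^2
    as well, so K and L commute.\<close>
  have "inner (K (L x) - K (K x)) y = 0" for x y
    by (simp add: inner_diff_left pos_opD(2)[OF K] pos_opD(2)[OF L] LK)
  then have "K (L x) - K (K x) = 0" for x
    using inner_eq_zero_iff by blast
  then have KL: "K (L x) = L (K x)" for x by (simp add: LK)
  have sym: "sym_op (\<lambda>x. L x - K x)"
    by (intro sym_op_diff pos_op_imp_sym_op L K)
  have "0 \<le> inner (L x - K x) x" for x
  proof (rule ccontr)
    assume "\<not> 0 \<le> inner (L x - K x) x"
    then have pos: "0 < inner (K x - L x) x" by (simp add: inner_diff_left)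
    have bl: "bounded_linear (\<lambda>x. K x - L x)"
      by (intro bounded_linear_sub K.bounded_linear_axioms L.bounded_linear_axioms)
    have com: "commutes K L" "commutes (\<lambda>x. K x - L x) K" "commutes (\<lambda>x. K x - L x) L"
      by (simp_all add: commutes_def K.diff L.diff KL)
    obtain s t y c where st: "0 \<le> s" "0 \<le> t" and y: "joint_approx_eigen K L s t y"
      and c: "0 < c" "\<And>n. c \<le> inner (K (y n) - L (y n)) (y n)"
      by (rule joint_approx_eigen_exists[OF K L bl com pos]) (blast intro: that)
    note y = joint_approx_eigenD[OF y]
    have "(\<lambda>n. inner (K (y n) - L (y n)) (y n)) \<longlonglongrightarrow> s - t"
      by (rule approx_eigen_inner[OF y(1) approx_eigen_diff[OF y(2,3)]])
    then have "c \<le> s - t"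
      by (rule LIMSEQ_le_const) (use c in blast)
    moreover have "s * s = t * s"
    proof (rule approx_eigen_unique[OF y(1)])
      show "approx_eigen (\<lambda>x. K (K x)) (s * s) y"
        by (rule approx_eigen_compose[OF K.bounded_linear_axioms y(2,2)])
      show "approx_eigen (\<lambda>x. K (K x)) (t * s) y"
        unfolding LK[symmetric] by (rule approx_eigen_compose[OF L.bounded_linear_axioms y(3,2)])
    qed
    ultimately show False using st c(1) by auto
  qed
  then show ?thesis
    using sym unfolding pos_op_def sym_op_def L_def K_def by blast
qed

text \<open>The extension is the block matrix with rows (Q, D) and (0, \<open>cadj Q\<close>), where
  D is the root of the self-commutator of \<open>Q\<close>. Quasinormality gives D^2 Q = 0, hence D
  Q = 0 and, by adjoints, \<open>cadj Q\<close> D = 0. These remove the mixed terms, and both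
  diagonal entries of N M and of M N become \<open>cadj Q\<close> Q.\<close>

lemma quasinormal_normal_ext:
  fixes Q :: "'b::chilbert_space \<Rightarrow> 'b"
  assumes Q: "quasinormal Q"
  shows "\<exists>N M :: 'b \<times> 'b \<Rightarrow> 'b \<times> 'b. bounded_clinear N \<and> bounded_clinear M \<and>
    (\<forall>x y. cinner (N x) y = cinner x (M y)) \<and> (\<forall>x. N (M x) = M (N x)) \<and>
    (\<forall>y. N (y, 0) = (Q y, 0))"
proof -
  note bQ = quasinormalD(1)[OF Q]
  note bQ' = bounded_clinear_cadj[OF bQ]
  have "bounded_clinear (\<lambda>x. cadj Q (Q x) - Q (cadj Q x))"
    by (intro bounded_clinear_diff bounded_clinear_compose[OF bQ' bQ] bounded_clinear_compose[OF bQ bQ'])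
  then obtain D where D: "bounded_clinear D" "pos_op D"
    "\<And>x. D (D x) = cadj Q (Q x) - Q (cadj Q x)"
    by (rule positive_op_sqrt[OF quasinormal_imp_hyponormal[OF Q]]) (blast intro: that)
  interpret D: bounded_linear D using pos_opD(1)[OF D(2)] .
  interpret Q: bounded_linear Q using bounded_clinearD(1)[OF bQ] .
  interpret Q': bounded_linear "cadj Q" using bounded_clinearD(1)[OF bQ'] .
  have D_adj: "cinner (D x) y = cinner x (D y)" for x y
    by (rule cinner_adjointI[OF D(1) pos_opD(2)[OF D(2)]])
  have DQ: "D (Q x) = 0" for x
  proof -
    have "inner (D (Q x)) (D (Q x)) = inner (Q x) (D (D (Q x)))"
      by (rule pos_opD(2)[OF D(2)])
    also have "\<dots> = 0" by (simp add: D(3) quasinormalD(2)[OF Q])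
    finally show ?thesis by simp
  qed
  have Q'D: "cadj Q (D x) = 0" for x
    by (rule cinner_eqI) (simp add: cinner_cadj_right[OF bQ, symmetric] D_adj[symmetric] DQ)
  define N where "N z = (Q (fst z) + D (snd z), cadj Q (snd z))" for z
  define M where "M z = (cadj Q (fst z), D (fst z) + Q (snd z))" for z
  show ?thesis
  proof (intro exI conjI allI)
    show "bounded_clinear N" "bounded_clinear M"
      unfolding N_def[abs_def] M_def[abs_def]
      by (intro bounded_clinear_Pair bounded_clinear_add bounded_clinear_compose[OF bQ]
          bounded_clinear_compose[OF D(1)] bounded_clinear_compose[OF bQ']
          bounded_clinear_fst bounded_clinear_snd)+
    show "cinner (N x) y = cinner x (M y)" for x y
      by (simp add: N_def M_def cinner_prod_def cinner_add_left cinner_add_right D_adj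
          cinner_cadj_right[OF bQ] cinner_cadj_left[OF bQ])
    show "N (M x) = M (N x)" for x
      by (simp add: N_def M_def Q.add Q'.add D.add D(3) DQ Q'D)
    show "N (y, 0) = (Q y, 0)" for y
      by (simp add: N_def D.zero Q'.zero)
  qed
qed

section \<open>Subnormality in the class \<open>\<Q>\<close>\<close>

lemma class_QD:
  assumes "class_Q V F Q"
  shows "bounded_clinear V" "bounded_clinear F" "bounded_clinear Q"
    "cadj V (V x) = x" "cadj V (F y) = 0" "Q (cadj F (F y)) = cadj F (F (Q y))" "quasinormal Q"
  using assms unfolding class_Q_def by (simp_all add: fun_eq_iff)

lemma class_Q_scaleC:
  assumes "class_Q V E Q"
  shows "class_Q V (\<lambda>y. c *\<^sub>C E y) Q"
proof -
  note E = class_QD[OF assms]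
  have "cadj V (c *\<^sub>C E y) = 0" for y
    by (simp add: bounded_clinearD(2)[OF bounded_clinear_cadj[OF E(1)]] E(5))
  moreover have "Q (cnj c *\<^sub>C cadj E (c *\<^sub>C E y)) = cnj c *\<^sub>C cadj E (c *\<^sub>C E (Q y))" for y
    by (simp add: bounded_clinearD(2)[OF E(3)] bounded_clinearD(2)[OF bounded_clinear_cadj[OF E(2)]] E(6))
  ultimately show ?thesis
    using assms E(2) unfolding class_Q_def
    by (simp add: fun_eq_iff cadj_scaleC bounded_clinear_scaleC)
qed

text \<open>In the notation of the overview, L is \<open>gram Q\<close> and G is
  \<open>gram F\<close>.\<close>

definition gram :: "('a::chilbert_space \<Rightarrow> 'b::chilbert_space) \<Rightarrow> 'a \<Rightarrow> 'a" where
  "gram A x = cadj A (A x)"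

context
  fixes V :: "'a::chilbert_space \<Rightarrow> 'a" and F :: "'b::chilbert_space \<Rightarrow> 'a" and Q :: "'b \<Rightarrow> 'b"
  assumes cQ: "class_Q V F Q"
begin

lemmas clinear_V = class_QD(1)[OF cQ] and clinear_F = class_QD(2)[OF cQ]
  and clinear_Q = class_QD(3)[OF cQ]
lemmas quasi = class_QD(7)[OF cQ]

lemma gram_F_clinear: "bounded_clinear (gram F)"
  unfolding gram_def[abs_def]
  by (rule bounded_clinear_compose[OF bounded_clinear_cadj[OF clinear_F] clinear_F])

lemma gram_Q_pos: "pos_op (gram Q)" and gram_F_pos: "pos_op (gram F)"
  unfolding gram_def[abs_def]
  by (intro pos_op_cadj_self clinear_Q clinear_F)+

interpretation Q: bounded_linear Q using bounded_clinearD(1)[OF clinear_Q] .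
interpretation F: bounded_linear F using bounded_clinearD(1)[OF clinear_F] .
interpretation V: bounded_linear V using bounded_clinearD(1)[OF clinear_V] .
interpretation gram_Q: bounded_linear "gram Q" using pos_opD(1)[OF gram_Q_pos] .
interpretation gram_F: bounded_linear "gram F" using pos_opD(1)[OF gram_F_pos] .

lemma Q_gram_Q: "Q (gram Q x) = gram Q (Q x)"
  by (simp add: gram_def quasinormalD(2)[OF quasi])

lemma Q_gram_F: "Q (gram F x) = gram F (Q x)"
  using class_QD(6)[OF cQ] by (simp add: gram_def)

lemma gram_F_gram_Q: "gram F (gram Q x) = gram Q (gram F x)"
proof -
  have "commutes Q (gram F)" using Q_gram_F by (simp add: commutes_def)
  then have "commutes (cadj Q) (gram F)"
    using commutes_cadj[OF clinear_Q gram_F_clinear pos_op_imp_sym_op[OF gram_F_pos]] by blast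
  then show ?thesis by (simp add: gram_def[of Q] Q_gram_F commutes_def)
qed

lemma Q_gram_Q_funpow: "Q ((gram Q ^^ j) x) = (gram Q ^^ j) (Q x)"
  by (induction j) (simp_all add: Q_gram_Q)

lemma gram_F_gram_Q_funpow: "gram Q (gram F ((gram Q ^^ j) x)) = gram F ((gram Q ^^ Suc j) x)"
  by (simp add: gram_F_gram_Q)

text \<open>Quasinormality turns the adjoint of Q^j times Q^j into L^j, and G commutes with
  \<open>Q\<close>: the Gram operator of F Q^j is G L^j.\<close>

lemma cinner_F_funpow:
  "cinner (F ((Q ^^ j) x)) (F ((Q ^^ j) y)) = cinner (gram F ((gram Q ^^ j) x)) y"
proof (induction j arbitrary: x y)
  case 0
  show ?case by (simp add: gram_def cinner_cadj_left[OF clinear_F])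
next
  case (Suc j)
  have "cinner (F ((Q ^^ Suc j) x)) (F ((Q ^^ Suc j) y))
      = cinner (F ((Q ^^ j) (Q x))) (F ((Q ^^ j) (Q y)))"
    by (simp add: funpow_swap1)
  also have "\<dots> = cinner (Q (gram F ((gram Q ^^ j) x))) (Q y)"
    by (simp add: Suc Q_gram_F Q_gram_Q_funpow)
  also have "\<dots> = cinner (gram Q (gram F ((gram Q ^^ j) x))) y"
    by (simp add: gram_def cinner_cadj_left[OF clinear_Q])
  finally show ?case by (simp only: gram_F_gram_Q_funpow)
qed

lemma inner_gram_F_funpow:
  "inner (gram F ((gram Q ^^ j) x)) ((gram Q ^^ k) y) = inner (gram F ((gram Q ^^ (k + j)) x)) y"
proof (induction k arbitrary: j)
  case (Suc k)
  have "inner (gram F ((gram Q ^^ j) x)) ((gram Q ^^ Suc k) y)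
      = inner (gram Q (gram F ((gram Q ^^ j) x))) ((gram Q ^^ k) y)"
    by (simp add: pos_opD(2)[OF gram_Q_pos])
  also have "\<dots> = inner (gram F ((gram Q ^^ (k + Suc j)) x)) y"
    unfolding gram_F_gram_Q_funpow Suc ..
  finally show ?case by simp
qed simp

lemma norm_F_funpow: "(norm (F ((Q ^^ j) x)))\<^sup>2 = inner (gram F ((gram Q ^^ j) x)) x"
  by (simp add: power2_norm_eq_inner inner_eq_Re_cinner cinner_F_funpow)

text \<open>
  Here \<open>v = (1 + L + \<dots> + L\<^sup>n\<^sup>-\<^sup>1) y\<close> with \<open>L = Q\<^sup>*Q\<close>, and \<open>G = F\<^sup>*F\<close>.
  Since \<open>v - L v = y - L\<^sup>n y\<close>, the hypothesis \<open>G (1 - L - G) \<ge> 0\<close> at \<open>v\<close> gives \<open>\<parallel>G v\<parallel>\<^sup>2 \<le> \<langle>y, G v\<rangle>\<close>.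
\<close>

lemma F_funpow_sum_le:
  assumes le: "\<And>x. inner (gram Q x + gram F x) (gram F x) \<le> inner x (gram F x)"
  shows "(\<Sum>j<n. (norm (F ((Q ^^ j) y)))\<^sup>2) \<le> (norm y)\<^sup>2"
proof -
  define v where "v = (\<Sum>j<n. (gram Q ^^ j) y)"
  have tele: "(\<Sum>j<n. (gram Q ^^ j) y) - gram Q (\<Sum>j<n. (gram Q ^^ j) y) = y - (gram Q ^^ n) y"
  proof (induction n)
    case (Suc n)
    have "(\<Sum>j<Suc n. (gram Q ^^ j) y) - gram Q (\<Sum>j<Suc n. (gram Q ^^ j) y)
        = ((\<Sum>j<n. (gram Q ^^ j) y) - gram Q (\<Sum>j<n. (gram Q ^^ j) y))
          + ((gram Q ^^ n) y - (gram Q ^^ Suc n) y)"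
      by (simp add: gram_Q.add)
    then show ?case unfolding Suc by simp
  qed (simp add: gram_Q.zero)
  have Fv: "gram F v = (\<Sum>j<n. gram F ((gram Q ^^ j) y))"
    by (simp add: v_def gram_F.sum)
  have nn: "0 \<le> inner (gram F v) ((gram Q ^^ n) y)"
    unfolding Fv inner_sum_left inner_gram_F_funpow norm_F_funpow[symmetric] by (rule sum_nonneg) simp
  have sum: "(\<Sum>j<n. (norm (F ((Q ^^ j) y)))\<^sup>2) = inner (gram F v) y"
    unfolding Fv inner_sum_left norm_F_funpow ..
  have "(norm (gram F v))\<^sup>2 \<le> inner (v - gram Q v) (gram F v)"
    using le[of v] by (simp add: power2_norm_eq_inner inner_add_left inner_diff_left)
  also have "\<dots> = inner (gram F v) y - inner (gram F v) ((gram Q ^^ n) y)"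
    using tele by (simp add: v_def[symmetric] inner_commute[of _ "gram F v"] inner_diff_right)
  finally have *: "(norm (gram F v))\<^sup>2 \<le> inner (gram F v) y" using nn by linarith
  have cs: "inner (gram F v) y \<le> norm (gram F v) * norm y" by (rule norm_cauchy_schwarz)
  \<comment> \<open>From ||G v||^2 <= <G v, y> <= ||G v|| ||y||. A second use of Cauchy-Schwarz
    bounds the sum <G v, y> by ||y||^2, independently of n.\<close>
  have "norm (gram F v) \<le> norm y"
  proof (cases "norm (gram F v) = 0")
    case False
    have "norm (gram F v) * norm (gram F v) \<le> norm (gram F v) * norm y"
      using * cs by (simp add: power2_eq_square)
    then show ?thesis by (rule mult_left_le_imp_le) (use False in simp)
  qed simp
  then have "norm (gram F v) * norm y \<le> norm y * norm y" by (rule mult_right_mono) simp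
  then show ?thesis unfolding sum using cs by (simp add: power2_eq_square)
qed

text \<open>
  The extension acts on \<open>(H\<^sub>1 \<oplus> \<ell>\<^sup>2(H\<^sub>1)) \<oplus> (H\<^sub>2 \<oplus> H\<^sub>2)\<close> as the unitary extension of \<open>V\<close> and the
  normal extension of \<open>Q\<close>. With \<open>R y = (F y, F Q y, F Q\<^sup>2 y, \<dots>)\<close>, the space \<open>H\<^sub>1 \<oplus> H\<^sub>2\<close> is
  embedded by \<open>(x, y) \<mapsto> ((x, R y), ((1 - R\<^sup>*R)\<^sup>1\<^sup>/\<^sup>2 y, 0))\<close>.
\<close>

theorem subnormal_block_op:
  assumes le: "\<And>x. inner (gram Q x + gram F x) (gram F x) \<le> inner x (gram F x)"
  shows "subnormal (block_op V F Q)"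
proof -
  define R where "R y = Abs_ell2 (\<lambda>j. F ((Q ^^ j) y))" for y
  have summ: "summable (\<lambda>j. (norm (F ((Q ^^ j) y)))\<^sup>2)" for y
    by (rule summableI_nonneg_bounded[where x="(norm y)\<^sup>2"]) (use F_funpow_sum_le[OF le] in auto)
  have R_nth: "ell2_nth (R y) j = F ((Q ^^ j) y)" for y j
    unfolding R_def by (rule ell2_nth_Abs_ell2[OF summ])
  have Qj: "bounded_clinear (Q ^^ j)" for j by (rule bounded_clinear_funpow[OF clinear_Q])
  have R_add: "R (x + y) = R x + R y" for x y
    by (rule ell2_eqI) (simp add: R_nth plus_ell2.rep_eq F.add linear_simps[OF bounded_clinearD(1)[OF Qj]])
  have R_scaleC: "R (c *\<^sub>C x) = c *\<^sub>C R x" for c x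
    by (rule ell2_eqI) (simp add: R_nth scaleC_ell2.rep_eq bounded_clinearD(2)[OF Qj]
        bounded_clinearD(2)[OF clinear_F])
  have R_norm: "(norm (R y))\<^sup>2 \<le> (norm y)\<^sup>2" for y
    unfolding norm_ell2_sq R_nth
    by (rule suminf_le_const[OF summ F_funpow_sum_le[OF le]])
  have "bounded_linear R"
    using R_add R_scaleC power2_le_imp_le[OF R_norm norm_ge_zero]
    by (intro bounded_linear_intro[where K=1]) (auto simp: scaleR_scaleC)
  then have R: "bounded_clinear R" using R_scaleC by (simp add: bounded_clinear_def)
  define W where "W y = cadj R (R y)" for y
  have W: "bounded_clinear W"
    unfolding W_def[abs_def] by (rule bounded_clinear_compose[OF bounded_clinear_cadj[OF R] R])
  have W_cinner: "cinner (W y) z = (\<Sum>j. cinner (gram F ((gram Q ^^ j) y)) z)" for y z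
    by (simp add: W_def cinner_cadj_left[OF R] cinner_ell2_def R_nth cinner_F_funpow)
  \<comment> \<open>\<open>W\<close> is available as a weak sum of the operators G L^j, each of
    which commutes with \<open>Q\<close>; hence the comparison through inner products.\<close>
  have "cinner z (Q (W y)) = cinner z (W (Q y))" for y z
  proof -
    have "cinner (Q (W y)) z = (\<Sum>j. cinner (gram F ((gram Q ^^ j) y)) (cadj Q z))"
      by (simp add: cinner_cadj_right[OF clinear_Q] W_cinner)
    also have "\<dots> = cinner (W (Q y)) z"
      by (simp add: cinner_cadj_right[OF clinear_Q, symmetric] Q_gram_F Q_gram_Q_funpow W_cinner)
    finally show ?thesis by (metis cinner_commute)
  qed
  then have QW: "Q (W y) = W (Q y)" for y
    using cinner_eqI by metis
  have "pos_op (\<lambda>x. x - W x)"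
  proof -
    have "sym_op W"
      unfolding W_def[abs_def] by (intro pos_op_imp_sym_op pos_op_cadj_self R)
    then have "sym_op (\<lambda>x. x - W x)" by (intro sym_op_diff sym_op_ident)
    moreover have "inner (x - W x) x = (norm x)\<^sup>2 - (norm (R x))\<^sup>2" for x
      by (simp add: inner_diff_left W_def inner_cadj_left[OF R] power2_norm_eq_inner)
    then have "0 \<le> inner (x - W x) x" for x using R_norm[of x] by simp
    ultimately show ?thesis unfolding pos_op_def sym_op_def by blast
  qed
  then obtain C where C: "bounded_clinear C" "pos_op C" "\<And>x. C (C x) = x - W x"
    "\<And>B. bounded_linear B \<Longrightarrow> commutes B (\<lambda>x. x - W x) \<Longrightarrow> commutes B C"
    by (rule positive_op_sqrt[OF _ bounded_clinear_diff[OF bounded_clinear_ident W]]) (blast intro: that)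
  interpret C: bounded_linear C using pos_opD(1)[OF C(2)] .
  \<comment> \<open>This makes the component C y evolve by \<open>Q\<close>, so that it fits the
    normal extension of \<open>Q\<close>.\<close>
  have "commutes Q C"
    by (rule C(4)[OF Q.bounded_linear_axioms]) (simp add: commutes_def Q.diff QW)
  note QC = commutesD[OF this]
  obtain N M :: "'b \<times> 'b \<Rightarrow> 'b \<times> 'b" where NM: "bounded_clinear N" "bounded_clinear M"
    "\<And>x y. cinner (N x) y = cinner x (M y)" "\<And>x. N (M x) = M (N x)" "\<And>y. N (y, 0) = (Q y, 0)"
    using quasinormal_normal_ext[OF quasi] by blast
  note iso = class_QD(4)[OF cQ]
  note U = bounded_clinear_unitary_ext[OF clinear_V iso] and U' = bounded_clinear_unitary_ext_inv[OF clinear_V iso]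
  \<comment> \<open>\<open>F\<close> maps into the kernel of \<open>cadj V\<close>, so the unitary
    extension shifts the whole sequence R y: its head F y enters the first summand and R (Q y)
    remains.\<close>
  have dF: "defect V (F y) = F y" for y
    by (simp add: defect_def class_QD(5)[OF cQ] V.zero)
  define J where "J z = ((fst z, R (snd z)), (C (snd z), 0 :: 'b))" for z :: "'a \<times> 'b"
  show ?thesis
  proof (rule subnormalI_type[where J=J])
    show "bounded_clinear (\<lambda>z. (unitary_ext V (fst z), N (snd z)))"
      "bounded_clinear (\<lambda>z. (unitary_ext_inv V (fst z), M (snd z)))"
      by (intro bounded_clinear_Pair bounded_clinear_compose[OF U] bounded_clinear_compose[OF U']
          bounded_clinear_compose[OF NM(1)] bounded_clinear_compose[OF NM(2)]
          bounded_clinear_fst bounded_clinear_snd)+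
    show "cinner (unitary_ext V (fst z), N (snd z)) w
        = cinner z (unitary_ext_inv V (fst w), M (snd w))" for z w
      by (simp add: cinner_prod_def[of _ w] cinner_prod_def[of z] NM(3) unitary_ext_adjoint[OF clinear_V iso])
    show "(unitary_ext V (fst (unitary_ext_inv V (fst z), M (snd z))),
          N (snd (unitary_ext_inv V (fst z), M (snd z))))
        = (unitary_ext_inv V (fst (unitary_ext V (fst z), N (snd z))),
          M (snd (unitary_ext V (fst z), N (snd z))))" for z
      by (simp add: unitary_ext_left_inv[OF clinear_V iso] unitary_ext_right_inv[OF clinear_V iso] NM(4))
    show "J (x + y) = J x + J y" for x y
      by (simp add: J_def R_add C.add)
    show "J (c *\<^sub>C x) = c *\<^sub>C J x" for c x
      by (simp add: J_def scaleC_prod_def R_scaleC bounded_clinearD(2)[OF C(1)])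
    show "cinner (J x) (J y) = cinner x y" for x y
    proof -
      \<comment> \<open>\<open>C\<close> carries exactly what R loses, so J preserves inner
        products.\<close>
      have "cinner (C a) (C b) = cinner a b - cinner (R a) (R b)" for a b
      proof -
        have "cinner (C a) (C b) = cinner (C (C a)) b"
          using cinner_adjointI[OF C(1) pos_opD(2)[OF C(2)], of "C a" b] by simp
        then show ?thesis by (simp add: C(3) cinner_diff_left W_def cinner_cadj_left[OF R])
      qed
      then show ?thesis by (simp add: J_def cinner_prod_def)
    qed
    show "(unitary_ext V (fst (J h)), N (snd (J h))) = J (block_op V F Q h)" for h
    proof -
      have "unitary_ext V (fst h, R (snd h)) = (V (fst h) + F (snd h), R (Q (snd h)))"
      proof (rule prod_eqI)
        show "snd (unitary_ext V (fst h, R (snd h))) = snd (V (fst h) + F (snd h), R (Q (snd h)))"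
          by (rule ell2_eqI) (simp add: unitary_ext_coord[OF clinear_V iso] R_nth dF funpow_swap1)
      qed (simp add: unitary_ext_coord[OF clinear_V iso] R_nth dF)
      then show ?thesis by (simp add: J_def block_op_def NM(5) QC)
    qed
  qed
qed

text \<open>T maps (0, y) to (F y, Q y), then to (V F y + F Q y, Q^2 y). The cross term vanishes
  because the ranges of \<open>V\<close> and \<open>F\<close> are orthogonal, and \<open>V\<close>
  preserves the norm of F y.\<close>

lemma norm_block_op:
  "(norm (block_op V F Q (0, y)))\<^sup>2 = inner (gram F y + gram Q y) y"
  "(norm (block_op V F Q (block_op V F Q (0, y))))\<^sup>2
    = inner (gram F y + gram F (gram Q y) + gram Q (gram Q y)) y"
proof -
  have VF: "inner (V x) (F z) = 0" for x z
    by (simp add: inner_cadj_right[OF clinear_V] class_QD(5)[OF cQ])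
  have VV: "inner (V x) (V z) = inner x z" for x z
    by (simp add: inner_cadj_right[OF clinear_V] class_QD(4)[OF cQ])
  have gram_F: "inner (F x) (F z) = inner (gram F x) z" for x z
    by (simp add: gram_def inner_cadj_left[OF clinear_F])
  have gram_Q: "inner (Q x) (Q z) = inner (gram Q x) z" for x z
    by (simp add: gram_def inner_cadj_left[OF clinear_Q])
  show "(norm (block_op V F Q (0, y)))\<^sup>2 = inner (gram F y + gram Q y) y"
    by (simp add: block_op_def V.zero power2_norm_eq_inner gram_F gram_Q inner_add_left)
  have 1: "inner (gram F (Q y)) (Q y) = inner (gram F (gram Q y)) y"
    by (metis Q_gram_F gram_Q gram_F_gram_Q)
  have 2: "inner (gram Q (Q y)) (Q y) = inner (gram Q (gram Q y)) y"
    by (metis Q_gram_Q gram_Q)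
  show "(norm (block_op V F Q (block_op V F Q (0, y))))\<^sup>2
      = inner (gram F y + gram F (gram Q y) + gram Q (gram Q y)) y"
    by (simp add: block_op_def V.zero power2_norm_eq_inner gram_F gram_Q inner_add_left inner_add_right
        VF VV inner_commute[of "F _" "V _"] 1 2)
qed

end

text \<open>The best choice of \<open>r\<close> gives paranormality, \<open>\<parallel>T h\<parallel>\<^sup>2 \<le> \<parallel>h\<parallel> \<parallel>T\<^sup>2 h\<parallel>\<close>.\<close>

lemma subnormal_imp_paranormal:
  fixes T :: "'h::chilbert_space \<Rightarrow> 'h"
  assumes "subnormal T"
  shows "2 * r * (norm (T h))\<^sup>2 \<le> (norm (T (T h)))\<^sup>2 + r\<^sup>2 * (norm h)\<^sup>2"
proof -
  obtain K :: "(nat \<Rightarrow> 'h) hilbert_struct" and J N where ext: "normal_extension T K J N"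
    using assms unfolding subnormal_def by blast
  interpret hilbert_space_on K using ext by (simp add: normal_extension_def)
  obtain M where adj: "adjoint_on K N M" and NM: "\<And>x. x \<in> carrier K \<Longrightarrow> N (M x) = M (N x)"
    and N: "bounded_op_on K N"
    using ext unfolding normal_extension_def normal_op_on_def by blast
  have cl: "N x \<in> carrier K" "M x \<in> carrier K" if "x \<in> carrier K" for x
    using that N adj by (auto simp: adjoint_on_def bounded_op_on_def)
  have ad: "ip K (N x) y = ip K x (M y)" if "x \<in> carrier K" "y \<in> carrier K" for x y
    using adj that by (simp add: adjoint_on_def)
  have J: "J x \<in> carrier K" "ip K (J x) (J x) = cinner x x" "N (J x) = J (T x)" for x
    using ext by (auto simp: normal_extension_def isometric_embedding_def)
  let ?x = "J h"
  \<comment> \<open>The claim is ||w - r J h||^2 >= 0: the adjoint relation gives <w, J h> = ||T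
    h||^2, and normality gives ||w|| = ||T^2 h||.\<close>
  define w where "w = M (N ?x)"
  note x = J(1)[of h]
  have w: "w \<in> carrier K" using x cl by (simp add: w_def)
  have Re_J: "Re (ip K (J y) (J y)) = (norm y)\<^sup>2" for y
    by (simp add: J(2) cinner_self)
  have "ip K w w = ip K (N w) (N ?x)"
    using ad[of w "N ?x"] w x cl by (simp add: w_def)
  also have "\<dots> = ip K (M (N (N ?x))) (N ?x)"
    using NM[of "N ?x"] x cl by (simp add: w_def)
  also have "Re \<dots> = Re (ip K (N (N ?x)) (N (N ?x)))"
    using ad[of "N ?x" "N (N ?x)"] Re_ip_commute[of "M (N (N ?x))" "N ?x"] x cl by simp
  finally have ww: "Re (ip K w w) = (norm (T (T h)))\<^sup>2"
    by (simp add: J(3) Re_J)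
  have "Re (ip K w ?x) = Re (ip K (N ?x) (N ?x))"
    using ad[of ?x "N ?x"] Re_ip_commute[of w ?x] w x cl by (simp add: w_def)
  then have wx: "Re (ip K w ?x) = (norm (T h))\<^sup>2" by (simp add: J(3) Re_J)
  let ?d = "add K w (scl K (complex_of_real (- r)) ?x)"
  have "0 \<le> Re (ip K ?d ?d)"
    using w x by (intro ip_ge_0) (simp add: add_closed scl_closed)
  also have "Re (ip K ?d ?d) = Re (ip K w w) - 2 * r * Re (ip K w ?x) + r\<^sup>2 * Re (ip K ?x ?x)"
    using w x Re_ip_commute[of w ?x]
    by (simp add: ip_add_left ip_add_right ip_scl_left ip_scl_right add_closed scl_closed
        power2_eq_square algebra_simps)
  finally show ?thesis by (simp add: ww wx Re_J)
qed

text \<open>The case a = 0 stands apart: the operator is then the direct sum of \<open>V\<close> and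
  \<open>Q\<close>, always subnormal, whereas the inequality at a = 0 would demand s <= 1.\<close>

theorem subnormal_block_op_iff:
  fixes V :: "'a::chilbert_space \<Rightarrow> 'a" and E :: "'b::chilbert_space \<Rightarrow> 'a" and Q :: "'b \<Rightarrow> 'b"
  assumes cQ: "class_Q V E Q"
  shows "subnormal (dagger V E Q (complex_of_real a))
    \<longleftrightarrow> a = 0 \<or> (\<forall>(s, t)\<in>sigma_sharp E Q. s\<^sup>2 + a\<^sup>2 * t\<^sup>2 \<le> 1)"
    and sigma_sharp_nonempty: "E \<noteq> (\<lambda>_. 0) \<Longrightarrow> sigma_sharp E Q \<noteq> {}"
proof -
  note E = class_QD(2)[OF cQ] and Q = class_QD(3)[OF cQ] and quasi = class_QD(7)[OF cQ]
  define F where "F y = complex_of_real a *\<^sub>C E y" for y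
  have cF: "class_Q V F Q" unfolding F_def[abs_def] by (rule class_Q_scaleC[OF cQ])
  define L where "L y = cadj Q (Q y)" for y
  define B where "B y = cadj E (E y)" for y
  define G where "G y = cadj F (F y)" for y
  have L: "pos_op L" and B: "pos_op B"
    unfolding L_def[abs_def] B_def[abs_def] by (intro pos_op_cadj_self E Q)+
  have cL: "bounded_clinear L" and cB: "bounded_clinear B"
    unfolding L_def[abs_def] B_def[abs_def]
    by (intro bounded_clinear_compose[OF bounded_clinear_cadj[OF Q] Q]
        bounded_clinear_compose[OF bounded_clinear_cadj[OF E] E])+
  interpret L: bounded_linear L using pos_opD(1)[OF L] .
  interpret B: bounded_linear B using pos_opD(1)[OF B] .
  have GB: "G y = a\<^sup>2 *\<^sub>R B y" for y
    unfolding G_def F_def[abs_def] cadj_scaleC[OF E] B_def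
    by (simp add: bounded_clinearD(2)[OF bounded_clinear_cadj[OF E]] scaleC_scaleC scaleR_scaleC
        power2_eq_square)
  have "commutes Q B" using class_QD(6)[OF cQ] by (simp add: commutes_def B_def)
  then have "commutes (cadj Q) B"
    by (rule commutes_cadj[OF Q cB pos_op_imp_sym_op[OF B]])
  then have BL: "commutes B L"
    using \<open>commutes Q B\<close> by (simp add: commutes_def L_def)
  let ?A = "op_abs Q" and ?B = "op_abs E"
  have A: "pos_op ?A" and B': "pos_op ?B"
    by (intro pos_op_op_abs Q E)+
  have AA: "?A (?A y) = L y" and BB: "?B (?B y) = B y" for y
    by (simp_all add: op_abs_square Q E L_def B_def)
  have comA: "commutes D ?A" if "bounded_linear D" "commutes D L" for D
    using commutes_op_abs[OF Q that(1)] that(2) by (simp add: L_def[abs_def])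
  have comB: "commutes D ?B" if "bounded_linear D" "commutes D B" for D
    using commutes_op_abs[OF E that(1)] that(2) by (simp add: B_def[abs_def])
  have "commutes L B" using BL by (rule commutes_sym)
  have BA: "commutes B ?A" by (rule comA[OF B.bounded_linear_axioms BL])
  have LA: "commutes L ?A" by (rule comA[OF L.bounded_linear_axioms]) (simp add: commutes_def)
  have LB: "commutes L ?B" by (rule comB[OF L.bounded_linear_axioms \<open>commutes L B\<close>])
  have BB': "commutes B ?B" by (rule comB[OF B.bounded_linear_axioms]) (simp add: commutes_def)
  have AB: "commutes ?A ?B"
    by (rule comB[OF pos_opD(1)[OF A] commutes_sym[OF BA]])
  have sharp: "(s, t) \<in> sigma_sharp E Q \<longleftrightarrow> 0 \<le> s \<and> 0 < t \<and> (\<exists>y. joint_approx_eigen ?A ?B s t y)"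
    for s t
    by (auto simp: sigma_sharp_def taylor_spectrum_iff[OF A B' AB])
  have eig: "approx_eigen L (s\<^sup>2) y" "approx_eigen B (t\<^sup>2) y" "approx_eigen G (a\<^sup>2 * t\<^sup>2) y"
    if "joint_approx_eigen ?A ?B s t y" for s t y
  proof -
    note y = joint_approx_eigenD[OF that]
    show "approx_eigen L (s\<^sup>2) y" and b: "approx_eigen B (t\<^sup>2) y"
      using approx_eigen_compose[OF pos_opD(1)[OF A] y(2,2)]
        approx_eigen_compose[OF pos_opD(1)[OF B'] y(3,3)]
      by (simp_all add: AA BB power2_eq_square)
    show "approx_eigen G (a\<^sup>2 * t\<^sup>2) y"
      using approx_eigen_scaleR[OF b, of "a\<^sup>2"] by (simp add: GB[abs_def])
  qed
  have G_bl: "bounded_linear G"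
    unfolding GB[abs_def] by (intro bounded_linear_const_scaleR B.bounded_linear_axioms)
  interpret G: bounded_linear G by fact
  have GA: "commutes G ?A" and GB': "commutes G ?B"
    using pos_opD(1)[OF A] pos_opD(1)[OF B']
    by (simp_all add: commutes_def GB commutesD[OF BA] commutesD[OF BB'] linear_simps)
  have G_sym: "inner (G x) y = inner x (G y)" for x y
    by (simp add: GB pos_opD(2)[OF B])

  show "sigma_sharp E Q \<noteq> {}" if nz: "E \<noteq> (\<lambda>_. 0)"
  proof -
    obtain x where x: "E x \<noteq> 0" using nz by auto
    have "inner (B x) x = inner (E x) (E x)"
      by (simp add: B_def inner_cadj_left[OF E])
    \<comment> \<open>Localizing the form of B = |E|^2 itself yields a joint approximate eigenvalue
      with t^2 >= c > 0.\<close>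
    then have pos: "0 < inner (B x) x" using x by simp
    obtain s t y c where st: "0 \<le> s" "0 \<le> t" and y: "joint_approx_eigen ?A ?B s t y"
      and c: "0 < c" "\<And>n. c \<le> inner (B (y n)) (y n)"
      by (rule joint_approx_eigen_exists[OF A B' B.bounded_linear_axioms AB BA BB' pos]) (blast intro: that)
    have "c \<le> t\<^sup>2"
      using approx_eigen_inner[OF joint_approx_eigenD(1)[OF y] eig(2)[OF y]]
      by (rule LIMSEQ_le_const) (use c in blast)
    then have "t \<noteq> 0" using c(1) by auto
    then have "(s, t) \<in> sigma_sharp E Q" using st y by (auto simp: sharp)
    then show ?thesis by blast
  qed

  have dag: "dagger V E Q (complex_of_real a) = block_op V F Q"
    by (simp add: dagger_def F_def[abs_def])
  have gram_F_G: "gram F = G" and gram_Q_L: "gram Q = L"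
    by (simp_all add: fun_eq_iff gram_def G_def L_def)
  show "subnormal (dagger V E Q (complex_of_real a))
    \<longleftrightarrow> a = 0 \<or> (\<forall>(s, t)\<in>sigma_sharp E Q. s\<^sup>2 + a\<^sup>2 * t\<^sup>2 \<le> 1)"
  proof
    assume sub: "subnormal (dagger V E Q (complex_of_real a))"
    have "s\<^sup>2 + a\<^sup>2 * t\<^sup>2 \<le> 1" if "a \<noteq> 0" and st: "(s, t) \<in> sigma_sharp E Q" for s t
    proof -
      obtain y where y: "joint_approx_eigen ?A ?B s t y" and t: "0 < t"
        using st by (auto simp: sharp)
      define u w where "u = s\<^sup>2" and "w = a\<^sup>2 * t\<^sup>2"
      have w: "0 < w" using t \<open>a \<noteq> 0\<close> by (simp add: w_def)
      note n1 = joint_approx_eigenD(1)[OF y]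
      have Lu: "approx_eigen L u y" and Gw: "approx_eigen G w y"
        using eig[OF y] by (simp_all add: u_def w_def)
      have m1: "(\<lambda>n. inner (G (y n) + L (y n)) (y n)) \<longlonglongrightarrow> w + u"
        by (rule approx_eigen_inner[OF n1 approx_eigen_add[OF Gw Lu]])
      have m2: "(\<lambda>n. inner (G (y n) + G (L (y n)) + L (L (y n))) (y n)) \<longlonglongrightarrow> w + w * u + u * u"
        by (rule approx_eigen_inner[OF n1]) (intro approx_eigen_add approx_eigen_compose Gw Lu G_bl
            L.bounded_linear_axioms)
      \<comment> \<open>r = w + u is the limit of ||T h||^2 along the unit vectors h = (0, y n),
        which is the best r in the limit.\<close>
      have "2 * (w + u) * inner (G (y n) + L (y n)) (y n)
          \<le> inner (G (y n) + G (L (y n)) + L (L (y n))) (y n) + (w + u)\<^sup>2" for n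
        using subnormal_imp_paranormal[OF sub, of "w + u" "(0, y n)"] n1[of n]
        unfolding dag norm_block_op[OF cF] gram_F_G gram_Q_L by (simp add: norm_Pair)
      then have "2 * (w + u) * (w + u) \<le> (w + w * u + u * u) + (w + u)\<^sup>2"
        by (intro LIMSEQ_le[OF tendsto_mult[OF tendsto_const m1] tendsto_add[OF m2 tendsto_const]]) auto
      \<comment> \<open>The terms u^2 cancel and a factor w remains. Cancelling it needs w > 0, that
        is, t > 0 and nonzero a.\<close>
      then have "w * (u + w) \<le> w * 1" by (simp add: power2_eq_square algebra_simps)
      then have "u + w \<le> 1" by (rule mult_left_le_imp_le) (rule w)
      then show ?thesis by (simp add: u_def w_def)
    qed
    then show "a = 0 \<or> (\<forall>(s, t)\<in>sigma_sharp E Q. s\<^sup>2 + a\<^sup>2 * t\<^sup>2 \<le> 1)" by blast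
  next
    assume ass: "a = 0 \<or> (\<forall>(s, t)\<in>sigma_sharp E Q. s\<^sup>2 + a\<^sup>2 * t\<^sup>2 \<le> 1)"
    have "inner (L x + G x) (G x) \<le> inner x (G x)" for x
    proof (rule ccontr)
      define M where "M x = G (L x + G x - x)" for x
      assume "\<not> inner (L x + G x) (G x) \<le> inner x (G x)"
      then have pos: "0 < inner (M x) x"
        by (simp add: M_def G_sym inner_diff_left)
      have M_bl: "bounded_linear M"
        unfolding M_def by (intro bounded_linear_compose[OF G_bl] bounded_linear_sub
            bounded_linear_add L.bounded_linear_axioms G_bl bounded_linear_ident)
      have MA: "commutes M ?A" and MB: "commutes M ?B"
        using pos_opD(1)[OF A] pos_opD(1)[OF B']
        by (simp_all add: commutes_def M_def commutesD[OF GA] commutesD[OF GB'] commutesD[OF LA]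
            commutesD[OF LB] linear_simps[symmetric])
      obtain s t y c where st: "0 \<le> s" "0 \<le> t" and y: "joint_approx_eigen ?A ?B s t y"
        and c: "0 < c" "\<And>n. c \<le> inner (M (y n)) (y n)"
        by (rule joint_approx_eigen_exists[OF A B' M_bl AB MA MB pos]) (blast intro: that)
      have "approx_eigen M (a\<^sup>2 * t\<^sup>2 * (s\<^sup>2 + a\<^sup>2 * t\<^sup>2 - 1)) y"
        unfolding M_def[abs_def]
        by (intro approx_eigen_compose[OF G_bl] approx_eigen_diff approx_eigen_add
            approx_eigen_ident eig[OF y])
      from approx_eigen_inner[OF joint_approx_eigenD(1)[OF y] this]
      have "c \<le> a\<^sup>2 * t\<^sup>2 * (s\<^sup>2 + a\<^sup>2 * t\<^sup>2 - 1)"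
        by (rule LIMSEQ_le_const) (use c in blast)
      then have p: "0 < a\<^sup>2 * t\<^sup>2 * (s\<^sup>2 + a\<^sup>2 * t\<^sup>2 - 1)" using c(1) by linarith
      \<comment> \<open>Positivity of the product puts the point into \<open>sigma_sharp\<close>,
        where the hypothesis applies; for a = 0 it is contradictory by itself.\<close>
      then have at: "a \<noteq> 0" "t \<noteq> 0" by auto
      then have "0 < a\<^sup>2 * t\<^sup>2" by simp
      then have "1 < s\<^sup>2 + a\<^sup>2 * t\<^sup>2" using zero_less_mult_pos[OF p] by simp
      moreover have "(s, t) \<in> sigma_sharp E Q" using st y at by (auto simp: sharp)
      ultimately show False using ass at by fastforce
    qed
    then show "subnormal (dagger V E Q (complex_of_real a))"
      unfolding dag by (intro subnormal_block_op[OF cF]) (simp add: gram_F_G gram_Q_L)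
  qed
qed

section \<open>From the spectral criterion to the interval of admissible parameters\<close>

theorem theorem10p1:
  fixes V :: "'a::chilbert_space \<Rightarrow> 'a"
    and E :: "'b::chilbert_space \<Rightarrow> 'a"
    and Q :: "'b \<Rightarrow> 'b"
  assumes nontrivial: "\<exists>x::'a. x \<noteq> 0" "\<exists>y::'b. y \<noteq> 0"
    and T_in_Q: "class_Q V E Q"
    and E_nonzero: "E \<noteq> (\<lambda>_. 0)"
  shows "0 \<in> S_dagger V E Q \<and>
    (S_dagger V E Q - {0} \<noteq> {} \<longleftrightarrow>
       sigma_sharp E Q \<subseteq> {0..1} \<times> {0<..} \<and> beta_dagger E Q > 0) \<and>
    (S_dagger V E Q - {0} \<noteq> {} \<longrightarrow> S_dagger V E Q = {0..beta_dagger E Q}) \<and>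
    (sigma_sharp E Q \<subseteq> {0..1} \<times> {0<..} \<longrightarrow>
       (S_dagger V E Q = {0} \<longleftrightarrow> beta_dagger E Q = 0))"
proof -
  let ?S = "S_dagger V E Q" and ?b = "beta_dagger E Q" and ?sig = "sigma_sharp E Q"
  let ?f = "\<lambda>(s, t). sqrt ((1 - s\<^sup>2) / t\<^sup>2)"
  have S: "a \<in> ?S \<longleftrightarrow> 0 \<le> a \<and> (a = 0 \<or> (\<forall>(s, t)\<in>?sig. s\<^sup>2 + a\<^sup>2 * t\<^sup>2 \<le> 1))" for a
    by (simp add: S_dagger_def subnormal_block_op_iff[OF T_in_Q])
  have ne: "?sig \<noteq> {}" by (rule sigma_sharp_nonempty[OF T_in_Q E_nonzero])
  have sig: "0 \<le> s" "0 < t" if "(s, t) \<in> ?sig" for s t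
    using that by (auto simp: sigma_sharp_def)
  have zero: "0 \<in> ?S" by (simp add: S)
  have in_unit: "?sig \<subseteq> {0..1} \<times> {0<..}" if "a \<in> ?S" "a \<noteq> 0" for a
  proof (clarify, simp, intro conjI)
    fix s t assume st: "(s, t) \<in> ?sig"
    then have "s\<^sup>2 + a\<^sup>2 * t\<^sup>2 \<le> 1" using that by (auto simp: S)
    moreover have "0 \<le> a\<^sup>2 * t\<^sup>2" by simp
    ultimately have "s\<^sup>2 \<le> 1\<^sup>2" unfolding one_power2 by linarith
    then show "s \<le> 1" by (rule power2_le_imp_le) simp
    show "0 \<le> s" "0 < t" using sig[OF st] by auto
  qed
  \<comment> \<open>Also true for s > 1: the real \<open>sqrt\<close> is odd, hence negative there,
    and both sides fail.\<close>
  have pointwise: "s\<^sup>2 + a\<^sup>2 * t\<^sup>2 \<le> 1 \<longleftrightarrow> a \<le> sqrt ((1 - s\<^sup>2) / t\<^sup>2)" if "0 \<le> a" "0 < t" for a s t :: real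
  proof -
    have "a \<le> sqrt ((1 - s\<^sup>2) / t\<^sup>2) \<longleftrightarrow> sqrt (a\<^sup>2) \<le> sqrt ((1 - s\<^sup>2) / t\<^sup>2)"
      using that by simp
    also have "\<dots> \<longleftrightarrow> a\<^sup>2 \<le> (1 - s\<^sup>2) / t\<^sup>2" by (rule real_sqrt_le_iff)
    also have "\<dots> \<longleftrightarrow> a\<^sup>2 * t\<^sup>2 \<le> 1 - s\<^sup>2"
      using that by (simp add: pos_le_divide_eq)
    finally show ?thesis by auto
  qed
  have nn: "0 \<le> ?f p" if "?sig \<subseteq> {0..1} \<times> {0<..}" "p \<in> ?sig" for p
    using that by (cases p) (auto simp: power_le_one)
  have bound: "(\<forall>(s, t)\<in>?sig. s\<^sup>2 + a\<^sup>2 * t\<^sup>2 \<le> 1) \<longleftrightarrow> a \<le> ?b"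
    if "?sig \<subseteq> {0..1} \<times> {0<..}" "0 \<le> a" for a
  proof -
    \<comment> \<open>Nonemptiness and the lower bound 0 make \<open>INF\<close> a genuine infimum.
      A number is below it exactly when it is below every value, which is why the endpoint belongs
      to the interval.\<close>
    have "bdd_below (?f ` ?sig)" by (rule bdd_belowI2) (rule nn[OF that(1)])
    then have "a \<le> ?b \<longleftrightarrow> (\<forall>p\<in>?sig. a \<le> ?f p)"
      unfolding beta_dagger_def by (rule le_cINF_iff[OF ne])
    also have "\<dots> \<longleftrightarrow> (\<forall>(s, t)\<in>?sig. s\<^sup>2 + a\<^sup>2 * t\<^sup>2 \<le> 1)"
      using pointwise[OF that(2) sig(2)] by fastforce
    finally show ?thesis by blast
  qed
  have b_nn: "0 \<le> ?b" if "?sig \<subseteq> {0..1} \<times> {0<..}"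
    using that unfolding beta_dagger_def by (intro cINF_greatest[OF ne]) (rule nn)
  \<comment> \<open>Since the infimum is nonnegative, the exceptional value a = 0 lies in the
    interval anyway, and the equality holds even when the interval is {0}.\<close>
  have S_eq: "?S = {0..?b}" if "?sig \<subseteq> {0..1} \<times> {0<..}"
    using b_nn[OF that] bound[OF that] by (auto simp: S)
  have ii: "?S - {0} \<noteq> {} \<longleftrightarrow> ?sig \<subseteq> {0..1} \<times> {0<..} \<and> ?b > 0"
  proof
    assume "?S - {0} \<noteq> {}"
    then obtain a where a: "a \<in> ?S" "a \<noteq> 0" by blast
    have unit: "?sig \<subseteq> {0..1} \<times> {0<..}" by (rule in_unit[OF a])
    then show "?sig \<subseteq> {0..1} \<times> {0<..} \<and> ?b > 0" using a S_eq[OF unit] by auto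
  next
    assume r: "?sig \<subseteq> {0..1} \<times> {0<..} \<and> ?b > 0"
    then have "?b \<in> ?S - {0}" using S_eq by auto
    then show "?S - {0} \<noteq> {}" by blast
  qed
  have iii: "?S = {0..?b}" if "?S - {0} \<noteq> {}"
    using S_eq ii that by blast
  have iv: "?S = {0} \<longleftrightarrow> ?b = 0" if "?sig \<subseteq> {0..1} \<times> {0<..}"
    using S_eq[OF that] b_nn[OF that] by (auto simp: set_eq_iff)
  show ?thesis using zero ii iii iv by blast
qed

end
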